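(* The system $\mathsf{ACA}_0^\omega+\mathsf{BOOT}^-$ proves (the axioms of) $\mathsf{ATR}_0$.
   Context: Framework: Kohlenbach's higher-order arithmetic. $\mathsf{RCA}_0^\omega$ is the base theory in the language with variables of all finite types over $\mathbb{N}$ (basic arithmetic, combinators, primitive recursor $\mathbf{R}_0$, extensionality, quantifier-free induction, $\mathsf{QF\text{-}AC}^{1,0}$). $\mathsf{ACA}_0^\omega$ is $\mathsf{RCA}_0^\omega$ plus $(\exists^2)$: there is $\varphi^2\le 1$ with $\varphi(f)=0\leftrightarrow(\exists n)(f(n)=0)$ for all $f^1$. $\mathsf{BOOT}^-$: for every $Y^2$ (taking a function $f^1$ and a number $n$) such that for every $n\in\mathbb{N}$ there is at most one $f^1$ with $Y(f,n)=0$, there is $X\subseteq\mathbb{N}$ with $(\forall n\in\mathbb{N})(n\in X\leftrightarrow(\exists f^1)(Y(f,n)=0))$. $\mathsf{ATR}_0$ is the second-order system of arithmetical transfinite recursion. *)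

theory Defs
  imports Main
begin

section \<open>Many-sorted first-order formulas\<close>

text \<open>
  One datatype serves both languages below: the type parameter 'a is the type of atomic
  formulas and 's the type of sorts. Bound variables are de Bruijn indices counted separately
  for each sort: a variable of sort s and index i refers to the i-th enclosing quantifier
  \<^emph>\<open>of sort s\<close>, counted from the inside and starting from 0. The logic is classical, so the
  remaining connectives are defined.
\<close>

datatype ('a, 's) fm =
    Atom 'a
  | Fls
  | Imp "('a, 's) fm" "('a, 's) fm"  (infixr \<open>\<^bold>\<longrightarrow>\<close> 60)
  | All 's "('a, 's) fm"

definition Neg :: "('a, 's) fm \<Rightarrow> ('a, 's) fm"  (\<open>\<^bold>\<not> _\<close> [75] 75) where
  "\<^bold>\<not> \<phi> = (\<phi> \<^bold>\<longrightarrow> Fls)"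

definition And :: "('a, 's) fm \<Rightarrow> ('a, 's) fm \<Rightarrow> ('a, 's) fm"  (infixr \<open>\<^bold>\<and>\<close> 70) where
  "\<phi> \<^bold>\<and> \<psi> = \<^bold>\<not> (\<phi> \<^bold>\<longrightarrow> \<^bold>\<not> \<psi>)"

definition Or :: "('a, 's) fm \<Rightarrow> ('a, 's) fm \<Rightarrow> ('a, 's) fm"  (infixr \<open>\<^bold>\<or>\<close> 65) where
  "\<phi> \<^bold>\<or> \<psi> = (\<^bold>\<not> \<phi> \<^bold>\<longrightarrow> \<psi>)"

definition Iff :: "('a, 's) fm \<Rightarrow> ('a, 's) fm \<Rightarrow> ('a, 's) fm"  (infix \<open>\<^bold>\<longleftrightarrow>\<close> 55) where
  "\<phi> \<^bold>\<longleftrightarrow> \<psi> = ((\<phi> \<^bold>\<longrightarrow> \<psi>) \<^bold>\<and> (\<psi> \<^bold>\<longrightarrow> \<phi>))"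

definition Ex :: "'s \<Rightarrow> ('a, 's) fm \<Rightarrow> ('a, 's) fm" where
  "Ex s \<phi> = \<^bold>\<not> All s (\<^bold>\<not> \<phi>)"

primrec quantifier_free :: "('a, 's) fm \<Rightarrow> bool" where
  "quantifier_free (Atom a) = True"
| "quantifier_free Fls = True"
| "quantifier_free (\<phi> \<^bold>\<longrightarrow> \<psi>) = (quantifier_free \<phi> \<and> quantifier_free \<psi>)"
| "quantifier_free (All s \<phi>) = False"

text \<open>Free variables, given the variables of atomic formulas.\<close>

primrec free_vars :: "('a \<Rightarrow> ('s \<times> nat) set) \<Rightarrow> ('a, 's) fm \<Rightarrow> ('s \<times> nat) set" where
  "free_vars va (Atom a) = va a"
| "free_vars va Fls = {}"
| "free_vars va (\<phi> \<^bold>\<longrightarrow> \<psi>) = free_vars va \<phi> \<union> free_vars va \<psi>"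
| "free_vars va (All s \<phi>) =
     {(r, i). (r, if r = s then Suc i else i) \<in> free_vars va \<phi>}"

text \<open>
  Axioms with parameters stand for their universal closures. The closures of the formulas
  in A are the closed formulas obtained from members of A by prefixing universal quantifiers.
\<close>

inductive_set generalizations :: "('a, 's) fm set \<Rightarrow> ('a, 's) fm set"
  for A :: "('a, 's) fm set" where
  base: "\<phi> \<in> A \<Longrightarrow> \<phi> \<in> generalizations A"
| gen: "\<phi> \<in> generalizations A \<Longrightarrow> All s \<phi> \<in> generalizations A"

definition universal_closures ::
    "('a \<Rightarrow> ('s \<times> nat) set) \<Rightarrow> ('a, 's) fm set \<Rightarrow> ('a, 's) fm set" where
  "universal_closures va A = {\<phi> \<in> generalizations A. free_vars va \<phi> = {}}"


section \<open>The language of higher-order arithmetic\<close>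

datatype ty = N | Fun ty ty  (infixr \<open>\<leadsto>\<close> 70)

abbreviation ty1 :: ty where "ty1 \<equiv> N \<leadsto> N"
abbreviation ty2 :: ty where "ty2 \<equiv> ty1 \<leadsto> N"

datatype tm =
    Var ty nat
  | App tm tm  (infixl \<open>\<cdot>\<close> 100)
  | Zero | One | Plus | Times
  | PiC ty ty        \<comment> \<open>the combinator with \<open>\<Pi> x y = x\<close>\<close>
  | SigmaC ty ty ty  \<comment> \<open>the combinator with \<open>\<Sigma> x y z = x z (y z)\<close>\<close>
  | Rec              \<comment> \<open>the recursor \<open>R\<^sub>0\<close>\<close>

text \<open>The first argument of the recursor is a binary function on numbers, in curried form.\<close>

inductive typed :: "tm \<Rightarrow> ty \<Rightarrow> bool"  (infix \<open>\<Colon>\<close> 50) where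
  "Var \<tau> i \<Colon> \<tau>"
| "t \<Colon> \<sigma> \<leadsto> \<tau> \<Longrightarrow> u \<Colon> \<sigma> \<Longrightarrow> t \<cdot> u \<Colon> \<tau>"
| "Zero \<Colon> N"
| "One \<Colon> N"
| "Plus \<Colon> N \<leadsto> N \<leadsto> N"
| "Times \<Colon> N \<leadsto> N \<leadsto> N"
| "PiC \<rho> \<tau> \<Colon> \<rho> \<leadsto> \<tau> \<leadsto> \<rho>"
| "SigmaC \<delta> \<rho> \<tau> \<Colon> (\<delta> \<leadsto> \<rho> \<leadsto> \<tau>) \<leadsto> (\<delta> \<leadsto> \<rho>) \<leadsto> \<delta> \<leadsto> \<tau>"
| "Rec \<Colon> (N \<leadsto> N \<leadsto> N) \<leadsto> N \<leadsto> N \<leadsto> N"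

abbreviation plus_tm :: "tm \<Rightarrow> tm \<Rightarrow> tm"  (infixl \<open>\<^bold>+\<close> 90) where "t \<^bold>+ u \<equiv> Plus \<cdot> t \<cdot> u"
abbreviation times_tm :: "tm \<Rightarrow> tm \<Rightarrow> tm"  (infixl \<open>\<^bold>*\<close> 95) where "t \<^bold>* u \<equiv> Times \<cdot> t \<cdot> u"

text \<open>Equality and order are primitive on numbers only.\<close>

datatype atom = EqA tm tm | LessA tm tm

type_synonym form = "(atom, ty) fm"

abbreviation Eq :: "tm \<Rightarrow> tm \<Rightarrow> form"  (infix \<open>\<^bold>=\<close> 80) where "t \<^bold>= u \<equiv> Atom (EqA t u)"
abbreviation Less :: "tm \<Rightarrow> tm \<Rightarrow> form"  (infix \<open>\<^bold><\<close> 80) where "t \<^bold>< u \<equiv> Atom (LessA t u)"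

primrec tm_vars :: "tm \<Rightarrow> (ty \<times> nat) set" where
  "tm_vars (Var \<tau> i) = {(\<tau>, i)}"
| "tm_vars (t \<cdot> u) = tm_vars t \<union> tm_vars u"
| "tm_vars Zero = {}"
| "tm_vars One = {}"
| "tm_vars Plus = {}"
| "tm_vars Times = {}"
| "tm_vars (PiC \<rho> \<tau>) = {}"
| "tm_vars (SigmaC \<delta> \<rho> \<tau>) = {}"
| "tm_vars Rec = {}"

primrec atom_vars :: "atom \<Rightarrow> (ty \<times> nat) set" where
  "atom_vars (EqA t u) = tm_vars t \<union> tm_vars u"
| "atom_vars (LessA t u) = tm_vars t \<union> tm_vars u"

primrec wf_atom :: "atom \<Rightarrow> bool" where
  "wf_atom (EqA t u) = (t \<Colon> N \<and> u \<Colon> N)"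
| "wf_atom (LessA t u) = (t \<Colon> N \<and> u \<Colon> N)"

primrec wf_form :: "form \<Rightarrow> bool" where
  "wf_form (Atom a) = wf_atom a"
| "wf_form Fls = True"
| "wf_form (\<phi> \<^bold>\<longrightarrow> \<psi>) = (wf_form \<phi> \<and> wf_form \<psi>)"
| "wf_form (All \<tau> \<phi>) = wf_form \<phi>"


subsection \<open>Substitution\<close>

type_synonym subst = "ty \<Rightarrow> nat \<Rightarrow> tm"

primrec subst_tm :: "subst \<Rightarrow> tm \<Rightarrow> tm" where
  "subst_tm \<sigma> (Var \<tau> i) = \<sigma> \<tau> i"
| "subst_tm \<sigma> (t \<cdot> u) = subst_tm \<sigma> t \<cdot> subst_tm \<sigma> u"
| "subst_tm \<sigma> Zero = Zero"
| "subst_tm \<sigma> One = One"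
| "subst_tm \<sigma> Plus = Plus"
| "subst_tm \<sigma> Times = Times"
| "subst_tm \<sigma> (PiC \<rho> \<tau>) = PiC \<rho> \<tau>"
| "subst_tm \<sigma> (SigmaC \<delta> \<rho> \<tau>) = SigmaC \<delta> \<rho> \<tau>"
| "subst_tm \<sigma> Rec = Rec"

primrec subst_atom :: "subst \<Rightarrow> atom \<Rightarrow> atom" where
  "subst_atom \<sigma> (EqA t u) = EqA (subst_tm \<sigma> t) (subst_tm \<sigma> u)"
| "subst_atom \<sigma> (LessA t u) = LessA (subst_tm \<sigma> t) (subst_tm \<sigma> u)"

definition shift :: "ty \<Rightarrow> subst" where
  "shift \<tau> = (\<lambda>\<rho> i. Var \<rho> (if \<rho> = \<tau> then Suc i else i))"

text \<open>The term t moved under one more quantifier of type \<open>\<tau>\<close>.\<close>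

abbreviation lift_tm :: "ty \<Rightarrow> tm \<Rightarrow> tm" where
  "lift_tm \<tau> \<equiv> subst_tm (shift \<tau>)"

definition push :: "ty \<Rightarrow> subst \<Rightarrow> subst" where
  "push \<tau> \<sigma> = (\<lambda>\<rho> i. if \<rho> = \<tau>
     then (case i of 0 \<Rightarrow> Var \<tau> 0 | Suc j \<Rightarrow> lift_tm \<tau> (\<sigma> \<tau> j))
     else lift_tm \<tau> (\<sigma> \<rho> i))"

primrec subst_form :: "subst \<Rightarrow> form \<Rightarrow> form" where
  "subst_form \<sigma> (Atom a) = Atom (subst_atom \<sigma> a)"
| "subst_form \<sigma> Fls = Fls"
| "subst_form \<sigma> (\<phi> \<^bold>\<longrightarrow> \<psi>) = (subst_form \<sigma> \<phi> \<^bold>\<longrightarrow> subst_form \<sigma> \<psi>)"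
| "subst_form \<sigma> (All \<tau> \<phi>) = All \<tau> (subst_form (push \<tau> \<sigma>) \<phi>)"

abbreviation lift_form :: "ty \<Rightarrow> form \<Rightarrow> form" where
  "lift_form \<tau> \<equiv> subst_form (shift \<tau>)"

text \<open>Instantiation of the outermost variable of type \<open>\<tau>\<close>, that is, of a removed quantifier.\<close>

definition inst :: "ty \<Rightarrow> tm \<Rightarrow> form \<Rightarrow> form" where
  "inst \<tau> t = subst_form (\<lambda>\<rho> i. if \<rho> = \<tau>
     then (case i of 0 \<Rightarrow> t | Suc j \<Rightarrow> Var \<tau> j) else Var \<rho> i)"


subsection \<open>Derivability\<close>

text \<open>
  Classical many-sorted natural deduction with equality on numbers, from a set T of axioms and
  a list of local assumptions. The axioms are used with T consisting of closed formulas, so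
  only the local assumptions are lifted in the introduction rule for quantifiers.
\<close>

inductive deriv :: "form set \<Rightarrow> form list \<Rightarrow> form \<Rightarrow> bool" for T :: "form set" where
  Axiom: "\<phi> \<in> T \<Longrightarrow> deriv T \<Gamma> \<phi>"
| Assm: "\<phi> \<in> set \<Gamma> \<Longrightarrow> deriv T \<Gamma> \<phi>"
| ImpI: "wf_form \<phi> \<Longrightarrow> deriv T (\<phi> # \<Gamma>) \<psi> \<Longrightarrow> deriv T \<Gamma> (\<phi> \<^bold>\<longrightarrow> \<psi>)"
| ImpE: "deriv T \<Gamma> (\<phi> \<^bold>\<longrightarrow> \<psi>) \<Longrightarrow> deriv T \<Gamma> \<phi> \<Longrightarrow> deriv T \<Gamma> \<psi>"
| Contr: "wf_form \<phi> \<Longrightarrow> deriv T ((\<^bold>\<not> \<phi>) # \<Gamma>) Fls \<Longrightarrow> deriv T \<Gamma> \<phi>"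
| AllI: "deriv T (map (lift_form \<tau>) \<Gamma>) \<phi> \<Longrightarrow> deriv T \<Gamma> (All \<tau> \<phi>)"
| AllE: "deriv T \<Gamma> (All \<tau> \<phi>) \<Longrightarrow> t \<Colon> \<tau> \<Longrightarrow> deriv T \<Gamma> (inst \<tau> t \<phi>)"
| EqRefl: "t \<Colon> N \<Longrightarrow> deriv T \<Gamma> (t \<^bold>= t)"
| EqSubst: "wf_form \<phi> \<Longrightarrow> deriv T \<Gamma> (t \<^bold>= u) \<Longrightarrow> deriv T \<Gamma> (inst N t \<phi>)
    \<Longrightarrow> deriv T \<Gamma> (inst N u \<phi>)"

definition proves :: "form set \<Rightarrow> form \<Rightarrow> bool"  (infix \<open>\<turnstile>\<close> 50) where
  "T \<turnstile> \<phi> \<longleftrightarrow> deriv T [] \<phi>"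


section \<open>The axioms of higher-order arithmetic\<close>

text \<open>Equality of objects of higher type is defined extensionally from equality of numbers.\<close>

primrec Eqt :: "ty \<Rightarrow> tm \<Rightarrow> tm \<Rightarrow> form" where
  "Eqt N t u = (t \<^bold>= u)"
| "Eqt (\<rho> \<leadsto> \<tau>) t u =
     All \<rho> (Eqt \<tau> (lift_tm \<rho> t \<cdot> Var \<rho> 0) (lift_tm \<rho> u \<cdot> Var \<rho> 0))"

text \<open>
  The order axioms fix the successor as \<open>n + 1\<close>; with quantifier-free induction they yield
  that the numbers form a discretely ordered semiring.
\<close>

definition arith_axioms :: "form set" where
  "arith_axioms =
    (let n = Var N 0; m = Var N 1 in
     {\<^bold>\<not> (n \<^bold>+ One \<^bold>= Zero),
      (m \<^bold>+ One \<^bold>= n \<^bold>+ One) \<^bold>\<longrightarrow> (m \<^bold>= n),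
      m \<^bold>+ Zero \<^bold>= m,
      m \<^bold>+ (n \<^bold>+ One) \<^bold>= (m \<^bold>+ n) \<^bold>+ One,
      m \<^bold>* Zero \<^bold>= Zero,
      m \<^bold>* (n \<^bold>+ One) \<^bold>= (m \<^bold>* n) \<^bold>+ m,
      \<^bold>\<not> (m \<^bold>< Zero),
      (m \<^bold>< n \<^bold>+ One) \<^bold>\<longleftrightarrow> ((m \<^bold>< n) \<^bold>\<or> (m \<^bold>= n))})"

text \<open>
  The two variables of an axiom for \<open>\<Pi>\<close> may have the same type, in which case the first one
  has index 1 in the matrix; lifting covers both cases. The three variables of an axiom
  for \<open>\<Sigma>\<close> always have different types.
\<close>

definition combinator_axioms :: "form set" where
  "combinator_axioms =
     {All \<rho> (All \<tau> (let x = lift_tm \<tau> (Var \<rho> 0); y = Var \<tau> 0 in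
        Eqt \<rho> (PiC \<rho> \<tau> \<cdot> x \<cdot> y) x)) | \<rho> \<tau>. True} \<union>
     {All (\<delta> \<leadsto> \<rho> \<leadsto> \<tau>) (All (\<delta> \<leadsto> \<rho>) (All \<delta>
        (let x = Var (\<delta> \<leadsto> \<rho> \<leadsto> \<tau>) 0; y = Var (\<delta> \<leadsto> \<rho>) 0; z = Var \<delta> 0 in
        Eqt \<tau> (SigmaC \<delta> \<rho> \<tau> \<cdot> x \<cdot> y \<cdot> z) (x \<cdot> z \<cdot> (y \<cdot> z))))) | \<delta> \<rho> \<tau>. True}"

definition recursor_axioms :: "form set" where
  "recursor_axioms =
    (let f = Var (N \<leadsto> N \<leadsto> N) 0; n = Var N 0; m = Var N 1 in
     {Rec \<cdot> f \<cdot> m \<cdot> Zero \<^bold>= m,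
      Rec \<cdot> f \<cdot> m \<cdot> (n \<^bold>+ One) \<^bold>= f \<cdot> n \<cdot> (Rec \<cdot> f \<cdot> m \<cdot> n)})"

definition extensionality_axioms :: "form set" where
  "extensionality_axioms =
     {All (\<rho> \<leadsto> \<tau>) (All \<rho> (All \<rho>
        (let F = Var (\<rho> \<leadsto> \<tau>) 0; x = Var \<rho> 1; y = Var \<rho> 0 in
        Eqt \<rho> x y \<^bold>\<longrightarrow> Eqt \<tau> (F \<cdot> x) (F \<cdot> y)))) | \<rho> \<tau>. True}"

text \<open>The number variable with index 0 is the induction variable of A.\<close>

definition qf_induction :: "form set" where
  "qf_induction =
     {inst N Zero A \<^bold>\<and>
      All N (A \<^bold>\<longrightarrow>
        subst_form (\<lambda>\<rho> i. if \<rho> = N \<and> i = 0 then Var N 0 \<^bold>+ One else Var \<rho> i) A)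
      \<^bold>\<longrightarrow> All N A
      | A. wf_form A \<and> quantifier_free A}"

text \<open>
  In \<open>A(f, n)\<close> the variables f and n have index 0 in their types. Passing to \<open>A(f, Y f)\<close>
  replaces n, removes its quantifier and adds that of Y.
\<close>

definition qf_choice :: "form set" where
  "qf_choice =
     {All ty1 (Ex N A) \<^bold>\<longrightarrow>
      Ex ty2 (All ty1 (subst_form (\<lambda>\<rho> i.
        if \<rho> = N then (case i of 0 \<Rightarrow> Var ty2 0 \<cdot> Var ty1 0 | Suc j \<Rightarrow> Var N j)
        else if \<rho> = ty2 then Var ty2 (Suc i)
        else Var \<rho> i) A))
      | A. wf_form A \<and> quantifier_free A}"

definition RCA0\<omega> :: "form set" where
  "RCA0\<omega> = universal_closures atom_vars
     (arith_axioms \<union> combinator_axioms \<union> recursor_axioms \<union> extensionality_axioms \<union>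
      qf_induction \<union> qf_choice)"

text \<open>The axiom \<open>(\<exists>\<^sup>2)\<close>; \<open>\<phi> \<le> 1\<close> is meant pointwise.\<close>

definition Exists2 :: form where
  "Exists2 = Ex ty2 (let \<phi> = Var ty2 0; f = Var ty1 0 in
     All ty1 ((\<phi> \<cdot> f \<^bold>< One) \<^bold>\<or> (\<phi> \<cdot> f \<^bold>= One)) \<^bold>\<and>
     All ty1 ((\<phi> \<cdot> f \<^bold>= Zero) \<^bold>\<longleftrightarrow> Ex N (f \<cdot> Var N 0 \<^bold>= Zero)))"

definition ACA0\<omega> :: "form set" where
  "ACA0\<omega> = insert Exists2 RCA0\<omega>"

text \<open>
  Sets of numbers are represented by their characteristic functions, \<open>n \<in> X\<close> being \<open>X(n) = 1\<close>.
  The argument of the following predicate is the index of a variable of type 1.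
\<close>

definition IsSet :: "nat \<Rightarrow> form" where
  "IsSet X = All N ((Var ty1 X \<cdot> Var N 0 \<^bold>= Zero) \<^bold>\<or> (Var ty1 X \<cdot> Var N 0 \<^bold>= One))"

abbreviation InSet :: "tm \<Rightarrow> nat \<Rightarrow> form" where
  "InSet t X \<equiv> (Var ty1 X \<cdot> t \<^bold>= One)"

definition BOOT_minus :: form where
  "BOOT_minus =
    (let Y = Var (ty1 \<leadsto> N \<leadsto> N) 0; n = Var N 0 in
     All (ty1 \<leadsto> N \<leadsto> N)
      (All N (All ty1 (All ty1 (let f = Var ty1 1; g = Var ty1 0 in
         (Y \<cdot> f \<cdot> n \<^bold>= Zero) \<^bold>\<and> (Y \<cdot> g \<cdot> n \<^bold>= Zero) \<^bold>\<longrightarrow> Eqt ty1 f g)))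
       \<^bold>\<longrightarrow> Ex ty1 (IsSet 0 \<^bold>\<and>
             All N (InSet n 0 \<^bold>\<longleftrightarrow> Ex ty1 (Y \<cdot> Var ty1 0 \<cdot> n \<^bold>= Zero)))))"


section \<open>Second-order arithmetic\<close>

datatype sort2 = NumS | SetS

datatype tm2 = NVar nat | Zero2 | One2 | Plus2 tm2 tm2 | Times2 tm2 tm2

text \<open>In \<open>MemA t X\<close>, X is the index of a set variable.\<close>

datatype atom2 = EqA2 tm2 tm2 | LessA2 tm2 tm2 | MemA tm2 nat

type_synonym form2 = "(atom2, sort2) fm"

abbreviation plus_tm2 :: "tm2 \<Rightarrow> tm2 \<Rightarrow> tm2"  (infixl \<open>+\<^sub>2\<close> 90) where "t +\<^sub>2 u \<equiv> Plus2 t u"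
abbreviation times_tm2 :: "tm2 \<Rightarrow> tm2 \<Rightarrow> tm2"  (infixl \<open>*\<^sub>2\<close> 95) where "t *\<^sub>2 u \<equiv> Times2 t u"
abbreviation Eq2 :: "tm2 \<Rightarrow> tm2 \<Rightarrow> form2"  (infix \<open>=\<^sub>2\<close> 80) where "t =\<^sub>2 u \<equiv> Atom (EqA2 t u)"
abbreviation Less2 :: "tm2 \<Rightarrow> tm2 \<Rightarrow> form2"  (infix \<open><\<^sub>2\<close> 80) where "t <\<^sub>2 u \<equiv> Atom (LessA2 t u)"
abbreviation Mem :: "tm2 \<Rightarrow> nat \<Rightarrow> form2"  (infix \<open>\<in>\<^sub>2\<close> 80) where "t \<in>\<^sub>2 X \<equiv> Atom (MemA t X)"

abbreviation AllN :: "form2 \<Rightarrow> form2" where "AllN \<equiv> All NumS"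
abbreviation ExN :: "form2 \<Rightarrow> form2" where "ExN \<equiv> Ex NumS"
abbreviation AllS :: "form2 \<Rightarrow> form2" where "AllS \<equiv> All SetS"
abbreviation ExS :: "form2 \<Rightarrow> form2" where "ExS \<equiv> Ex SetS"

primrec tm2_vars :: "tm2 \<Rightarrow> (sort2 \<times> nat) set" where
  "tm2_vars (NVar i) = {(NumS, i)}"
| "tm2_vars Zero2 = {}"
| "tm2_vars One2 = {}"
| "tm2_vars (Plus2 t u) = tm2_vars t \<union> tm2_vars u"
| "tm2_vars (Times2 t u) = tm2_vars t \<union> tm2_vars u"

primrec atom2_vars :: "atom2 \<Rightarrow> (sort2 \<times> nat) set" where
  "atom2_vars (EqA2 t u) = tm2_vars t \<union> tm2_vars u"
| "atom2_vars (LessA2 t u) = tm2_vars t \<union> tm2_vars u"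
| "atom2_vars (MemA t X) = insert (SetS, X) (tm2_vars t)"

primrec arithmetical :: "form2 \<Rightarrow> bool" where
  "arithmetical (Atom a) = True"
| "arithmetical Fls = True"
| "arithmetical (\<phi> \<^bold>\<longrightarrow> \<psi>) = (arithmetical \<phi> \<and> arithmetical \<psi>)"
| "arithmetical (All s \<phi>) = (s = NumS \<and> arithmetical \<phi>)"

definition arith_axioms2 :: "form2 set" where
  "arith_axioms2 =
    (let n = NVar 0; m = NVar 1 in
     {\<^bold>\<not> (n +\<^sub>2 One2 =\<^sub>2 Zero2),
      (m +\<^sub>2 One2 =\<^sub>2 n +\<^sub>2 One2) \<^bold>\<longrightarrow> (m =\<^sub>2 n),
      m +\<^sub>2 Zero2 =\<^sub>2 m,
      m +\<^sub>2 (n +\<^sub>2 One2) =\<^sub>2 (m +\<^sub>2 n) +\<^sub>2 One2,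
      m *\<^sub>2 Zero2 =\<^sub>2 Zero2,
      m *\<^sub>2 (n +\<^sub>2 One2) =\<^sub>2 (m *\<^sub>2 n) +\<^sub>2 m,
      \<^bold>\<not> (m <\<^sub>2 Zero2),
      (m <\<^sub>2 n +\<^sub>2 One2) \<^bold>\<longleftrightarrow> ((m <\<^sub>2 n) \<^bold>\<or> (m =\<^sub>2 n))})"

definition induction_axiom2 :: form2 where
  "induction_axiom2 =
     AllS ((Zero2 \<in>\<^sub>2 0) \<^bold>\<and> AllN ((NVar 0 \<in>\<^sub>2 0) \<^bold>\<longrightarrow> (NVar 0 +\<^sub>2 One2 \<in>\<^sub>2 0))
       \<^bold>\<longrightarrow> AllN (NVar 0 \<in>\<^sub>2 0))"

definition arithmetical_comprehension :: "form2 set" where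
  "arithmetical_comprehension =
     {ExS (AllN ((NVar 0 \<in>\<^sub>2 0) \<^bold>\<longleftrightarrow> \<phi>))
      | \<phi>. arithmetical \<phi> \<and> (SetS, 0) \<notin> free_vars atom2_vars \<phi>}"

definition ACA0 :: "form2 set" where
  "ACA0 = universal_closures atom2_vars
     (arith_axioms2 \<union> {induction_axiom2} \<union> arithmetical_comprehension)"


subsection \<open>Arithmetical transfinite recursion\<close>

text \<open>The standard numerical code \<open>(i, j) = (i + j)\<^sup>2 + i\<close> of a pair.\<close>

definition pair :: "tm2 \<Rightarrow> tm2 \<Rightarrow> tm2" where
  "pair s t = (s +\<^sub>2 t) *\<^sub>2 (s +\<^sub>2 t) +\<^sub>2 s"

text \<open>A set X is viewed as the binary relation \<open>i \<le>\<^sub>X j\<close> given by \<open>(i, j) \<in> X\<close>.\<close>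

definition Fld :: "tm2 \<Rightarrow> nat \<Rightarrow> form2" where
  "Fld t X = (pair t t \<in>\<^sub>2 X)"

definition LeX :: "nat \<Rightarrow> tm2 \<Rightarrow> tm2 \<Rightarrow> form2" where
  "LeX X s t = (pair s t \<in>\<^sub>2 X)"

definition LessX :: "nat \<Rightarrow> tm2 \<Rightarrow> tm2 \<Rightarrow> form2" where
  "LessX X s t = ((pair s t \<in>\<^sub>2 X) \<^bold>\<and> \<^bold>\<not> (pair t s \<in>\<^sub>2 X))"

definition Reflexive :: "nat \<Rightarrow> form2" where
  "Reflexive X = (let j = NVar 0; i = NVar 1 in
     AllN (AllN (LeX X i j \<^bold>\<longrightarrow> Fld i X \<^bold>\<and> Fld j X)))"

definition LinearOrder :: "nat \<Rightarrow> form2" where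
  "LinearOrder X = (let k = NVar 0; j = NVar 1; i = NVar 2 in
     Reflexive X \<^bold>\<and>
     AllN (AllN (AllN (LeX X i j \<^bold>\<and> LeX X j k \<^bold>\<longrightarrow> LeX X i k)))) \<^bold>\<and>
    (let j = NVar 0; i = NVar 1 in
     AllN (AllN (LeX X i j \<^bold>\<and> LeX X j i \<^bold>\<longrightarrow> (i =\<^sub>2 j))) \<^bold>\<and>
     AllN (AllN (Fld i X \<^bold>\<and> Fld j X \<^bold>\<longrightarrow> LeX X i j \<^bold>\<or> LeX X j i)))"

text \<open>F is (the graph of) a function from the natural numbers to the field of X.\<close>

definition FunctionToFld :: "nat \<Rightarrow> nat \<Rightarrow> form2" where
  "FunctionToFld F X =
     AllN ((NVar 0 \<in>\<^sub>2 F) \<^bold>\<longrightarrow>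
       ExN (ExN (let m = NVar 0; n = NVar 1; k = NVar 2 in
         (k =\<^sub>2 pair n m) \<^bold>\<and> Fld m X))) \<^bold>\<and>
     AllN (ExN (pair (NVar 1) (NVar 0) \<in>\<^sub>2 F)) \<^bold>\<and>
     AllN (AllN (AllN (let l = NVar 0; m = NVar 1; n = NVar 2 in
       (pair n m \<in>\<^sub>2 F) \<^bold>\<and> (pair n l \<in>\<^sub>2 F) \<^bold>\<longrightarrow> (m =\<^sub>2 l))))"

definition WellFounded :: "nat \<Rightarrow> form2" where
  "WellFounded X = (Reflexive X \<^bold>\<and>
     \<^bold>\<not> ExS (let F = 0; X' = Suc X in
       FunctionToFld F X' \<^bold>\<and>
       AllN (AllN (AllN (let l = NVar 0; m = NVar 1; n = NVar 2 in
         (pair n m \<in>\<^sub>2 F) \<^bold>\<and> (pair (n +\<^sub>2 One2) l \<in>\<^sub>2 F) \<^bold>\<longrightarrow> LessX X' l m)))))"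

definition WellOrder :: "nat \<Rightarrow> form2" where
  "WellOrder X = (WellFounded X \<^bold>\<and> LinearOrder X)"

text \<open>\<open>Z = Y\<^sup>j = {(m, i). i <\<^sub>X j \<and> (m, i) \<in> Y}\<close>, where j is the index of a number variable.\<close>

definition IsSegment :: "nat \<Rightarrow> nat \<Rightarrow> nat \<Rightarrow> nat \<Rightarrow> form2" where
  "IsSegment Z X Y j =
     AllN ((NVar 0 \<in>\<^sub>2 Z) \<^bold>\<longleftrightarrow>
       ExN (ExN (let m = NVar 0; i = NVar 1; p = NVar 2; j' = NVar (j + 3) in
         (p =\<^sub>2 pair m i) \<^bold>\<and> LessX X i j' \<^bold>\<and> (pair m i \<in>\<^sub>2 Y))))"

text \<open>
  \<open>H\<^sub>\<theta>(X, Y)\<close>: X is a linear order and \<open>Y = {(n, j). j \<in> field(X) \<and> \<theta>(n, Y\<^sup>j)}\<close>.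
  Here Y and X are the set variables 0 and 1; in \<open>\<theta>(n, Z)\<close>, n is the number variable 0 and
  Z is the set variable 0. As \<open>\<theta>\<close> is placed below the quantifiers for k, j, n and Z,
  its number variables 1, 2 (which denote j, k) and its set variable 1 (which denotes Y)
  must not occur free in it. Its other free variables are parameters.
\<close>

definition Hierarchy :: "form2 \<Rightarrow> form2" where
  "Hierarchy \<theta> =
     LinearOrder 1 \<^bold>\<and>
     AllN ((NVar 0 \<in>\<^sub>2 0) \<^bold>\<longleftrightarrow>
       ExN (ExN (let n = NVar 0; j = NVar 1; k = NVar 2 in
         (k =\<^sub>2 pair n j) \<^bold>\<and> Fld j 1 \<^bold>\<and> ExS (IsSegment 0 2 1 1 \<^bold>\<and> \<theta>))))"

definition transfinite_recursion :: "form2 set" where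
  "transfinite_recursion =
     {AllS (WellOrder 0 \<^bold>\<longrightarrow> ExS (Hierarchy \<theta>))
      | \<theta>. arithmetical \<theta> \<and>
          {(NumS, 1), (NumS, 2), (SetS, 1)} \<inter> free_vars atom2_vars \<theta> = {}}"

definition ATR0 :: "form2 set" where
  "ATR0 = ACA0 \<union> universal_closures atom2_vars transfinite_recursion"


subsection \<open>Second-order arithmetic within higher-order arithmetic\<close>

text \<open>
  Set variables become variables of type 1, and quantifiers over sets are relativized to
  characteristic functions.
\<close>

primrec translate_tm :: "tm2 \<Rightarrow> tm" where
  "translate_tm (NVar i) = Var N i"
| "translate_tm Zero2 = Zero"
| "translate_tm One2 = One"
| "translate_tm (Plus2 t u) = translate_tm t \<^bold>+ translate_tm u"
| "translate_tm (Times2 t u) = translate_tm t \<^bold>* translate_tm u"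

primrec translate_atom :: "atom2 \<Rightarrow> form" where
  "translate_atom (EqA2 t u) = (translate_tm t \<^bold>= translate_tm u)"
| "translate_atom (LessA2 t u) = (translate_tm t \<^bold>< translate_tm u)"
| "translate_atom (MemA t X) = InSet (translate_tm t) X"

primrec translate :: "form2 \<Rightarrow> form" where
  "translate (Atom a) = translate_atom a"
| "translate Fls = Fls"
| "translate (\<phi> \<^bold>\<longrightarrow> \<psi>) = (translate \<phi> \<^bold>\<longrightarrow> translate \<psi>)"
| "translate (All s \<phi>) =
     (case s of NumS \<Rightarrow> All N (translate \<phi>) | SetS \<Rightarrow> All ty1 (IsSet 0 \<^bold>\<longrightarrow> translate \<phi>))"

end

theory Submission
  imports Defs "HOL-Library.Countable_Set"
begin

text \<open>
  Provability is reduced to truth by a Henkin completeness theorem: the term model of a maximal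
  consistent Henkin context, taken modulo the defined equality at all types, is a countable
  extensional model, and extensionality is what makes application well defined on it. Its numbers
  can be identified with the type nat, carrying nonstandard operations.

  In a model of \<open>ACA\<^sub>0\<^sup>\<omega> + BOOT\<^sup>-\<close>, quantifier-free choice yields characteristic functionals for
  atoms and implication and \<open>\<exists>\<^sup>2\<close> handles number quantifiers, so every arithmetical formula has a
  characteristic term. This gives arithmetical comprehension, comprehension for \<open>\<exists>Y \<phi>(Y, n)\<close> with
  \<open>\<phi>\<close> arithmetical and Y unique, and, by the recursor, dependent choice.

  Let X be a well-order. Dependent choice turns a nonempty set without least element into a
  descending sequence, so definable sets have least elements. Hence there is at most one
  hierarchy on the predecessors of each j, and the set of all (n, j) such that
  \<open>\<theta>(n, Y)\<close> holds for the hierarchy Y below j exists by BOOT. If some j had no hierarchy below it,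
  the part of this set below the least such j would be one.
\<close>

text \<open>Working in models replaces derivations in the formal calculus by ordinary mathematical
  reasoning. The price is that the numbers of a model may be nonstandard: every induction inside a
  model needs a set of that model, so definability has to be tracked explicitly.
  \<open>BOOT_minus\<close> speaks about zeros of a functional, so an arithmetical matrix can be fed
  to it only as a term with a free variable of type 1; this is why characteristic terms, and not
  just characteristic functions of sets, are built. Its uniqueness premise shapes the recursion:
  membership of (n, j) is phrased through an approximation below j, a witness that j determines. The
  same uniqueness makes "j has an approximation" an instance of \<open>BOOT_minus\<close>, and
  without the set of these j there would be no least counterexample. Quantifier-free choice picks
  numbers from functions; dependent choice on numbers arises by passing a number x as the constant
  function with value x.\<close>

instance ty :: countable by countable_datatype
instance tm :: countable by countable_datatype
instance atom :: countable by countable_datatype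
instance fm :: (countable, countable) countable by countable_datatype

text \<open>Polymorphic in the values, so that one operation extends both substitutions (values are
  terms) and assignments of a model; the syntactic and the semantic substitution lemmas then take
  the same form.\<close>

definition bind :: "ty \<Rightarrow> 'a \<Rightarrow> (ty \<Rightarrow> nat \<Rightarrow> 'a) \<Rightarrow> ty \<Rightarrow> nat \<Rightarrow> 'a" where
  "bind \<tau> a e = (\<lambda>\<rho> i. if \<rho> = \<tau> then (case i of 0 \<Rightarrow> a | Suc j \<Rightarrow> e \<tau> j) else e \<rho> i)"

lemma bind_simps [simp]:
  "bind \<tau> a e \<tau> 0 = a"
  "bind \<tau> a e \<tau> (Suc i) = e \<tau> i"
  "\<rho> \<noteq> \<tau> \<Longrightarrow> bind \<tau> a e \<rho> = e \<rho>"
  by (auto simp: bind_def)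

lemma bind_comp: "(\<lambda>\<rho> i. f \<rho> (bind \<tau> a e \<rho> i)) = bind \<tau> (f \<tau> a) (\<lambda>\<rho> i. f \<rho> (e \<rho> i))"
  by (auto simp: bind_def fun_eq_iff split: nat.splits)

lemma inst_bind: "inst \<tau> t = subst_form (bind \<tau> t Var)"
  by (simp add: inst_def bind_def)

subsection \<open>Substitution\<close>

lemma subst_tm_comp: "subst_tm \<sigma> (subst_tm \<rho> t) = subst_tm (\<lambda>\<tau> i. subst_tm \<sigma> (\<rho> \<tau> i)) t"
  by (induction t) auto

lemma subst_tm_Var [simp]: "subst_tm Var t = t"
  by (induction t) auto

lemma subst_tm_bind_lift: "subst_tm (bind \<tau> u \<sigma>) (lift_tm \<tau> t) = subst_tm \<sigma> t"
proof -
  have "(\<lambda>\<rho> i. subst_tm (bind \<tau> u \<sigma>) (shift \<tau> \<rho> i)) = \<sigma>"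
    by (auto simp: fun_eq_iff shift_def)
  then show ?thesis by (simp add: subst_tm_comp)
qed

lemma push_bind: "push \<tau> \<sigma> = bind \<tau> (Var \<tau> 0) (\<lambda>\<rho> i. lift_tm \<tau> (\<sigma> \<rho> i))"
  by (simp add: push_def bind_def)

lemma subst_tm_push_lift: "subst_tm (push \<tau> \<sigma>) (lift_tm \<tau> t) = lift_tm \<tau> (subst_tm \<sigma> t)"
  unfolding push_bind subst_tm_bind_lift by (rule subst_tm_comp[symmetric])

lemma subst_tm_bind_push:
  "subst_tm (bind \<tau> u \<sigma>) (push \<tau> s \<rho> i) = bind \<tau> u (\<lambda>\<rho> i. subst_tm \<sigma> (s \<rho> i)) \<rho> i"
  by (cases i; cases "\<rho> = \<tau>") (simp_all add: push_bind subst_tm_bind_lift)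

lemma push_comp:
  "(\<lambda>\<rho> i. subst_tm (push \<tau> \<sigma>) (push \<tau> s \<rho> i)) = push \<tau> (\<lambda>\<rho> i. subst_tm \<sigma> (s \<rho> i))"
  unfolding push_bind[of _ \<sigma>] subst_tm_bind_push
  by (simp add: push_bind subst_tm_comp)

lemma push_Var [simp]: "push \<tau> Var = Var"
  by (auto simp: push_def shift_def fun_eq_iff split: nat.splits)

lemma subst_form_comp:
  "subst_form \<sigma> (subst_form \<rho> \<phi>) = subst_form (\<lambda>\<tau> i. subst_tm \<sigma> (\<rho> \<tau> i)) \<phi>"
proof (induction \<phi> arbitrary: \<sigma> \<rho>)
  case (Atom a)
  then show ?case by (cases a) (auto simp: subst_tm_comp)
qed (auto simp: push_comp)

lemma subst_form_Var [simp]: "subst_form Var \<phi> = \<phi>"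
proof (induction \<phi>)
  case (Atom a)
  then show ?case by (cases a) auto
qed auto

lemma inst_push: "inst \<tau> t (subst_form (push \<tau> \<sigma>) \<phi>) = subst_form (bind \<tau> t \<sigma>) \<phi>"
  unfolding inst_bind subst_form_comp subst_tm_bind_push by simp

lemma subst_inst: "subst_form \<sigma> (inst \<tau> t \<phi>) = subst_form (bind \<tau> (subst_tm \<sigma> t) \<sigma>) \<phi>"
  using bind_comp[of "\<lambda>_. subst_tm \<sigma>" \<tau> t Var] by (simp add: inst_bind subst_form_comp)

lemma subst_inst_push:
  "subst_form \<sigma> (inst \<tau> t \<phi>) = inst \<tau> (subst_tm \<sigma> t) (subst_form (push \<tau> \<sigma>) \<phi>)"
  by (simp add: inst_push subst_inst)

lemma subst_push_lift:
  "subst_form (push \<tau> \<sigma>) (lift_form \<tau> \<phi>) = lift_form \<tau> (subst_form \<sigma> \<phi>)"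
proof -
  have "(\<lambda>\<rho> i. subst_tm (push \<tau> \<sigma>) (shift \<tau> \<rho> i)) = (\<lambda>\<rho> i. lift_tm \<tau> (\<sigma> \<rho> i))"
    by (auto simp: fun_eq_iff shift_def push_def)
  then show ?thesis by (simp add: subst_form_comp)
qed

lemma subst_tm_cong:
  "(\<And>\<tau> i. (\<tau>, i) \<in> tm_vars t \<Longrightarrow> \<sigma> \<tau> i = \<sigma>' \<tau> i) \<Longrightarrow> subst_tm \<sigma> t = subst_tm \<sigma>' t"
  by (induction t) auto

lemma subst_form_cong:
  "(\<And>\<tau> i. (\<tau>, i) \<in> free_vars atom_vars \<phi> \<Longrightarrow> \<sigma> \<tau> i = \<sigma>' \<tau> i)
    \<Longrightarrow> subst_form \<sigma> \<phi> = subst_form \<sigma>' \<phi>"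
proof (induction \<phi> arbitrary: \<sigma> \<sigma>')
  case (Atom a)
  then show ?case by (cases a) (auto intro!: subst_tm_cong)
next
  case (All \<tau> \<phi>)
  have "subst_form (push \<tau> \<sigma>) \<phi> = subst_form (push \<tau> \<sigma>') \<phi>"
  proof (rule All.IH)
    fix \<rho> i assume i: "(\<rho>, i) \<in> free_vars atom_vars \<phi>"
    show "push \<tau> \<sigma> \<rho> i = push \<tau> \<sigma>' \<rho> i"
    proof (cases "\<rho> = \<tau>")
      case True
      then show ?thesis using i All.prems[of \<tau> "i - 1"] by (cases i) (simp_all add: push_def)
    next
      case False
      then show ?thesis using i All.prems[of \<rho> i] by (simp add: push_def)
    qed
  qed
  then show ?case by simp
next
  case (Imp \<phi> \<psi>)
  have "subst_form \<sigma> \<phi> = subst_form \<sigma>' \<phi>" by (rule Imp.IH(1)) (simp add: Imp.prems)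
  moreover have "subst_form \<sigma> \<psi> = subst_form \<sigma>' \<psi>" by (rule Imp.IH(2)) (simp add: Imp.prems)
  ultimately show ?case by simp
qed simp

lemma subst_form_closed: "free_vars atom_vars \<phi> = {} \<Longrightarrow> subst_form \<sigma> \<phi> = \<phi>"
  using subst_form_cong[of \<phi> \<sigma> Var] by simp

lemma finite_tm_vars: "finite (tm_vars t)"
  by (induction t) auto

lemma finite_free_vars:
  assumes "\<And>a. finite (va a)"
  shows "finite (free_vars va \<phi>)"
proof (induction \<phi>)
  case (All s \<phi>)
  \<comment> \<open>The predecessor keeps a bound index 0 at 0, so in general only an inclusion
    holds; finiteness needs no more.\<close>
  have "free_vars va (All s \<phi>) \<subseteq> (\<lambda>(r, i). (r, if r = s then i - 1 else i)) ` free_vars va \<phi>"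
    by (force simp: image_iff)
  then show ?case using All.IH finite_surj by blast
qed (use assms in auto)

lemma finite_atom_vars: "finite (atom_vars a)"
  by (cases a) (auto simp: finite_tm_vars)

section \<open>Well-typed substitutions\<close>

definition typed_subst :: "subst \<Rightarrow> bool" where
  "typed_subst \<sigma> \<longleftrightarrow> (\<forall>\<tau> i. \<sigma> \<tau> i \<Colon> \<tau>)"

lemma typed_subst_tm: "t \<Colon> \<tau> \<Longrightarrow> typed_subst \<sigma> \<Longrightarrow> subst_tm \<sigma> t \<Colon> \<tau>"
  by (induction rule: typed.induct) (auto simp: typed_subst_def intro: typed.intros)

lemma typed_subst_Var: "typed_subst Var"
  by (auto simp: typed_subst_def intro: typed.intros)

lemma typed_subst_shift: "typed_subst (shift \<tau>)"
  by (auto simp: typed_subst_def shift_def intro: typed.intros)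

lemma typed_subst_bind: "typed_subst \<sigma> \<Longrightarrow> t \<Colon> \<tau> \<Longrightarrow> typed_subst (bind \<tau> t \<sigma>)"
  by (auto simp: typed_subst_def bind_def split: nat.splits)

lemma typed_subst_push: "typed_subst \<sigma> \<Longrightarrow> typed_subst (push \<tau> \<sigma>)"
  unfolding push_bind
  by (rule typed_subst_bind)
    (auto simp: typed_subst_def intro: typed.intros intro!: typed_subst_tm[OF _ typed_subst_shift])

lemma wf_subst: "wf_form \<phi> \<Longrightarrow> typed_subst \<sigma> \<Longrightarrow> wf_form (subst_form \<sigma> \<phi>)"
proof (induction \<phi> arbitrary: \<sigma>)
  case (Atom a)
  then show ?case by (cases a) (auto intro: typed_subst_tm)
qed (auto intro: typed_subst_push)

lemma wf_inst: "wf_form \<phi> \<Longrightarrow> t \<Colon> \<tau> \<Longrightarrow> wf_form (inst \<tau> t \<phi>)"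
  by (simp add: inst_bind wf_subst typed_subst_bind typed_subst_Var)

inductive_cases typed_VarE: "Var \<rho> i \<Colon> \<tau>"
inductive_cases typed_AppE: "t \<cdot> u \<Colon> \<tau>"
inductive_cases typed_constE: "Zero \<Colon> \<tau>" "One \<Colon> \<tau>" "Plus \<Colon> \<tau>" "Times \<Colon> \<tau>"
  "PiC \<rho> \<sigma> \<Colon> \<tau>" "SigmaC \<delta> \<rho> \<sigma> \<Colon> \<tau>" "Rec \<Colon> \<tau>"

text \<open>A term determines its type, which is why \<open>rp\<close> and \<open>lam\<close> can
  later be chosen from a term without naming its type.\<close>

lemma typed_unique: "t \<Colon> \<tau> \<Longrightarrow> t \<Colon> \<tau>' \<Longrightarrow> \<tau> = \<tau>'"
  by (induction arbitrary: \<tau>' rule: typed.induct)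
    (blast elim: typed_VarE typed_AppE typed_constE)+

lemma subst_Eqt: "subst_form \<sigma> (Eqt \<tau> t u) = Eqt \<tau> (subst_tm \<sigma> t) (subst_tm \<sigma> u)"
  by (induction \<tau> arbitrary: \<sigma> t u) (auto simp: subst_tm_push_lift, auto simp: push_def)

lemma wf_Eqt: "t \<Colon> \<tau> \<Longrightarrow> u \<Colon> \<tau> \<Longrightarrow> wf_form (Eqt \<tau> t u)"
proof (induction \<tau> arbitrary: t u)
  case (Fun \<rho> \<tau>)
  have "lift_tm \<rho> s \<cdot> Var \<rho> 0 \<Colon> \<tau>" if "s \<Colon> \<rho> \<leadsto> \<tau>" for s
    by (rule typed.intros(2)[OF typed_subst_tm[OF that typed_subst_shift] typed.intros(1)])
  then show ?case using Fun by simp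
qed simp

subsection \<open>Derivations\<close>

text \<open>Contexts are compared as sets, which covers weakening, exchange and contraction at once
  and lets derivations from different stages of the Henkin construction be combined.\<close>

lemma deriv_weaken: "deriv T \<Gamma> \<phi> \<Longrightarrow> set \<Gamma> \<subseteq> set \<Gamma>' \<Longrightarrow> deriv T \<Gamma>' \<phi>"
proof (induction arbitrary: \<Gamma>' rule: deriv.induct)
  case (ImpI \<phi> \<Gamma> \<psi>)
  have "deriv T (\<phi> # \<Gamma>') \<psi>" using ImpI.prems by (intro ImpI.IH) auto
  then show ?case using ImpI.hyps deriv.ImpI by blast
next
  case (Contr \<phi> \<Gamma>)
  have "deriv T ((\<^bold>\<not> \<phi>) # \<Gamma>') Fls" using Contr.prems by (intro Contr.IH) auto
  then show ?case using Contr.hyps deriv.Contr by blast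
next
  case (AllI \<tau> \<Gamma> \<phi>)
  have "deriv T (map (lift_form \<tau>) \<Gamma>') \<phi>" using AllI.prems by (intro AllI.IH) auto
  then show ?case by (rule deriv.AllI)
next
  case (ImpE \<Gamma> \<phi> \<psi>)
  then show ?case using deriv.ImpE by blast
next
  case (AllE \<Gamma> \<tau> \<phi> t)
  then show ?case by (simp add: deriv.AllE)
next
  case (EqSubst \<phi> \<Gamma> t u)
  then show ?case using deriv.EqSubst[of \<phi> T \<Gamma>' t u] by simp
qed (auto intro: deriv.Axiom deriv.Assm deriv.EqRefl)

text \<open>The axioms survive unchanged because they are closed. Its purpose is to rename a fresh
  free variable to the index 0 that \<open>AllI\<close> generalizes.\<close>

lemma deriv_subst:
  assumes closed: "\<And>\<phi>. \<phi> \<in> T \<Longrightarrow> free_vars atom_vars \<phi> = {}"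
  shows "deriv T \<Gamma> \<phi> \<Longrightarrow> typed_subst \<sigma> \<Longrightarrow> deriv T (map (subst_form \<sigma>) \<Gamma>) (subst_form \<sigma> \<phi>)"
proof (induction arbitrary: \<sigma> rule: deriv.induct)
  case (Axiom \<phi> \<Gamma>)
  then show ?case by (simp add: closed subst_form_closed deriv.Axiom)
next
  case (ImpI \<phi> \<Gamma> \<psi>)
  then show ?case by (simp add: deriv.ImpI wf_subst)
next
  case (ImpE \<Gamma> \<phi> \<psi>)
  have "deriv T (map (subst_form \<sigma>) \<Gamma>) (subst_form \<sigma> \<phi> \<^bold>\<longrightarrow> subst_form \<sigma> \<psi>)"
    using ImpE.IH(1)[OF ImpE.prems] by simp
  then show ?case by (rule deriv.ImpE) (rule ImpE.IH(2)[OF ImpE.prems])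
next
  case (Contr \<phi> \<Gamma>)
  then show ?case using deriv.Contr[of "subst_form \<sigma> \<phi>" T "map (subst_form \<sigma>) \<Gamma>"]
    by (simp add: Neg_def wf_subst)
next
  case (AllI \<tau> \<Gamma> \<phi>)
  have "deriv T (map (lift_form \<tau>) (map (subst_form \<sigma>) \<Gamma>)) (subst_form (push \<tau> \<sigma>) \<phi>)"
    using AllI.IH[OF typed_subst_push[OF AllI.prems, of \<tau>]] by (simp add: comp_def subst_push_lift)
  then show ?case by (simp add: deriv.AllI)
next
  case (AllE \<Gamma> \<tau> \<phi> t)
  have "deriv T (map (subst_form \<sigma>) \<Gamma>) (All \<tau> (subst_form (push \<tau> \<sigma>) \<phi>))"
    using AllE.IH[OF AllE.prems] by simp
  then show ?case
    unfolding subst_inst_push by (rule deriv.AllE) (intro typed_subst_tm AllE)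
next
  case (EqRefl t \<Gamma>)
  then show ?case by (auto intro!: deriv.EqRefl typed_subst_tm)
next
  case (EqSubst \<phi> \<Gamma> t u)
  have i: "deriv T (map (subst_form \<sigma>) \<Gamma>) (inst N (subst_tm \<sigma> t) (subst_form (push N \<sigma>) \<phi>))"
    using EqSubst.IH(2)[OF EqSubst.prems] by (simp add: subst_inst_push)
  have e: "deriv T (map (subst_form \<sigma>) \<Gamma>) (subst_tm \<sigma> t \<^bold>= subst_tm \<sigma> u)"
    using EqSubst.IH(1)[OF EqSubst.prems] by simp
  have "wf_form (subst_form (push N \<sigma>) \<phi>)"
    by (intro wf_subst typed_subst_push EqSubst)
  from deriv.EqSubst[OF this e i] show ?case unfolding subst_inst_push .
qed (auto intro: deriv.Assm)

subsection \<open>Models\<close>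

text \<open>A HOL type cannot depend on a \<open>ty\<close>, so one carrier holds the objects of all
  finite types and \<open>dom\<close> sorts them. Evaluation consults \<open>cst\<close> at
  constants only.\<close>

record 'u hmodel =
  dom :: "ty \<Rightarrow> 'u set"
  ap :: "'u \<Rightarrow> 'u \<Rightarrow> 'u"
  cst :: "tm \<Rightarrow> 'u"
  lt :: "'u \<Rightarrow> 'u \<Rightarrow> bool"

primrec eval :: "'u hmodel \<Rightarrow> (ty \<Rightarrow> nat \<Rightarrow> 'u) \<Rightarrow> tm \<Rightarrow> 'u" where
  "eval M e (Var \<tau> i) = e \<tau> i"
| "eval M e (t \<cdot> u) = ap M (eval M e t) (eval M e u)"
| "eval M e Zero = cst M Zero"
| "eval M e One = cst M One"
| "eval M e Plus = cst M Plus"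
| "eval M e Times = cst M Times"
| "eval M e (PiC \<rho> \<tau>) = cst M (PiC \<rho> \<tau>)"
| "eval M e (SigmaC \<delta> \<rho> \<tau>) = cst M (SigmaC \<delta> \<rho> \<tau>)"
| "eval M e Rec = cst M Rec"

primrec holds_atom :: "'u hmodel \<Rightarrow> (ty \<Rightarrow> nat \<Rightarrow> 'u) \<Rightarrow> atom \<Rightarrow> bool" where
  "holds_atom M e (EqA t u) \<longleftrightarrow> eval M e t = eval M e u"
| "holds_atom M e (LessA t u) \<longleftrightarrow> lt M (eval M e t) (eval M e u)"

primrec holds :: "'u hmodel \<Rightarrow> (ty \<Rightarrow> nat \<Rightarrow> 'u) \<Rightarrow> form \<Rightarrow> bool" where
  "holds M e (Atom a) \<longleftrightarrow> holds_atom M e a"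
| "holds M e Fls \<longleftrightarrow> False"
| "holds M e (\<phi> \<^bold>\<longrightarrow> \<psi>) \<longleftrightarrow> (holds M e \<phi> \<longrightarrow> holds M e \<psi>)"
| "holds M e (All \<tau> \<phi>) \<longleftrightarrow> (\<forall>a\<in>dom M \<tau>. holds M (bind \<tau> a e) \<phi>)"

definition valid :: "'u hmodel \<Rightarrow> (ty \<Rightarrow> nat \<Rightarrow> 'u) \<Rightarrow> bool" where
  "valid M e \<longleftrightarrow> (\<forall>\<tau> i. e \<tau> i \<in> dom M \<tau>)"

text \<open>A valid assignment exists only if every domain is nonempty. The last conjunct,
  extensionality, is what turns the defined equality \<open>Eqt\<close> into identity.\<close>

definition wf_hmodel :: "'u hmodel \<Rightarrow> bool" where
  "wf_hmodel M \<longleftrightarrow> (\<exists>e. valid M e) \<and>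
     (\<forall>e t \<tau>. valid M e \<longrightarrow> t \<Colon> \<tau> \<longrightarrow> eval M e t \<in> dom M \<tau>) \<and>
     (\<forall>\<rho> \<tau>. \<forall>f\<in>dom M (\<rho> \<leadsto> \<tau>). \<forall>a\<in>dom M \<rho>. ap M f a \<in> dom M \<tau>) \<and>
     (\<forall>\<rho> \<tau>. \<forall>f\<in>dom M (\<rho> \<leadsto> \<tau>). \<forall>g\<in>dom M (\<rho> \<leadsto> \<tau>).
       (\<forall>a\<in>dom M \<rho>. ap M f a = ap M g a) \<longrightarrow> f = g)"

subsection \<open>Maximal consistent Henkin contexts\<close>

locale henkin =
  fixes T :: "form set" and \<phi>0 :: form
  assumes closed: "\<And>\<phi>. \<phi> \<in> T \<Longrightarrow> free_vars atom_vars \<phi> = {}"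
    and wfT: "\<And>\<phi>. \<phi> \<in> T \<Longrightarrow> wf_form \<phi>"
    and ext: "extensionality_axioms \<subseteq> T"
    and wf0: "wf_form \<phi>0"
    and notderiv: "\<not> deriv T [] \<phi>0"
begin

definition fresh :: "ty \<Rightarrow> form list \<Rightarrow> nat" where
  "fresh \<tau> \<Gamma> = (SOME k. \<forall>\<phi>\<in>set \<Gamma>. (\<tau>, k) \<notin> free_vars atom_vars \<phi>)"

lemma fresh: "\<phi> \<in> set \<Gamma> \<Longrightarrow> (\<tau>, fresh \<tau> \<Gamma>) \<notin> free_vars atom_vars \<phi>"
proof -
  let ?A = "\<Union>\<phi>\<in>set \<Gamma>. free_vars atom_vars \<phi>"
  have "finite (snd ` ?A)" by (auto intro: finite_free_vars finite_atom_vars)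
  then obtain k where "k \<notin> snd ` ?A" by (meson ex_new_if_finite infinite_UNIV_nat)
  then have "\<forall>\<phi>\<in>set \<Gamma>. (\<tau>, k) \<notin> free_vars atom_vars \<phi>" by force
  then have "\<forall>\<phi>\<in>set \<Gamma>. (\<tau>, fresh \<tau> \<Gamma>) \<notin> free_vars atom_vars \<phi>"
    unfolding fresh_def by (rule someI)
  then show "\<phi> \<in> set \<Gamma> \<Longrightarrow> ?thesis" by blast
qed

text \<open>Henkin witnesses are free variables and not new constants: a context is a finite list
  and each type has infinitely many indices, so the language need not grow. Negated universal
  formulas always have the matched shape, since negation abbreviates an implication.\<close>

definition witness :: "form \<Rightarrow> form list \<Rightarrow> form list" where
  "witness \<psi> \<Gamma> = (case \<psi> of
     (All \<tau> \<chi> \<^bold>\<longrightarrow> Fls) \<Rightarrow> (\<^bold>\<not> inst \<tau> (Var \<tau> (fresh \<tau> (\<psi> # \<Gamma>))) \<chi>) # \<psi> # \<Gamma>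
   | _ \<Rightarrow> \<psi> # \<Gamma>)"

definition extend :: "form \<Rightarrow> form list \<Rightarrow> form list" where
  "extend \<psi> \<Gamma> = (if wf_form \<psi> \<and> \<not> deriv T (\<psi> # \<Gamma>) Fls then witness \<psi> \<Gamma> else \<Gamma>)"

primrec ctx :: "nat \<Rightarrow> form list" where
  "ctx 0 = [\<^bold>\<not> \<phi>0]"
| "ctx (Suc n) = extend (from_nat n) (ctx n)"

text \<open>Derivability from the union of the stages: a derivation uses finitely many assumptions
  and the stages increase, so one stage is enough.\<close>

definition dv :: "form \<Rightarrow> bool" where
  "dv \<phi> \<longleftrightarrow> (\<exists>n. deriv T (ctx n) \<phi>)"

lemma witness_superset: "insert \<psi> (set \<Gamma>) \<subseteq> set (witness \<psi> \<Gamma>)"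
  by (auto simp: witness_def split: fm.splits)

lemma ctx_mono: "n \<le> m \<Longrightarrow> set (ctx n) \<subseteq> set (ctx m)"
proof (induction m)
  case (Suc m)
  then show ?case using witness_superset[of "from_nat m" "ctx m"]
    by (auto simp: extend_def le_Suc_eq)
qed simp

text \<open>\<open>AllI\<close> generalizes index 0, but the fresh variable has index k. The
  substitution \<open>\<sigma>\<close> renames k to 0 and lifts everything else: on
  \<open>\<Gamma>\<close>, where k does not occur, this is the lift that \<open>AllI\<close> asks
  for, and on the instance it restores \<open>\<chi>\<close>.\<close>

lemma generalize_fresh:
  assumes "deriv T \<Gamma> (inst \<tau> (Var \<tau> k) \<chi>)"
    and "\<And>\<phi>. \<phi> \<in> set \<Gamma> \<Longrightarrow> (\<tau>, k) \<notin> free_vars atom_vars \<phi>"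
    and "(\<tau>, k) \<notin> free_vars atom_vars (All \<tau> \<chi>)"
  shows "deriv T \<Gamma> (All \<tau> \<chi>)"
proof -
  define \<sigma> where "\<sigma> = (\<lambda>\<rho> i. if \<rho> = \<tau> \<and> i = k then Var \<tau> 0 else shift \<tau> \<rho> i)"
  have "typed_subst \<sigma>"
    using typed_subst_shift[of \<tau>] by (auto simp: typed_subst_def \<sigma>_def intro: typed.intros)
  with assms(1) have d: "deriv T (map (subst_form \<sigma>) \<Gamma>) (subst_form \<sigma> (inst \<tau> (Var \<tau> k) \<chi>))"
    by (intro deriv_subst closed)
  have "map (subst_form \<sigma>) \<Gamma> = map (lift_form \<tau>) \<Gamma>"
    using assms(2) by (auto intro!: subst_form_cong simp: \<sigma>_def)
  moreover have "subst_form \<sigma> (inst \<tau> (Var \<tau> k) \<chi>) = subst_form Var \<chi>"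
    unfolding subst_inst
  proof (rule subst_form_cong)
    fix \<rho> i assume "(\<rho>, i) \<in> free_vars atom_vars \<chi>"
    then show "bind \<tau> (subst_tm \<sigma> (Var \<tau> k)) \<sigma> \<rho> i = Var \<rho> i"
      using assms(3) by (auto simp: bind_def \<sigma>_def shift_def split: nat.splits)
  qed
  ultimately have "deriv T (map (lift_form \<tau>) \<Gamma>) \<chi>" using d by (metis subst_form_Var)
  then show ?thesis by (rule deriv.AllI)
qed

text \<open>Inconsistency would yield, by \<open>Contr\<close>, the instance at a fresh variable,
  hence the universal formula itself, against its negation \<open>\<psi>\<close>.\<close>

lemma witness_consistent:
  assumes "wf_form \<psi>" "\<not> deriv T (\<psi> # \<Gamma>) Fls"
  shows "\<not> deriv T (witness \<psi> \<Gamma>) Fls"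
proof (cases "\<exists>\<tau> \<chi>. \<psi> = (All \<tau> \<chi> \<^bold>\<longrightarrow> Fls)")
  case True
  then obtain \<tau> \<chi> where \<psi>: "\<psi> = (All \<tau> \<chi> \<^bold>\<longrightarrow> Fls)" by blast
  define k where "k = fresh \<tau> (\<psi> # \<Gamma>)"
  show ?thesis
  proof
    assume "deriv T (witness \<psi> \<Gamma>) Fls"
    then have "deriv T ((\<^bold>\<not> inst \<tau> (Var \<tau> k) \<chi>) # \<psi> # \<Gamma>) Fls"
      by (simp add: witness_def \<psi> k_def)
    moreover have "wf_form (inst \<tau> (Var \<tau> k) \<chi>)"
      using assms(1) \<psi> by (auto intro!: wf_inst typed.intros)
    ultimately have "deriv T (\<psi> # \<Gamma>) (inst \<tau> (Var \<tau> k) \<chi>)" by (rule deriv.Contr[rotated])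
    then have "deriv T (\<psi> # \<Gamma>) (All \<tau> \<chi>)"
    proof (rule generalize_fresh)
      fix \<phi> assume "\<phi> \<in> set (\<psi> # \<Gamma>)"
      then show "(\<tau>, k) \<notin> free_vars atom_vars \<phi>" unfolding k_def by (rule fresh)
    next
      have "(\<tau>, k) \<notin> free_vars atom_vars \<psi>" unfolding k_def by (rule fresh) simp
      then show "(\<tau>, k) \<notin> free_vars atom_vars (All \<tau> \<chi>)" by (simp add: \<psi>)
    qed
    moreover have "deriv T (\<psi> # \<Gamma>) (All \<tau> \<chi> \<^bold>\<longrightarrow> Fls)" by (rule deriv.Assm) (simp add: \<psi>)
    ultimately show False using assms(2) deriv.ImpE by blast
  qed
next
  case False
  then have "witness \<psi> \<Gamma> = \<psi> # \<Gamma>" by (auto simp: witness_def split: fm.splits)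
  then show ?thesis using assms by simp
qed

lemma ctx_consistent: "\<not> deriv T (ctx n) Fls"
proof (induction n)
  case 0
  then show ?case using notderiv wf0 by (auto dest: deriv.Contr)
next
  case (Suc n)
  then show ?case by (auto simp: extend_def dest: witness_consistent[rotated])
qed

lemma dv_consistent: "\<not> dv Fls"
  by (simp add: dv_def ctx_consistent)

lemma dv_ImpE: "dv (\<phi> \<^bold>\<longrightarrow> \<psi>) \<Longrightarrow> dv \<phi> \<Longrightarrow> dv \<psi>"
proof -
  assume "dv (\<phi> \<^bold>\<longrightarrow> \<psi>)" "dv \<phi>"
  then obtain n m where "deriv T (ctx n) (\<phi> \<^bold>\<longrightarrow> \<psi>)" "deriv T (ctx m) \<phi>" by (auto simp: dv_def)
  then have "deriv T (ctx (max n m)) (\<phi> \<^bold>\<longrightarrow> \<psi>)" "deriv T (ctx (max n m)) \<phi>"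
    by (auto elim!: deriv_weaken intro!: ctx_mono)
  then show ?thesis unfolding dv_def using deriv.ImpE by blast
qed

lemma wf_Neg [simp]: "wf_form (\<^bold>\<not> \<phi>) = wf_form \<phi>"
  by (simp add: Neg_def)

text \<open>The formula is examined at stage \<open>to_nat \<psi>\<close>. It is accepted there,
  because inconsistency with that stage would derive its negation.\<close>

lemma dv_stage:
  assumes "wf_form \<psi>" "\<not> dv (\<^bold>\<not> \<psi>)"
  shows "\<exists>n. set (witness \<psi> (ctx n)) \<subseteq> set (ctx (Suc n))"
proof -
  let ?n = "to_nat \<psi>"
  have "\<not> deriv T (\<psi> # ctx ?n) Fls"
    using assms unfolding dv_def Neg_def using deriv.ImpI by blast
  then show ?thesis using assms by (intro exI[of _ ?n]) (simp add: extend_def)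
qed

lemma dv_max: "wf_form \<psi> \<Longrightarrow> dv \<psi> \<or> dv (\<^bold>\<not> \<psi>)"
proof (rule disjCI)
  assume "wf_form \<psi>" "\<not> dv (\<^bold>\<not> \<psi>)"
  then obtain n where "\<psi> \<in> set (ctx (Suc n))" using dv_stage witness_superset by blast
  then show "dv \<psi>" unfolding dv_def using deriv.Assm by blast
qed

lemma dv_Imp:
  assumes "wf_form \<phi>" "wf_form \<psi>"
  shows "dv (\<phi> \<^bold>\<longrightarrow> \<psi>) \<longleftrightarrow> (dv \<phi> \<longrightarrow> dv \<psi>)"
proof
  assume "dv \<phi> \<longrightarrow> dv \<psi>"
  then consider "dv \<psi>" | "dv (\<^bold>\<not> \<phi>)" using dv_max assms by blast
  then show "dv (\<phi> \<^bold>\<longrightarrow> \<psi>)"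
  proof cases
    case 1
    then obtain n where "deriv T (ctx n) \<psi>" by (auto simp: dv_def)
    then have "deriv T (\<phi> # ctx n) \<psi>" by (rule deriv_weaken) auto
    then show ?thesis unfolding dv_def using deriv.ImpI assms by blast
  next
    case 2
    then obtain n where "deriv T (ctx n) (\<^bold>\<not> \<phi>)" by (auto simp: dv_def)
    then have "deriv T ((\<^bold>\<not> \<psi>) # \<phi> # ctx n) (\<phi> \<^bold>\<longrightarrow> Fls)"
      unfolding Neg_def by (rule deriv_weaken) auto
    moreover have "deriv T ((\<^bold>\<not> \<psi>) # \<phi> # ctx n) \<phi>" by (rule deriv.Assm) simp
    ultimately have "deriv T ((\<^bold>\<not> \<psi>) # \<phi> # ctx n) Fls" by (rule deriv.ImpE)
    then show ?thesis unfolding dv_def using deriv.ImpI deriv.Contr assms by blast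
  qed
qed (use dv_ImpE in blast)

text \<open>If the universal formula is not derivable, its negation is by maximality, and the stage
  accepting the negation also adds a refuted instance.\<close>

lemma dv_All:
  assumes "wf_form \<phi>"
  shows "dv (All \<tau> \<phi>) \<longleftrightarrow> (\<forall>t. t \<Colon> \<tau> \<longrightarrow> dv (inst \<tau> t \<phi>))"
proof (intro iffI allI impI)
  fix t assume "dv (All \<tau> \<phi>)" "t \<Colon> \<tau>"
  then show "dv (inst \<tau> t \<phi>)" unfolding dv_def using deriv.AllE by blast
next
  assume all: "\<forall>t. t \<Colon> \<tau> \<longrightarrow> dv (inst \<tau> t \<phi>)"
  show "dv (All \<tau> \<phi>)"
  proof (rule ccontr)
    assume n: "\<not> dv (All \<tau> \<phi>)"
    let ?\<psi> = "All \<tau> \<phi> \<^bold>\<longrightarrow> Fls"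
    have wf: "wf_form ?\<psi>" using assms by simp
    have d\<psi>: "dv ?\<psi>" using n dv_max[of "All \<tau> \<phi>"] assms by (simp add: Neg_def)
    then have "\<not> dv (\<^bold>\<not> ?\<psi>)" using dv_ImpE dv_consistent unfolding Neg_def by blast
    from dv_stage[OF wf this] obtain n where
      "(\<^bold>\<not> inst \<tau> (Var \<tau> (fresh \<tau> (?\<psi> # ctx n))) \<phi>) \<in> set (ctx (Suc n))"
      by (auto simp: witness_def)
    then have "dv (\<^bold>\<not> inst \<tau> (Var \<tau> (fresh \<tau> (?\<psi> # ctx n))) \<phi>)"
      unfolding dv_def using deriv.Assm by blast
    moreover have "dv (inst \<tau> (Var \<tau> (fresh \<tau> (?\<psi> # ctx n))) \<phi>)"
      using all by (simp add: typed.intros)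
    ultimately show False using dv_ImpE dv_consistent unfolding Neg_def by blast
  qed
qed

lemma dv_T: "\<phi> \<in> T \<Longrightarrow> dv \<phi>"
  unfolding dv_def using deriv.Axiom by blast

lemma dv_EqRefl: "t \<Colon> N \<Longrightarrow> dv (t \<^bold>= t)"
  unfolding dv_def using deriv.EqRefl by blast

lemma dv_EqSubst:
  assumes "wf_form \<phi>" "dv (t \<^bold>= u)" "dv (inst N t \<phi>)"
  shows "dv (inst N u \<phi>)"
proof -
  from assms obtain n m where "deriv T (ctx n) (t \<^bold>= u)" "deriv T (ctx m) (inst N t \<phi>)"
    by (auto simp: dv_def)
  then have "deriv T (ctx (max n m)) (t \<^bold>= u)" "deriv T (ctx (max n m)) (inst N t \<phi>)"
    by (auto elim!: deriv_weaken intro!: ctx_mono)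
  then show ?thesis unfolding dv_def using deriv.EqSubst assms(1) by blast
qed

subsection \<open>The extensional term model\<close>

text \<open>A substitution plays the role of an assignment, so that the truth lemma can be proved by
  induction on formulas with free variables.\<close>

definition hold :: "subst \<Rightarrow> form \<Rightarrow> bool" where
  "hold s \<phi> \<longleftrightarrow> dv (subst_form s \<phi>)"

lemma hold_Imp:
  assumes "typed_subst s" "wf_form \<phi>" "wf_form \<psi>"
  shows "hold s (\<phi> \<^bold>\<longrightarrow> \<psi>) \<longleftrightarrow> (hold s \<phi> \<longrightarrow> hold s \<psi>)"
  using assms by (simp add: hold_def dv_Imp wf_subst)

lemma hold_All:
  assumes "typed_subst s" "wf_form \<phi>"
  shows "hold s (All \<tau> \<phi>) \<longleftrightarrow> (\<forall>t. t \<Colon> \<tau> \<longrightarrow> hold (bind \<tau> t s) \<phi>)"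
  using assms by (simp add: hold_def dv_All wf_subst typed_subst_push inst_push)

definition eqv :: "ty \<Rightarrow> tm \<Rightarrow> tm \<Rightarrow> bool" where
  "eqv \<tau> t u \<longleftrightarrow> dv (Eqt \<tau> t u)"

lemma lift_typed: "t \<Colon> \<tau> \<Longrightarrow> lift_tm \<rho> t \<Colon> \<tau>"
  by (simp add: typed_subst_shift typed_subst_tm)

lemma eqv_N_replace:
  assumes "eqv N t u" "wf_form \<phi>" "dv (subst_form (bind N t Var) \<phi>)"
  shows "dv (subst_form (bind N u Var) \<phi>)"
  using assms dv_EqSubst by (simp add: eqv_def inst_bind)

text \<open>Replace the left-hand side of t = t. The hole is number variable 0, so the fixed side
  has to be lifted.\<close>

lemma eqv_N_sym:
  assumes "t \<Colon> N" "eqv N t u"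
  shows "eqv N u t"
  using eqv_N_replace[OF assms(2), of "Var N 0 \<^bold>= lift_tm N t"] assms
  by (simp add: subst_tm_bind_lift eqv_def dv_EqRefl lift_typed typed.intros)

lemma eqv_N_trans:
  assumes "t \<Colon> N" "eqv N t u" "eqv N u v"
  shows "eqv N t v"
  using eqv_N_replace[OF assms(3), of "lift_tm N t \<^bold>= Var N 0"] assms
  by (simp add: subst_tm_bind_lift eqv_def lift_typed typed.intros)

lemma less_cong1:
  assumes "w \<Colon> N" "eqv N t u" "dv (t \<^bold>< w)"
  shows "dv (u \<^bold>< w)"
  using eqv_N_replace[OF assms(2), of "Var N 0 \<^bold>< lift_tm N w"] assms
  by (simp add: subst_tm_bind_lift lift_typed typed.intros)

lemma less_cong2:
  assumes "w \<Colon> N" "eqv N t u" "dv (w \<^bold>< t)"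
  shows "dv (w \<^bold>< u)"
  using eqv_N_replace[OF assms(2), of "lift_tm N w \<^bold>< Var N 0"] assms
  by (simp add: subst_tm_bind_lift lift_typed typed.intros)

lemma eqv_Fun:
  assumes "t \<Colon> \<rho> \<leadsto> \<tau>" "u \<Colon> \<rho> \<leadsto> \<tau>"
  shows "eqv (\<rho> \<leadsto> \<tau>) t u \<longleftrightarrow> (\<forall>a. a \<Colon> \<rho> \<longrightarrow> eqv \<tau> (t \<cdot> a) (u \<cdot> a))"
proof -
  have "wf_form (Eqt \<tau> (lift_tm \<rho> t \<cdot> Var \<rho> 0) (lift_tm \<rho> u \<cdot> Var \<rho> 0))"
    using assms by (intro wf_Eqt) (blast intro: typed.intros lift_typed)+
  then show ?thesis
    by (simp add: eqv_def dv_All inst_bind subst_Eqt subst_tm_bind_lift)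
qed

lemma eqv_refl: "t \<Colon> \<tau> \<Longrightarrow> eqv \<tau> t t"
proof (induction \<tau> arbitrary: t)
  case N
  then show ?case by (simp add: eqv_def dv_EqRefl)
next
  case (Fun \<rho> \<tau>)
  then show ?case by (simp add: eqv_Fun typed.intros(2)[of t \<rho>])
qed

lemma eqv_sym: "t \<Colon> \<tau> \<Longrightarrow> u \<Colon> \<tau> \<Longrightarrow> eqv \<tau> t u \<Longrightarrow> eqv \<tau> u t"
proof (induction \<tau> arbitrary: t u)
  case N
  then show ?case by (simp add: eqv_N_sym)
next
  case (Fun \<rho> \<tau>)
  show ?case
    unfolding eqv_Fun[OF Fun.prems(2,1)]
  proof (intro allI impI)
    fix a assume a: "a \<Colon> \<rho>"
    then have "eqv \<tau> (t \<cdot> a) (u \<cdot> a)" using Fun.prems eqv_Fun by blast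
    then show "eqv \<tau> (u \<cdot> a) (t \<cdot> a)"
      by (rule Fun.IH(2)[rotated 2]) (rule typed.intros(2)[OF Fun.prems(1) a] typed.intros(2)[OF Fun.prems(2) a])+
  qed
qed

lemma eqv_trans:
  "t \<Colon> \<tau> \<Longrightarrow> u \<Colon> \<tau> \<Longrightarrow> v \<Colon> \<tau> \<Longrightarrow> eqv \<tau> t u \<Longrightarrow> eqv \<tau> u v \<Longrightarrow> eqv \<tau> t v"
proof (induction \<tau> arbitrary: t u v)
  case N
  then show ?case using eqv_N_trans by blast
next
  case (Fun \<rho> \<tau>)
  show ?case
    unfolding eqv_Fun[OF Fun.prems(1,3)]
  proof (intro allI impI)
    fix a assume a: "a \<Colon> \<rho>"
    then have "eqv \<tau> (t \<cdot> a) (u \<cdot> a)" "eqv \<tau> (u \<cdot> a) (v \<cdot> a)"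
      using Fun.prems eqv_Fun by blast+
    then show "eqv \<tau> (t \<cdot> a) (v \<cdot> a)"
      using Fun.IH(2) Fun.prems(1-3)[THEN typed.intros(2), OF a] by blast
  qed
qed

text \<open>The definition of \<open>Eqt\<close> makes equality a congruence in function position
  only; congruence in argument position comes from the extensionality axiom.\<close>

lemma eqv_arg:
  assumes F: "F \<Colon> \<rho> \<leadsto> \<tau>" and x: "x \<Colon> \<rho>" and y: "y \<Colon> \<rho>" and xy: "eqv \<rho> x y"
  shows "eqv \<tau> (F \<cdot> x) (F \<cdot> y)"
proof -
  let ?b1 = "Eqt \<rho> (Var \<rho> 1) (Var \<rho> 0)"
  let ?b2 = "Eqt \<tau> (Var (\<rho> \<leadsto> \<tau>) 0 \<cdot> Var \<rho> 1) (Var (\<rho> \<leadsto> \<tau>) 0 \<cdot> Var \<rho> 0)"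
  let ?s = "bind \<rho> y (bind \<rho> x (bind (\<rho> \<leadsto> \<tau>) F Var))"
  \<comment> \<open>The variable for F must not be captured by the binders for x and y; no type is a
    proper part of itself, by size.\<close>
  have ne: "\<rho> \<leadsto> \<tau> \<noteq> \<rho>"
  proof
    assume "\<rho> \<leadsto> \<tau> = \<rho>"
    then have "size (\<rho> \<leadsto> \<tau>) = size \<rho>" by simp
    then show False by simp
  qed
  have wf: "wf_form ?b1" "wf_form ?b2" by (auto intro!: wf_Eqt intro: typed.intros)
  have s1: "typed_subst (bind (\<rho> \<leadsto> \<tau>) F Var)"
    using F by (intro typed_subst_bind typed_subst_Var)
  then have s2: "typed_subst (bind \<rho> x (bind (\<rho> \<leadsto> \<tau>) F Var))" using x by (rule typed_subst_bind)
  then have s3: "typed_subst ?s" using y by (rule typed_subst_bind)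
  have "All (\<rho> \<leadsto> \<tau>) (All \<rho> (All \<rho> (?b1 \<^bold>\<longrightarrow> ?b2))) \<in> extensionality_axioms"
    unfolding extensionality_axioms_def Let_def by blast
  then have "dv (All (\<rho> \<leadsto> \<tau>) (All \<rho> (All \<rho> (?b1 \<^bold>\<longrightarrow> ?b2))))" using ext dv_T by blast
  then have "hold Var (All (\<rho> \<leadsto> \<tau>) (All \<rho> (All \<rho> (?b1 \<^bold>\<longrightarrow> ?b2))))"
    unfolding hold_def subst_form_Var .
  then have "hold (bind (\<rho> \<leadsto> \<tau>) F Var) (All \<rho> (All \<rho> (?b1 \<^bold>\<longrightarrow> ?b2)))"
    using F wf by (subst (asm) hold_All) (auto intro: typed_subst_Var)
  then have "hold (bind \<rho> x (bind (\<rho> \<leadsto> \<tau>) F Var)) (All \<rho> (?b1 \<^bold>\<longrightarrow> ?b2))"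
    using x wf s1 by (subst (asm) hold_All) auto
  then have "hold ?s (?b1 \<^bold>\<longrightarrow> ?b2)"
    using y wf s2 by (subst (asm) hold_All) auto
  then have "hold ?s ?b1 \<longrightarrow> hold ?s ?b2"
    using wf s3 by (simp add: hold_Imp)
  then show ?thesis using ne xy by (simp add: hold_def subst_Eqt eqv_def)
qed

text \<open>Representatives instead of equivalence classes keep the elements of the model terms, so
  its carrier stays countable.\<close>

definition rp :: "tm \<Rightarrow> tm" where
  "rp t = (SOME u. \<exists>\<tau>. t \<Colon> \<tau> \<and> u \<Colon> \<tau> \<and> eqv \<tau> t u)"

lemma rp: assumes "t \<Colon> \<tau>" shows rp_typed: "rp t \<Colon> \<tau>" and rp_eqv: "eqv \<tau> t (rp t)"
proof -
  have "\<exists>\<tau>. t \<Colon> \<tau> \<and> rp t \<Colon> \<tau> \<and> eqv \<tau> t (rp t)"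
    unfolding rp_def by (rule someI[of _ t]) (use assms eqv_refl in blast)
  then show "rp t \<Colon> \<tau>" "eqv \<tau> t (rp t)" using assms typed_unique by blast+
qed

text \<open>Equivalent terms give the choice operator the same predicate, hence the same
  choice.\<close>

lemma rp_cong: assumes "t \<Colon> \<tau>" "u \<Colon> \<tau>" "eqv \<tau> t u" shows "rp t = rp u"
proof -
  have "(\<exists>\<tau>. t \<Colon> \<tau> \<and> w \<Colon> \<tau> \<and> eqv \<tau> t w) \<longleftrightarrow> (\<exists>\<tau>. u \<Colon> \<tau> \<and> w \<Colon> \<tau> \<and> eqv \<tau> u w)" for w
  proof -
    have "(\<exists>\<tau>. t \<Colon> \<tau> \<and> w \<Colon> \<tau> \<and> eqv \<tau> t w) \<longleftrightarrow> w \<Colon> \<tau> \<and> eqv \<tau> t w"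
      using assms(1) typed_unique by blast
    also have "\<dots> \<longleftrightarrow> w \<Colon> \<tau> \<and> eqv \<tau> u w"
      using eqv_trans[OF assms(1,2)] eqv_trans[OF assms(2,1)] eqv_sym[OF assms] assms(3) by blast
    also have "\<dots> \<longleftrightarrow> (\<exists>\<tau>. u \<Colon> \<tau> \<and> w \<Colon> \<tau> \<and> eqv \<tau> u w)"
      using assms(2) typed_unique by blast
    finally show ?thesis .
  qed
  then show ?thesis by (simp add: rp_def)
qed

lemma rp_eq_iff: assumes "t \<Colon> \<tau>" "u \<Colon> \<tau>" shows "rp t = rp u \<longleftrightarrow> eqv \<tau> t u"
proof
  assume "rp t = rp u"
  then have "eqv \<tau> (rp t) u"
    using eqv_sym[OF assms(2) rp[OF assms(2)]] by simp
  then show "eqv \<tau> t u" using eqv_trans[OF assms(1) rp_typed[OF assms(1)] assms(2)]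
    rp_eqv[OF assms(1)] by blast
qed (use assms rp_cong in blast)

lemma rp_rp: "t \<Colon> \<tau> \<Longrightarrow> rp (rp t) = rp t"
  by (rule rp_cong[symmetric]) (rule rp_typed rp_eqv | assumption)+

text \<open>The argument is exchanged by extensionality, the function by the definition of equality
  at a function type.\<close>

lemma rp_App: assumes "t \<Colon> \<rho> \<leadsto> \<tau>" "u \<Colon> \<rho>" shows "rp (rp t \<cdot> rp u) = rp (t \<cdot> u)"
proof -
  have "eqv \<tau> (t \<cdot> u) (t \<cdot> rp u)" using assms rp by (intro eqv_arg)
  moreover have "eqv \<tau> (t \<cdot> rp u) (rp t \<cdot> rp u)"
    using assms rp eqv_Fun[of t \<rho> \<tau> "rp t"] by blast
  moreover have "t \<cdot> u \<Colon> \<tau>" "t \<cdot> rp u \<Colon> \<tau>" "rp t \<cdot> rp u \<Colon> \<tau>"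
    by (rule typed.intros(2)[of _ \<rho>]; intro assms rp_typed)+
  ultimately show ?thesis
    using rp_cong[of "t \<cdot> u" \<tau>] rp_cong[of "t \<cdot> rp u" \<tau>] by simp
qed

definition model :: "tm hmodel" where
  "model = \<lparr>dom = (\<lambda>\<tau>. {t. t \<Colon> \<tau> \<and> rp t = t}), ap = (\<lambda>a b. rp (a \<cdot> b)), cst = rp,
     lt = (\<lambda>a b. dv (a \<^bold>< b))\<rparr>"

lemma eval_model:
  "t \<Colon> \<tau> \<Longrightarrow> typed_subst s \<Longrightarrow> eval model (\<lambda>\<tau> i. rp (s \<tau> i)) t = rp (subst_tm s t)"
proof (induction rule: typed.induct)
  case (2 t \<sigma> \<tau> u)
  have "ap model (rp (subst_tm s t)) (rp (subst_tm s u)) = rp (subst_tm s t \<cdot> subst_tm s u)"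
    using rp_App[OF typed_subst_tm[OF 2(1,5)] typed_subst_tm[OF 2(2,5)]] by (simp add: model_def)
  then show ?case using 2 by simp
qed (simp_all add: model_def)

lemma rp_dom: "t \<Colon> \<tau> \<Longrightarrow> rp t \<in> dom model \<tau>"
  by (simp add: model_def rp_typed rp_rp)

lemma valid_model_typed: "valid model e \<Longrightarrow> typed_subst e"
  by (simp add: valid_def model_def typed_subst_def)

lemma valid_model_rp: "valid model e \<Longrightarrow> (\<lambda>\<tau> i. rp (e \<tau> i)) = e"
  by (simp add: valid_def model_def fun_eq_iff)

lemma valid_rp: "typed_subst s \<Longrightarrow> valid model (\<lambda>\<tau> i. rp (s \<tau> i))"
  unfolding valid_def typed_subst_def using rp_dom by blast

text \<open>Truth lemma. Each element of a domain is the representative of some term, so the model's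
  quantifiers and the instances in \<open>hold_All\<close> range over the same objects.\<close>

lemma holds_model:
  "wf_form \<phi> \<Longrightarrow> typed_subst s \<Longrightarrow> holds model (\<lambda>\<tau> i. rp (s \<tau> i)) \<phi> \<longleftrightarrow> hold s \<phi>"
proof (induction \<phi> arbitrary: s)
  case (Atom a)
  show ?case
  proof (cases a)
    case (EqA t u)
    then have "t \<Colon> N" "u \<Colon> N" using Atom by auto
    then show ?thesis
      using EqA rp_eq_iff[of "subst_tm s t" N "subst_tm s u"] typed_subst_tm Atom.prems
      by (simp add: eval_model hold_def eqv_def)
  next
    case (LessA t u)
    then have tu: "t \<Colon> N" "u \<Colon> N" using Atom by auto
    then have *: "subst_tm s t \<Colon> N" "subst_tm s u \<Colon> N" using typed_subst_tm Atom.prems by auto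
    have r: "eqv N (rp (subst_tm s t)) (subst_tm s t)" "eqv N (rp (subst_tm s u)) (subst_tm s u)"
      using rp * eqv_sym by blast+
    have "dv (rp (subst_tm s t) \<^bold>< rp (subst_tm s u)) \<longleftrightarrow> dv (rp (subst_tm s t) \<^bold>< subst_tm s u)"
      using less_cong2[OF rp_typed[OF *(1)]] r(2) rp_eqv[OF *(2)] by blast
    also have "\<dots> \<longleftrightarrow> dv (subst_tm s t \<^bold>< subst_tm s u)"
      using less_cong1[OF *(2)] r(1) rp_eqv[OF *(1)] by blast
    finally have "dv (rp (subst_tm s t) \<^bold>< rp (subst_tm s u)) \<longleftrightarrow> dv (subst_tm s t \<^bold>< subst_tm s u)" .
    moreover have "holds model (\<lambda>\<tau> i. rp (s \<tau> i)) (Atom a) \<longleftrightarrow>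
        dv (rp (subst_tm s t) \<^bold>< rp (subst_tm s u))"
      using LessA eval_model[OF tu(1) Atom.prems(2)] eval_model[OF tu(2) Atom.prems(2)]
      by (simp add: model_def)
    ultimately show ?thesis by (simp add: hold_def LessA)
  qed
next
  case Fls
  then show ?case by (simp add: hold_def dv_consistent)
next
  case (Imp \<phi> \<psi>)
  then show ?case by (simp add: hold_Imp)
next
  case (All \<tau> \<phi>)
  have *: "holds model (bind \<tau> (rp t) (\<lambda>\<tau> i. rp (s \<tau> i))) \<phi> \<longleftrightarrow> hold (bind \<tau> t s) \<phi>" if "t \<Colon> \<tau>" for t
    using All.IH[of "bind \<tau> t s"] All.prems that bind_comp[of "\<lambda>_. rp" \<tau> t s]
    by (simp add: typed_subst_bind)
  have "holds model (\<lambda>\<tau> i. rp (s \<tau> i)) (All \<tau> \<phi>) \<longleftrightarrow>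
      (\<forall>t. t \<Colon> \<tau> \<longrightarrow> holds model (bind \<tau> (rp t) (\<lambda>\<tau> i. rp (s \<tau> i))) \<phi>)"
  proof -
    have "dom model \<tau> = rp ` {t. t \<Colon> \<tau>}"
      using rp_dom by (force simp: model_def image_iff)
    then show ?thesis by auto
  qed
  also have "\<dots> \<longleftrightarrow> hold s (All \<tau> \<phi>)"
    using * All.prems by (simp add: hold_All)
  finally show ?case .
qed

lemma wf_model: "wf_hmodel model"
  unfolding wf_hmodel_def
proof (intro conjI allI impI ballI)
  show "\<exists>e. valid model e" using valid_rp typed_subst_Var by blast
next
  fix e t \<tau> assume "valid model e" "t \<Colon> \<tau>"
  then show "eval model e t \<in> dom model \<tau>"
    using eval_model[of t \<tau> e] valid_model_rp[of e] valid_model_typed[of e] typed_subst_tm[of t \<tau> e] rp_dom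
    by simp
next
  fix \<rho> \<tau> f a assume "f \<in> dom model (\<rho> \<leadsto> \<tau>)" "a \<in> dom model \<rho>"
  then have "f \<cdot> a \<Colon> \<tau>" by (simp add: model_def typed.intros(2)[of f \<rho>])
  then show "ap model f a \<in> dom model \<tau>"
    using rp_dom by (simp add: model_def)
next
  fix \<rho> \<tau> f g
  assume f: "f \<in> dom model (\<rho> \<leadsto> \<tau>)" and g: "g \<in> dom model (\<rho> \<leadsto> \<tau>)"
    and eq: "\<forall>a\<in>dom model \<rho>. ap model f a = ap model g a"
  then have fg: "f \<Colon> \<rho> \<leadsto> \<tau>" "g \<Colon> \<rho> \<leadsto> \<tau>" "rp f = f" "rp g = g" by (auto simp: model_def)
  have "eqv \<tau> (f \<cdot> a) (g \<cdot> a)" if a: "a \<Colon> \<rho>" for a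
  proof -
    have "rp a \<in> dom model \<rho>" using a by (rule rp_dom)
    then have "rp (rp f \<cdot> rp a) = rp (rp g \<cdot> rp a)" using eq fg by (simp add: model_def)
    then have "rp (f \<cdot> a) = rp (g \<cdot> a)"
      using rp_App[OF fg(1) a] rp_App[OF fg(2) a] by simp
    then show ?thesis
      using rp_eq_iff[OF typed.intros(2)[OF fg(1) a] typed.intros(2)[OF fg(2) a]] by simp
  qed
  then have "eqv (\<rho> \<leadsto> \<tau>) f g" using eqv_Fun fg by blast
  then show "f = g" using rp_cong[OF fg(1,2)] fg(3,4) by simp
qed

lemma model_T: "\<phi> \<in> T \<Longrightarrow> valid model e \<Longrightarrow> holds model e \<phi>"
  using holds_model[OF wfT valid_model_typed, of \<phi> e] valid_model_rp[of e]
  by (simp add: hold_def subst_form_closed closed dv_T)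

lemma model_not: "\<not> holds model (\<lambda>\<tau> i. rp (Var \<tau> i)) \<phi>0"
proof
  assume "holds model (\<lambda>\<tau> i. rp (Var \<tau> i)) \<phi>0"
  then have "hold Var \<phi>0" using holds_model[OF wf0 typed_subst_Var] by simp
  then have "dv \<phi>0" unfolding hold_def subst_form_Var .
  moreover have "dv (\<^bold>\<not> \<phi>0)" unfolding dv_def by (rule exI[of _ 0]) (auto intro: deriv.Assm)
  ultimately show False using dv_ImpE dv_consistent unfolding Neg_def by blast
qed

end

text \<open>Models with carrier \<open>tm\<close> suffice, because the countermodel is the term
  model; this is also where the countability of the number domain comes from.\<close>

theorem completeness:
  assumes "\<And>\<psi>. \<psi> \<in> T \<Longrightarrow> free_vars atom_vars \<psi> = {}" "\<And>\<psi>. \<psi> \<in> T \<Longrightarrow> wf_form \<psi>"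
    and "extensionality_axioms \<subseteq> T" and "wf_form \<phi>"
    and "\<And>(M :: tm hmodel) e. wf_hmodel M \<Longrightarrow> (\<And>e \<psi>. \<psi> \<in> T \<Longrightarrow> valid M e \<Longrightarrow> holds M e \<psi>) \<Longrightarrow>
      valid M e \<Longrightarrow> holds M e \<phi>"
  shows "T \<turnstile> \<phi>"
  unfolding proves_def
proof (rule ccontr)
  assume "\<not> deriv T [] \<phi>"
  then interpret henkin T \<phi> using assms by unfold_locales auto
  show False
    using assms(5)[OF wf_model model_T valid_rp[OF typed_subst_Var]] model_not by blast
qed

subsection \<open>Semantics of formulas\<close>

text \<open>A computable form of typing: through \<open>typed_iff\<close> the simplifier settles the
  typing conditions of concrete terms.\<close>

primrec typeof :: "tm \<Rightarrow> ty option" where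
  "typeof (Var \<tau> i) = Some \<tau>"
| "typeof (t \<cdot> u) = (case typeof t of Some (\<sigma> \<leadsto> \<tau>) \<Rightarrow> if typeof u = Some \<sigma> then Some \<tau> else None
     | _ \<Rightarrow> None)"
| "typeof Zero = Some N"
| "typeof One = Some N"
| "typeof Plus = Some (N \<leadsto> N \<leadsto> N)"
| "typeof Times = Some (N \<leadsto> N \<leadsto> N)"
| "typeof (PiC \<rho> \<tau>) = Some (\<rho> \<leadsto> \<tau> \<leadsto> \<rho>)"
| "typeof (SigmaC \<delta> \<rho> \<tau>) = Some ((\<delta> \<leadsto> \<rho> \<leadsto> \<tau>) \<leadsto> (\<delta> \<leadsto> \<rho>) \<leadsto> \<delta> \<leadsto> \<tau>)"
| "typeof Rec = Some ((N \<leadsto> N \<leadsto> N) \<leadsto> N \<leadsto> N \<leadsto> N)"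

lemma typed_iff: "t \<Colon> \<tau> \<longleftrightarrow> typeof t = Some \<tau>"
proof
  show "t \<Colon> \<tau> \<Longrightarrow> typeof t = Some \<tau>" by (induction rule: typed.induct) auto
  show "typeof t = Some \<tau> \<Longrightarrow> t \<Colon> \<tau>"
  proof (induction t arbitrary: \<tau>)
    case (App t u)
    then obtain \<sigma> where "typeof t = Some (\<sigma> \<leadsto> \<tau>)" "typeof u = Some \<sigma>"
      by (auto split: option.splits ty.splits if_splits)
    then show ?case using App.IH typed.intros(2) by blast
  qed (auto intro: typed.intros)
qed

lemma fun_ty_neq [simp]:
  "\<rho> \<leadsto> \<tau> \<noteq> \<rho>" "\<rho> \<leadsto> \<tau> \<noteq> \<tau>" "\<rho> \<noteq> \<rho> \<leadsto> \<tau>" "\<tau> \<noteq> \<rho> \<leadsto> \<tau>" "\<delta> \<leadsto> \<rho> \<leadsto> \<tau> \<noteq> \<delta>" "\<delta> \<noteq> \<delta> \<leadsto> \<rho> \<leadsto> \<tau>"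
proof -
  have *: "size \<sigma> \<noteq> size \<sigma>' \<Longrightarrow> \<sigma> \<noteq> \<sigma>'" for \<sigma> \<sigma>' :: ty by blast
  show "\<rho> \<leadsto> \<tau> \<noteq> \<rho>" "\<rho> \<leadsto> \<tau> \<noteq> \<tau>" "\<rho> \<noteq> \<rho> \<leadsto> \<tau>" "\<tau> \<noteq> \<rho> \<leadsto> \<tau>" "\<delta> \<leadsto> \<rho> \<leadsto> \<tau> \<noteq> \<delta>" "\<delta> \<noteq> \<delta> \<leadsto> \<rho> \<leadsto> \<tau>"
    by (rule *; simp)+
qed

lemma holds_connectives [simp]:
  "holds M e (\<^bold>\<not> \<phi>) \<longleftrightarrow> \<not> holds M e \<phi>"
  "holds M e (\<phi> \<^bold>\<and> \<psi>) \<longleftrightarrow> holds M e \<phi> \<and> holds M e \<psi>"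
  "holds M e (\<phi> \<^bold>\<or> \<psi>) \<longleftrightarrow> holds M e \<phi> \<or> holds M e \<psi>"
  "holds M e (\<phi> \<^bold>\<longleftrightarrow> \<psi>) \<longleftrightarrow> (holds M e \<phi> \<longleftrightarrow> holds M e \<psi>)"
  "holds M e (Ex \<tau> \<phi>) \<longleftrightarrow> (\<exists>a\<in>dom M \<tau>. holds M (bind \<tau> a e) \<phi>)"
  by (auto simp: Neg_def And_def Or_def Iff_def Ex_def)

lemma wf_connectives [simp]:
  "wf_form (\<^bold>\<not> \<phi>) \<longleftrightarrow> wf_form \<phi>"
  "wf_form (\<phi> \<^bold>\<and> \<psi>) \<longleftrightarrow> wf_form \<phi> \<and> wf_form \<psi>"
  "wf_form (\<phi> \<^bold>\<or> \<psi>) \<longleftrightarrow> wf_form \<phi> \<and> wf_form \<psi>"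
  "wf_form (\<phi> \<^bold>\<longleftrightarrow> \<psi>) \<longleftrightarrow> wf_form \<phi> \<and> wf_form \<psi>"
  "wf_form (Ex \<tau> \<phi>) \<longleftrightarrow> wf_form \<phi>"
  by (auto simp: Neg_def And_def Or_def Iff_def Ex_def)

lemma eval_subst: "eval M e (subst_tm \<sigma> t) = eval M (\<lambda>\<tau> i. eval M e (\<sigma> \<tau> i)) t"
  by (induction t) auto

lemma eval_lift [simp]: "eval M (bind \<tau> a e) (lift_tm \<tau> t) = eval M e t"
proof -
  have "(\<lambda>\<rho> i. eval M (bind \<tau> a e) (shift \<tau> \<rho> i)) = e"
    by (auto simp: fun_eq_iff shift_def)
  then show ?thesis by (simp add: eval_subst)
qed

lemma eval_bind_push:
  "(\<lambda>\<rho> i. eval M (bind \<tau> a e) (push \<tau> \<sigma> \<rho> i)) = bind \<tau> a (\<lambda>\<rho> i. eval M e (\<sigma> \<rho> i))"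
proof (intro ext)
  fix \<rho> i
  show "eval M (bind \<tau> a e) (push \<tau> \<sigma> \<rho> i) = bind \<tau> a (\<lambda>\<rho> i. eval M e (\<sigma> \<rho> i)) \<rho> i"
    by (cases i; cases "\<rho> = \<tau>") (simp_all add: push_bind)
qed

lemma holds_subst: "holds M e (subst_form \<sigma> \<phi>) \<longleftrightarrow> holds M (\<lambda>\<tau> i. eval M e (\<sigma> \<tau> i)) \<phi>"
proof (induction \<phi> arbitrary: e \<sigma>)
  case (Atom a)
  then show ?case by (cases a) (auto simp: eval_subst)
qed (auto simp: eval_bind_push)

lemma valid_bind [intro]: "valid M e \<Longrightarrow> a \<in> dom M \<tau> \<Longrightarrow> valid M (bind \<tau> a e)"
  by (auto simp: valid_def bind_def split: nat.splits)

text \<open>The higher-order counterpart of \<open>arithmetical\<close>; parameters may have any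
  type.\<close>

primrec number_quantified :: "form \<Rightarrow> bool" where
  "number_quantified (Atom a) = True"
| "number_quantified Fls = True"
| "number_quantified (\<phi> \<^bold>\<longrightarrow> \<psi>) = (number_quantified \<phi> \<and> number_quantified \<psi>)"
| "number_quantified (All \<tau> \<phi>) = (\<tau> = N \<and> number_quantified \<phi>)"

lemma number_quantified_connectives [simp]:
  "number_quantified (\<^bold>\<not> \<phi>) \<longleftrightarrow> number_quantified \<phi>"
  "number_quantified (\<phi> \<^bold>\<and> \<psi>) \<longleftrightarrow> number_quantified \<phi> \<and> number_quantified \<psi>"
  "number_quantified (\<phi> \<^bold>\<or> \<psi>) \<longleftrightarrow> number_quantified \<phi> \<and> number_quantified \<psi>"
  "number_quantified (\<phi> \<^bold>\<longleftrightarrow> \<psi>) \<longleftrightarrow> number_quantified \<phi> \<and> number_quantified \<psi>"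
  "number_quantified (Ex \<tau> \<phi>) \<longleftrightarrow> \<tau> = N \<and> number_quantified \<phi>"
  by (auto simp: Neg_def And_def Or_def Iff_def Ex_def)

lemma quantifier_free_connectives [simp]:
  "quantifier_free (\<^bold>\<not> \<phi>) \<longleftrightarrow> quantifier_free \<phi>"
  "quantifier_free (\<phi> \<^bold>\<and> \<psi>) \<longleftrightarrow> quantifier_free \<phi> \<and> quantifier_free \<psi>"
  by (auto simp: Neg_def And_def)

subsection \<open>Models of the higher-order axioms\<close>

text \<open>The axioms before universal closure. Truth under all valid assignments is easier to
  apply than truth of closures; \<open>universal_closures_matrix\<close> makes the passage.\<close>

definition matrices :: "form set" where
  "matrices = arith_axioms \<union> combinator_axioms \<union> recursor_axioms \<union> extensionality_axioms \<union>
     qf_induction \<union> qf_choice \<union> {Exists2, BOOT_minus}"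

locale hoa =
  fixes M :: "tm hmodel"
  assumes wfM: "wf_hmodel M"
    and ax: "\<phi> \<in> matrices \<Longrightarrow> valid M e \<Longrightarrow> holds M e \<phi>"
begin

abbreviation D where "D \<equiv> dom M"
abbreviation app where "app \<equiv> ap M"
abbreviation zero where "zero \<equiv> cst M Zero"
abbreviation one where "one \<equiv> cst M One"
abbreviation add where "add x y \<equiv> app (app (cst M Plus) x) y"
abbreviation mul where "mul x y \<equiv> app (app (cst M Times) x) y"

lemma ex_valid: "\<exists>e. valid M e"
  using wfM by (simp add: wf_hmodel_def)

lemma eval_in: "valid M e \<Longrightarrow> t \<Colon> \<tau> \<Longrightarrow> eval M e t \<in> D \<tau>"
  using wfM by (simp add: wf_hmodel_def)

lemma app_in: "f \<in> D (\<rho> \<leadsto> \<tau>) \<Longrightarrow> a \<in> D \<rho> \<Longrightarrow> app f a \<in> D \<tau>"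
  using wfM by (simp add: wf_hmodel_def)

lemma app_ext:
  "f \<in> D (\<rho> \<leadsto> \<tau>) \<Longrightarrow> g \<in> D (\<rho> \<leadsto> \<tau>) \<Longrightarrow> (\<And>a. a \<in> D \<rho> \<Longrightarrow> app f a = app g a) \<Longrightarrow> f = g"
  using wfM by (simp add: wf_hmodel_def)

lemma valid_in: "valid M e \<Longrightarrow> e \<tau> i \<in> D \<tau>"
  by (simp add: valid_def)

lemma cst_in:
  "zero \<in> D N" "one \<in> D N" "cst M Plus \<in> D (N \<leadsto> N \<leadsto> N)" "cst M Times \<in> D (N \<leadsto> N \<leadsto> N)"
  "cst M (PiC \<rho> \<tau>) \<in> D (\<rho> \<leadsto> \<tau> \<leadsto> \<rho>)"
  "cst M (SigmaC \<delta> \<rho> \<tau>) \<in> D ((\<delta> \<leadsto> \<rho> \<leadsto> \<tau>) \<leadsto> (\<delta> \<leadsto> \<rho>) \<leadsto> \<delta> \<leadsto> \<tau>)"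
  "cst M Rec \<in> D ((N \<leadsto> N \<leadsto> N) \<leadsto> N \<leadsto> N \<leadsto> N)"
proof -
  obtain e where "valid M e" using ex_valid by blast
  note eval_in[OF this]
  note this[OF typed.intros(3)] this[OF typed.intros(4)] this[OF typed.intros(5)]
    this[OF typed.intros(6)] this[OF typed.intros(7)] this[OF typed.intros(8)] this[OF typed.intros(9)]
  then show "zero \<in> D N" "one \<in> D N" "cst M Plus \<in> D (N \<leadsto> N \<leadsto> N)" "cst M Times \<in> D (N \<leadsto> N \<leadsto> N)"
    "cst M (PiC \<rho> \<tau>) \<in> D (\<rho> \<leadsto> \<tau> \<leadsto> \<rho>)"
    "cst M (SigmaC \<delta> \<rho> \<tau>) \<in> D ((\<delta> \<leadsto> \<rho> \<leadsto> \<tau>) \<leadsto> (\<delta> \<leadsto> \<rho>) \<leadsto> \<delta> \<leadsto> \<tau>)"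
    "cst M Rec \<in> D ((N \<leadsto> N \<leadsto> N) \<leadsto> N \<leadsto> N \<leadsto> N)"
    by simp_all
qed

lemma add_in: "x \<in> D N \<Longrightarrow> y \<in> D N \<Longrightarrow> add x y \<in> D N"
  by (rule app_in[OF app_in[OF cst_in(3)]])

lemma mul_in: "x \<in> D N \<Longrightarrow> y \<in> D N \<Longrightarrow> mul x y \<in> D N"
  by (rule app_in[OF app_in[OF cst_in(4)]])

text \<open>By extensionality of the model, agreement on all arguments is identity, type by
  type.\<close>

lemma holds_Eqt:
  "t \<Colon> \<tau> \<Longrightarrow> u \<Colon> \<tau> \<Longrightarrow> valid M e \<Longrightarrow> holds M e (Eqt \<tau> t u) \<longleftrightarrow> eval M e t = eval M e u"
proof (induction \<tau> arbitrary: t u e)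
  case (Fun \<rho> \<tau>)
  have ty: "lift_tm \<rho> s \<cdot> Var \<rho> 0 \<Colon> \<tau>" if "s \<Colon> \<rho> \<leadsto> \<tau>" for s
    by (rule typed.intros(2)[OF typed_subst_tm[OF that typed_subst_shift] typed.intros(1)])
  have "holds M e (Eqt (\<rho> \<leadsto> \<tau>) t u) \<longleftrightarrow> (\<forall>a\<in>D \<rho>. app (eval M e t) a = app (eval M e u) a)"
    using Fun.IH(2)[OF ty[OF Fun.prems(1)] ty[OF Fun.prems(2)] valid_bind[OF Fun.prems(3)]] by simp
  also have "\<dots> \<longleftrightarrow> eval M e t = eval M e u"
    using app_ext[OF eval_in[OF Fun.prems(3,1)] eval_in[OF Fun.prems(3,2)]] by auto
  finally show ?case .
qed simp

section \<open>Combinatory completeness\<close>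

lemma K_eq:
  assumes "x \<in> D \<rho>" "y \<in> D \<tau>"
  shows "app (app (cst M (PiC \<rho> \<tau>)) x) y = x"
proof -
  obtain e where e: "valid M e" using ex_valid by blast
  let ?\<phi> = "Eqt \<rho> (PiC \<rho> \<tau> \<cdot> lift_tm \<tau> (Var \<rho> 0) \<cdot> Var \<tau> 0) (lift_tm \<tau> (Var \<rho> 0))"
  have "All \<rho> (All \<tau> ?\<phi>) \<in> matrices"
    unfolding matrices_def combinator_axioms_def Let_def by blast
  from ax[OF this e] have "holds M (bind \<tau> y (bind \<rho> x e)) ?\<phi>" using assms by simp
  moreover have l: "lift_tm \<tau> (Var \<rho> 0) \<Colon> \<rho>" by (simp add: typed_iff shift_def)
  moreover have p: "PiC \<rho> \<tau> \<cdot> lift_tm \<tau> (Var \<rho> 0) \<cdot> Var \<tau> 0 \<Colon> \<rho>" by (simp add: typed_iff shift_def)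
  moreover have v: "valid M (bind \<tau> y (bind \<rho> x e))" using e assms by (intro valid_bind)
  ultimately have "eval M (bind \<tau> y (bind \<rho> x e)) (PiC \<rho> \<tau> \<cdot> lift_tm \<tau> (Var \<rho> 0) \<cdot> Var \<tau> 0) =
      eval M (bind \<tau> y (bind \<rho> x e)) (lift_tm \<tau> (Var \<rho> 0))"
    using holds_Eqt[OF p l v] by simp
  \<comment> \<open>With the lift kept folded, \<open>eval_lift\<close> treats equal and different
    types \<open>\<rho>\<close> and \<open>\<tau>\<close> alike.\<close>
  then show ?thesis by (simp del: subst_tm.simps)
qed

lemma S_eq:
  assumes x: "x \<in> D (\<delta> \<leadsto> \<rho> \<leadsto> \<tau>)" and y: "y \<in> D (\<delta> \<leadsto> \<rho>)" and z: "z \<in> D \<delta>"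
  shows "app (app (app (cst M (SigmaC \<delta> \<rho> \<tau>)) x) y) z = app (app x z) (app y z)"
proof -
  obtain e where e: "valid M e" using ex_valid by blast
  let ?x = "Var (\<delta> \<leadsto> \<rho> \<leadsto> \<tau>) 0" and ?y = "Var (\<delta> \<leadsto> \<rho>) 0" and ?z = "Var \<delta> 0"
  let ?\<phi> = "Eqt \<tau> (SigmaC \<delta> \<rho> \<tau> \<cdot> ?x \<cdot> ?y \<cdot> ?z) (?x \<cdot> ?z \<cdot> (?y \<cdot> ?z))"
  let ?e = "bind \<delta> z (bind (\<delta> \<leadsto> \<rho>) y (bind (\<delta> \<leadsto> \<rho> \<leadsto> \<tau>) x e))"
  have "All (\<delta> \<leadsto> \<rho> \<leadsto> \<tau>) (All (\<delta> \<leadsto> \<rho>) (All \<delta> ?\<phi>)) \<in> matrices"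
    unfolding matrices_def combinator_axioms_def Let_def by blast
  from ax[OF this e] have "holds M ?e ?\<phi>" using x y z by simp
  moreover have v: "valid M ?e" using e x y z by (intro valid_bind)
  moreover have t: "SigmaC \<delta> \<rho> \<tau> \<cdot> ?x \<cdot> ?y \<cdot> ?z \<Colon> \<tau>" "?x \<cdot> ?z \<cdot> (?y \<cdot> ?z) \<Colon> \<tau>"
    by (simp_all add: typed_iff)
  ultimately have "eval M ?e (SigmaC \<delta> \<rho> \<tau> \<cdot> ?x \<cdot> ?y \<cdot> ?z) = eval M ?e (?x \<cdot> ?z \<cdot> (?y \<cdot> ?z))"
    using holds_Eqt[OF t v] by simp
  then show ?thesis by simp
qed

text \<open>Bracket abstraction: the abstracted variable becomes the identity, an application is
  distributed by \<open>SigmaC\<close>, and everything else is made constant by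
  \<open>PiC\<close>.\<close>

lemma lam_exists:
  "t \<Colon> \<tau> \<Longrightarrow> \<exists>u. u \<Colon> \<sigma> \<leadsto> \<tau> \<and>
     (\<forall>e a. valid M e \<longrightarrow> a \<in> D \<sigma> \<longrightarrow> app (eval M e u) a = eval M (bind \<sigma> a e) t)"
proof (induction rule: typed.induct)
  case (1 \<tau> i)
  show ?case
  proof (cases "\<tau> = \<sigma>")
    case False
    then show ?thesis
      by (intro exI[of _ "PiC \<tau> \<sigma> \<cdot> Var \<tau> i"]) (simp add: typed_iff K_eq valid_in)
  next
    case True
    show ?thesis
    proof (cases i)
      case 0
      \<comment> \<open>The identity as S K K, typed for arguments in
        \<open>\<sigma>\<close>.\<close>
      have "app (app (app (cst M (SigmaC \<sigma> (\<sigma> \<leadsto> \<sigma>) \<sigma>)) (cst M (PiC \<sigma> (\<sigma> \<leadsto> \<sigma>)))) (cst M (PiC \<sigma> \<sigma>))) a = a"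
        if "a \<in> D \<sigma>" for a
        using that by (subst S_eq[OF cst_in(5,5)]) (simp_all add: K_eq app_in[OF cst_in(5)])
      then show ?thesis
        using True 0
        by (intro exI[of _ "SigmaC \<sigma> (\<sigma> \<leadsto> \<sigma>) \<sigma> \<cdot> PiC \<sigma> (\<sigma> \<leadsto> \<sigma>) \<cdot> PiC \<sigma> \<sigma>"]) (simp add: typed_iff)
    next
      case (Suc j)
      \<comment> \<open>Removing the abstracted variable lowers the other indices of its type by
        one.\<close>
      then show ?thesis
        using True by (intro exI[of _ "PiC \<tau> \<sigma> \<cdot> Var \<tau> j"]) (simp add: typed_iff K_eq valid_in)
    qed
  qed
next
  case (2 t \<rho> \<tau> u)
  then obtain t' u' where t': "t' \<Colon> \<sigma> \<leadsto> \<rho> \<leadsto> \<tau>"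
      "\<And>e a. valid M e \<Longrightarrow> a \<in> D \<sigma> \<Longrightarrow> app (eval M e t') a = eval M (bind \<sigma> a e) t"
    and u': "u' \<Colon> \<sigma> \<leadsto> \<rho>"
      "\<And>e a. valid M e \<Longrightarrow> a \<in> D \<sigma> \<Longrightarrow> app (eval M e u') a = eval M (bind \<sigma> a e) u"
    by blast
  then have "SigmaC \<sigma> \<rho> \<tau> \<cdot> t' \<cdot> u' \<Colon> \<sigma> \<leadsto> \<tau>" by (simp add: typed_iff)
  moreover have "app (eval M e (SigmaC \<sigma> \<rho> \<tau> \<cdot> t' \<cdot> u')) a = eval M (bind \<sigma> a e) (t \<cdot> u)"
    if "valid M e" "a \<in> D \<sigma>" for e a
    using that t' u' by (simp add: S_eq eval_in)
  ultimately show ?case by blast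
next
  case 3
  show ?case by (intro exI[of _ "PiC N \<sigma> \<cdot> Zero"]) (simp add: typed_iff K_eq cst_in)
next
  case 4
  show ?case by (intro exI[of _ "PiC N \<sigma> \<cdot> One"]) (simp add: typed_iff K_eq cst_in)
next
  case 5
  show ?case by (intro exI[of _ "PiC (N \<leadsto> N \<leadsto> N) \<sigma> \<cdot> Plus"]) (simp add: typed_iff K_eq cst_in)
next
  case 6
  show ?case by (intro exI[of _ "PiC (N \<leadsto> N \<leadsto> N) \<sigma> \<cdot> Times"]) (simp add: typed_iff K_eq cst_in)
next
  case (7 \<rho> \<tau>)
  show ?case
    by (intro exI[of _ "PiC (\<rho> \<leadsto> \<tau> \<leadsto> \<rho>) \<sigma> \<cdot> PiC \<rho> \<tau>"]) (simp add: typed_iff K_eq cst_in)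
next
  case (8 \<delta> \<rho> \<tau>)
  show ?case
    by (intro exI[of _ "PiC ((\<delta> \<leadsto> \<rho> \<leadsto> \<tau>) \<leadsto> (\<delta> \<leadsto> \<rho>) \<leadsto> \<delta> \<leadsto> \<tau>) \<sigma> \<cdot> SigmaC \<delta> \<rho> \<tau>"])
      (simp add: typed_iff K_eq cst_in)
next
  case 9
  show ?case
    by (intro exI[of _ "PiC ((N \<leadsto> N \<leadsto> N) \<leadsto> N \<leadsto> N \<leadsto> N) \<sigma> \<cdot> Rec"]) (simp add: typed_iff K_eq cst_in)
qed

definition lam :: "ty \<Rightarrow> tm \<Rightarrow> tm" where
  "lam \<sigma> t = (SOME u. \<forall>\<tau>. t \<Colon> \<tau> \<longrightarrow> u \<Colon> \<sigma> \<leadsto> \<tau> \<and>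
     (\<forall>e a. valid M e \<longrightarrow> a \<in> D \<sigma> \<longrightarrow> app (eval M e u) a = eval M (bind \<sigma> a e) t))"

lemma lam:
  assumes "t \<Colon> \<tau>"
  shows lam_typed: "lam \<sigma> t \<Colon> \<sigma> \<leadsto> \<tau>"
    and app_lam: "valid M e \<Longrightarrow> a \<in> D \<sigma> \<Longrightarrow> app (eval M e (lam \<sigma> t)) a = eval M (bind \<sigma> a e) t"
proof -
  obtain u where u: "u \<Colon> \<sigma> \<leadsto> \<tau> \<and>
     (\<forall>e a. valid M e \<longrightarrow> a \<in> D \<sigma> \<longrightarrow> app (eval M e u) a = eval M (bind \<sigma> a e) t)"
    using lam_exists[OF assms] by blast
  have "\<forall>\<tau>. t \<Colon> \<tau> \<longrightarrow> lam \<sigma> t \<Colon> \<sigma> \<leadsto> \<tau> \<and>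
     (\<forall>e a. valid M e \<longrightarrow> a \<in> D \<sigma> \<longrightarrow> app (eval M e (lam \<sigma> t)) a = eval M (bind \<sigma> a e) t)"
    unfolding lam_def
  proof (rule someI[of _ u], intro allI impI)
    fix \<tau>' assume "t \<Colon> \<tau>'"
    then have "\<tau>' = \<tau>" using assms typed_unique by blast
    then show "u \<Colon> \<sigma> \<leadsto> \<tau>' \<and>
     (\<forall>e a. valid M e \<longrightarrow> a \<in> D \<sigma> \<longrightarrow> app (eval M e u) a = eval M (bind \<sigma> a e) t)" using u by simp
  qed
  then show "lam \<sigma> t \<Colon> \<sigma> \<leadsto> \<tau>"
    "valid M e \<Longrightarrow> a \<in> D \<sigma> \<Longrightarrow> app (eval M e (lam \<sigma> t)) a = eval M (bind \<sigma> a e) t"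
    using assms by blast+
qed

lemma rec_eqs:
  assumes "f \<in> D (N \<leadsto> N \<leadsto> N)" "m \<in> D N" "n \<in> D N"
  shows "app (app (app (cst M Rec) f) m) zero = m"
    and "app (app (app (cst M Rec) f) m) (add n one) = app (app f n) (app (app (app (cst M Rec) f) m) n)"
proof -
  obtain e where e: "valid M e" using ex_valid by blast
  let ?e = "bind N n (bind N m (bind (N \<leadsto> N \<leadsto> N) f e))"
  have v: "valid M ?e" using e assms by (intro valid_bind)
  have "\<forall>\<phi>\<in>recursor_axioms. holds M ?e \<phi>" using ax[OF _ v] by (simp add: matrices_def)
  then show "app (app (app (cst M Rec) f) m) zero = m"
    "app (app (app (cst M Rec) f) m) (add n one) = app (app f n) (app (app (app (cst M Rec) f) m) n)"
    by (simp_all add: recursor_axioms_def Let_def)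
qed

lemma arith_eqs:
  assumes "m \<in> D N" "n \<in> D N"
  shows "add n one \<noteq> zero" "add m one = add n one \<Longrightarrow> m = n" "add m zero = m"
    "add m (add n one) = add (add m n) one" "mul m zero = zero" "mul m (add n one) = add (mul m n) m"
    "\<not> lt M m zero" "lt M m (add n one) \<longleftrightarrow> lt M m n \<or> m = n"
proof -
  obtain e where e: "valid M e" using ex_valid by blast
  let ?e = "bind N n (bind N m e)"
  have v: "valid M ?e" using e assms by (intro valid_bind)
  have "\<forall>\<phi>\<in>arith_axioms. holds M ?e \<phi>" using ax[OF _ v] by (simp add: matrices_def)
  then show "add n one \<noteq> zero" "add m one = add n one \<Longrightarrow> m = n" "add m zero = m"
    "add m (add n one) = add (add m n) one" "mul m zero = zero" "mul m (add n one) = add (mul m n) m"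
    "\<not> lt M m zero" "lt M m (add n one) \<longleftrightarrow> lt M m n \<or> m = n"
    by (simp_all add: arith_axioms_def Let_def)
qed

text \<open>Otherwise \<open>0 + 1 = 0 + 0 = 0\<close>, although a successor is never zero.\<close>

lemma one_neq_zero: "one \<noteq> zero"
  using arith_eqs(1,3)[of zero zero] cst_in(1) by metis

lemma induction:
  assumes "X \<in> D ty1" "app X zero = one" "\<And>n. n \<in> D N \<Longrightarrow> app X n = one \<Longrightarrow> app X (add n one) = one"
    and "n \<in> D N"
  shows "app X n = one"
proof -
  obtain e where "valid M e" using ex_valid by blast
  then have e: "valid M (bind ty1 X e)" using assms by blast
  let ?A = "Var ty1 0 \<cdot> Var N 0 \<^bold>= One"
  have "inst N Zero ?A \<^bold>\<and> All N (?A \<^bold>\<longrightarrow>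
        subst_form (\<lambda>\<rho> i. if \<rho> = N \<and> i = 0 then Var N 0 \<^bold>+ One else Var \<rho> i) ?A) \<^bold>\<longrightarrow> All N ?A \<in> qf_induction"
    unfolding qf_induction_def by (rule CollectI, rule exI[of _ ?A]) (simp add: typed_iff)
  then have "inst N Zero ?A \<^bold>\<and> All N (?A \<^bold>\<longrightarrow>
        subst_form (\<lambda>\<rho> i. if \<rho> = N \<and> i = 0 then Var N 0 \<^bold>+ One else Var \<rho> i) ?A) \<^bold>\<longrightarrow> All N ?A \<in> matrices"
    by (simp add: matrices_def)
  from ax[OF this e] show ?thesis using assms by (simp add: inst_def)
qed

lemma choice:
  assumes A: "wf_form A" "quantifier_free A" and e: "valid M e"
    and ex: "\<And>f. f \<in> D ty1 \<Longrightarrow> \<exists>n\<in>D N. holds M (bind N n (bind ty1 f e)) A"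
  shows "\<exists>Y\<in>D ty2. \<forall>f\<in>D ty1. holds M (bind N (app Y f) (bind ty1 f e)) A"
proof -
  let ?\<sigma> = "\<lambda>\<rho> i. if \<rho> = N then (case i of 0 \<Rightarrow> Var ty2 0 \<cdot> Var ty1 0 | Suc j \<Rightarrow> Var N j)
        else if \<rho> = ty2 then Var ty2 (Suc i) else Var \<rho> i"
  have "All ty1 (Ex N A) \<^bold>\<longrightarrow> Ex ty2 (All ty1 (subst_form ?\<sigma> A)) \<in> qf_choice"
    unfolding qf_choice_def using A by blast
  then have "All ty1 (Ex N A) \<^bold>\<longrightarrow> Ex ty2 (All ty1 (subst_form ?\<sigma> A)) \<in> matrices"
    by (simp add: matrices_def)
  from ax[OF this e] ex obtain Y where Y: "Y \<in> D ty2"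
    "\<forall>f\<in>D ty1. holds M (bind ty1 f (bind ty2 Y e)) (subst_form ?\<sigma> A)" by auto
  have "(\<lambda>\<tau> i. eval M (bind ty1 f (bind ty2 Y e)) (?\<sigma> \<tau> i)) = bind N (app Y f) (bind ty1 f e)" for f
    by (auto simp: fun_eq_iff bind_def split: nat.splits)
  then show ?thesis using Y by (auto simp: holds_subst)
qed

text \<open>Definition by cases through quantifier-free choice: pick n with n = 0 if B holds and n =
  1 otherwise. As n occupies number variable 0, B must be insensitive to that variable.\<close>

lemma char2_exists:
  assumes B: "wf_form B" "quantifier_free B" "\<And>n e. holds M (bind N n e) B \<longleftrightarrow> holds M e B"
    and e: "valid M e"
  shows "\<exists>Y\<in>D ty2. \<forall>f\<in>D ty1. (app Y f = zero \<or> app Y f = one) \<and>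
    (app Y f = zero \<longleftrightarrow> holds M (bind ty1 f e) B)"
proof -
  let ?A = "(B \<^bold>\<longrightarrow> (Var N 0 \<^bold>= Zero)) \<^bold>\<and> (\<^bold>\<not> B \<^bold>\<longrightarrow> (Var N 0 \<^bold>= One))"
  have "\<exists>Y\<in>D ty2. \<forall>f\<in>D ty1. holds M (bind N (app Y f) (bind ty1 f e)) ?A"
  proof (rule choice)
    show "\<exists>n\<in>D N. holds M (bind N n (bind ty1 f e)) ?A" for f
      using cst_in(1,2) by (cases "holds M (bind ty1 f e) B") (auto simp: B(3))
  qed (use B e in \<open>auto simp: typed_iff\<close>)
  then show ?thesis using one_neq_zero by (fastforce simp: B(3))
qed

text \<open>The numerals are pairwise distinct. With the countable carrier this gives a bijection
  between the numbers of the model and nat.\<close>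

lemma infinite_numbers: "infinite (D N)"
proof -
  define num where "num = rec_nat zero (\<lambda>_ x. add x one)"
  have s: "num 0 = zero" "num (Suc k) = add (num k) one" for k by (simp_all add: num_def)
  have m: "num k \<in> D N" for k by (induction k) (simp_all add: s cst_in add_in)
  have "num i = num j \<Longrightarrow> i = j" for i j
  proof (induction i arbitrary: j)
    case 0
    then show ?case using arith_eqs(1)[OF m m] by (cases j) (auto simp: s dest: sym)
  next
    case (Suc i)
    then show ?case using arith_eqs(1,2)[OF m m] by (cases j) (auto simp: s)
  qed
  then have "inj num" by (rule injI)
  moreover have "range num \<subseteq> D N" using m by blast
  ultimately show ?thesis using infinite_iff_countable_subset by blast
qed

end

lemma bind_commute: "\<rho> \<noteq> \<tau> \<Longrightarrow> bind \<rho> a (bind \<tau> b e) = bind \<tau> b (bind \<rho> a e)"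
  by (auto simp: bind_def fun_eq_iff split: nat.splits if_splits)

text \<open>
  A pair of numbers is coded by a function with these values at \<open>0\<close> and \<open>0 + 1\<close>. The second argument
  is not written 1 because \<open>0 + 1 = 1\<close> is not among the axioms.
\<close>

locale hoa_char = hoa +
  fixes E Q L I
  assumes E_in: "E \<in> D ty2" and Q_in: "Q \<in> D ty2" and L_in: "L \<in> D ty2" and I_in: "I \<in> D ty2"
    and E: "f \<in> D ty1 \<Longrightarrow> app E f = zero \<longleftrightarrow> (\<exists>n\<in>D N. app f n = zero)"
    and Q: "f \<in> D ty1 \<Longrightarrow> app Q f = zero \<or> app Q f = one"
      "f \<in> D ty1 \<Longrightarrow> app Q f = zero \<longleftrightarrow> app f zero = app f (add zero one)"
    and L: "f \<in> D ty1 \<Longrightarrow> app L f = zero \<or> app L f = one"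
      "f \<in> D ty1 \<Longrightarrow> app L f = zero \<longleftrightarrow> lt M (app f zero) (app f (add zero one))"
    and I: "f \<in> D ty1 \<Longrightarrow> app I f = zero \<or> app I f = one"
      "f \<in> D ty1 \<Longrightarrow> app I f = zero \<longleftrightarrow> (app f zero = zero \<longrightarrow> app f (add zero one) = zero)"

lemma (in hoa) hoa_char_exists: "\<exists>E Q L I. hoa_char M E Q L I"
proof -
  obtain e where e: "valid M e" using ex_valid by blast
  have "Exists2 \<in> matrices" by (simp add: matrices_def)
  from ax[OF this e] obtain E where E: "E \<in> D ty2"
    "\<forall>f\<in>D ty1. app E f = zero \<longleftrightarrow> (\<exists>n\<in>D N. app f n = zero)"
    by (auto simp: Exists2_def Let_def)
  let ?f0 = "Var ty1 0 \<cdot> Zero" and ?f1 = "Var ty1 0 \<cdot> (Zero \<^bold>+ One)"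
  obtain Q where Q: "Q \<in> D ty2" "\<forall>f\<in>D ty1. (app Q f = zero \<or> app Q f = one) \<and>
      (app Q f = zero \<longleftrightarrow> holds M (bind ty1 f e) (?f0 \<^bold>= ?f1))"
    using char2_exists[of "?f0 \<^bold>= ?f1" e] e by (auto simp: typed_iff)
  obtain L where L: "L \<in> D ty2" "\<forall>f\<in>D ty1. (app L f = zero \<or> app L f = one) \<and>
      (app L f = zero \<longleftrightarrow> holds M (bind ty1 f e) (?f0 \<^bold>< ?f1))"
    using char2_exists[of "?f0 \<^bold>< ?f1" e] e by (auto simp: typed_iff)
  obtain I where I: "I \<in> D ty2" "\<forall>f\<in>D ty1. (app I f = zero \<or> app I f = one) \<and>
      (app I f = zero \<longleftrightarrow> holds M (bind ty1 f e) ((?f0 \<^bold>= Zero) \<^bold>\<longrightarrow> (?f1 \<^bold>= Zero)))"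
    using char2_exists[of "(?f0 \<^bold>= Zero) \<^bold>\<longrightarrow> (?f1 \<^bold>= Zero)" e] e by (auto simp: typed_iff)
  have "hoa_char M E Q L I"
    using E Q L I by unfold_locales auto
  then show ?thesis by blast
qed

section \<open>Characteristic terms of arithmetical formulas\<close>

context hoa_char
begin

text \<open>The language has no constants for the four functionals, so terms reach them through
  reserved variables of type 2. Translated second-order formulas contain variables of types 0 and 1
  only, so there is no conflict.\<close>

definition good :: "(ty \<Rightarrow> nat \<Rightarrow> tm) \<Rightarrow> bool" where
  "good e \<longleftrightarrow> valid M e \<and> e ty2 0 = E \<and> e ty2 1 = Q \<and> e ty2 2 = L \<and> e ty2 3 = I"

lemma good_valid: "good e \<Longrightarrow> valid M e"
  by (simp add: good_def)

lemma good_bind: "good e \<Longrightarrow> a \<in> D \<tau> \<Longrightarrow> \<tau> \<noteq> ty2 \<Longrightarrow> good (bind \<tau> a e)"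
  by (auto simp: good_def)

text \<open>Recursion with start value a and constant step b: the value is a at 0 and b at
  successors, in particular at \<open>0 + 1\<close>.\<close>

definition tup :: "tm \<Rightarrow> tm \<Rightarrow> tm" where
  "tup a b = Rec \<cdot> (PiC ty1 N \<cdot> (PiC N N \<cdot> b)) \<cdot> a"

lemma tup:
  assumes "a \<Colon> N" "b \<Colon> N"
  shows tup_typed: "tup a b \<Colon> ty1"
    and app_tup: "valid M e \<Longrightarrow> app (eval M e (tup a b)) zero = eval M e a"
      "valid M e \<Longrightarrow> app (eval M e (tup a b)) (add zero one) = eval M e b"
proof -
  show "tup a b \<Colon> ty1" using assms by (simp add: typed_iff tup_def)
  assume e: "valid M e"
  let ?b = "app (cst M (PiC N N)) (eval M e b)"
  let ?F = "app (cst M (PiC ty1 N)) ?b"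
  have b: "eval M e b \<in> D N" and a: "eval M e a \<in> D N" using assms e by (simp_all add: eval_in)
  have b': "?b \<in> D ty1" using app_in[OF cst_in(5) b] .
  have F: "?F \<in> D (N \<leadsto> ty1)" using app_in[OF cst_in(5) b'] .
  show "app (eval M e (tup a b)) zero = eval M e a"
    using rec_eqs(1)[OF F a a] by (simp add: tup_def)
  have r: "app (app (app (cst M Rec) ?F) (eval M e a)) zero \<in> D N"
    using app_in[OF app_in[OF app_in[OF cst_in(7) F] a] cst_in(1)] .
  show "app (eval M e (tup a b)) (add zero one) = eval M e b"
    using rec_eqs(2)[OF F a cst_in(1)] K_eq[OF b' cst_in(1)] K_eq[OF b r] by (simp add: tup_def)
qed

text \<open>Zero stands for truth, as it does for E. Two-valuedness is required because such terms
  become characteristic functions of sets.\<close>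

definition rep :: "((ty \<Rightarrow> nat \<Rightarrow> tm) \<Rightarrow> bool) \<Rightarrow> bool" where
  "rep P \<longleftrightarrow> (\<exists>t. t \<Colon> N \<and> (\<forall>e. good e \<longrightarrow> (eval M e t = zero \<or> eval M e t = one) \<and>
     (eval M e t = zero \<longleftrightarrow> P e)))"

lemma rep_functional:
  assumes "a \<Colon> N" "b \<Colon> N"
    and "\<And>e. good e \<Longrightarrow> (app (e ty2 k) (eval M e (tup a b)) = zero \<or> app (e ty2 k) (eval M e (tup a b)) = one)
      \<and> (app (e ty2 k) (eval M e (tup a b)) = zero \<longleftrightarrow> P e)"
  shows "rep P"
  unfolding rep_def
proof (intro exI[of _ "Var ty2 k \<cdot> tup a b"] conjI[of "_ \<Colon> _"] allI impI)
  show "Var ty2 k \<cdot> tup a b \<Colon> N" using tup_typed[OF assms(1,2)] by (simp add: typed_iff)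
  show "(eval M e (Var ty2 k \<cdot> tup a b) = zero \<or> eval M e (Var ty2 k \<cdot> tup a b) = one) \<and>
    (eval M e (Var ty2 k \<cdot> tup a b) = zero \<longleftrightarrow> P e)" if "good e" for e
    using assms(3)[OF that] unfolding eval.simps .
qed

lemma rep_Imp:
  assumes "rep P" "rep P'"
  shows "rep (\<lambda>e. P e \<longrightarrow> P' e)"
proof -
  obtain t where t: "t \<Colon> N" "\<And>e. good e \<Longrightarrow> eval M e t = zero \<longleftrightarrow> P e"
    using assms(1) by (auto simp: rep_def)
  obtain t' where t': "t' \<Colon> N" "\<And>e. good e \<Longrightarrow> eval M e t' = zero \<longleftrightarrow> P' e"
    using assms(2) by (auto simp: rep_def)
  show ?thesis
  proof (rule rep_functional[OF t(1) t'(1), of 3])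
    fix e assume e: "good e"
    note ty = tup_typed[OF t(1) t'(1)]
    show "(app (e ty2 3) (eval M e (tup t t')) = zero \<or> app (e ty2 3) (eval M e (tup t t')) = one) \<and>
      (app (e ty2 3) (eval M e (tup t t')) = zero \<longleftrightarrow> (P e \<longrightarrow> P' e))"
      using I[OF eval_in[OF good_valid[OF e] ty]] app_tup[OF t(1) t'(1) good_valid[OF e]]
        t(2)[OF e] t'(2)[OF e] e by (simp add: good_def)
  qed
qed

lemma rep_False: "rep (\<lambda>e. False)"
  unfolding rep_def by (rule exI[of _ One]) (simp add: typed_iff one_neq_zero)

lemma rep_Not: "rep P \<Longrightarrow> rep (\<lambda>e. \<not> P e)"
  using rep_Imp[OF _ rep_False] by simp

lemma rep_Ex:
  assumes "rep P"
  shows "rep (\<lambda>e. \<exists>n\<in>D N. P (bind N n e))"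
proof -
  obtain t where t: "t \<Colon> N" "\<And>e. good e \<Longrightarrow> eval M e t = zero \<longleftrightarrow> P e"
    using assms by (auto simp: rep_def)
  let ?u = "Var ty2 0 \<cdot> lam N t"
  have ty: "lam N t \<Colon> ty1" using lam_typed[OF t(1)] .
  have "eval M e ?u = zero \<longleftrightarrow> (\<exists>n\<in>D N. P (bind N n e))" if e: "good e" for e
    using E[OF eval_in[OF good_valid[OF e] ty]] app_lam[OF t(1) good_valid[OF e]] t(2)[OF good_bind[OF e]] e
    by (simp add: good_def)
  then have u: "?u \<Colon> N" "\<And>e. good e \<Longrightarrow> eval M e ?u = zero \<longleftrightarrow> (\<exists>n\<in>D N. P (bind N n e))"
    using ty by (simp_all add: typed_iff)
  \<comment> \<open>The locale fixes only when E vanishes, so \<open>?u\<close> need not be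
    two-valued here. The implication functional at the pair of \<open>?u\<close> and 1 is two-valued
    and vanishes exactly when \<open>?u\<close> does not; a further negation gives the
    claim.\<close>
  have "rep (\<lambda>e. \<not> (\<exists>n\<in>D N. P (bind N n e)))"
  proof (rule rep_functional[OF u(1) typed.intros(4), of 3])
    fix e assume e: "good e"
    note ty = tup_typed[OF u(1) typed.intros(4)]
    show "(app (e ty2 3) (eval M e (tup ?u One)) = zero \<or> app (e ty2 3) (eval M e (tup ?u One)) = one) \<and>
      (app (e ty2 3) (eval M e (tup ?u One)) = zero \<longleftrightarrow> \<not> (\<exists>n\<in>D N. P (bind N n e)))"
      using I[OF eval_in[OF good_valid[OF e] ty]] app_tup[OF u(1) typed.intros(4) good_valid[OF e]]
        u(2)[OF e] e one_neq_zero by (auto simp: good_def)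
  qed
  from rep_Not[OF this] show ?thesis by simp
qed

lemma rep_holds: "wf_form \<phi> \<Longrightarrow> number_quantified \<phi> \<Longrightarrow> rep (\<lambda>e. holds M e \<phi>)"
proof (induction \<phi>)
  case (Atom a)
  show ?case
  proof (cases a)
    case (EqA t u)
    then have tu: "t \<Colon> N" "u \<Colon> N" using Atom by auto
    show ?thesis
    proof (rule rep_functional[OF tu, of 1])
      fix e assume e: "good e"
      show "(app (e ty2 1) (eval M e (tup t u)) = zero \<or> app (e ty2 1) (eval M e (tup t u)) = one) \<and>
        (app (e ty2 1) (eval M e (tup t u)) = zero \<longleftrightarrow> holds M e (Atom a))"
        using Q[OF eval_in[OF good_valid[OF e] tup_typed[OF tu]]] app_tup[OF tu good_valid[OF e]] e EqA
        by (simp add: good_def)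
    qed
  next
    case (LessA t u)
    then have tu: "t \<Colon> N" "u \<Colon> N" using Atom by auto
    show ?thesis
    proof (rule rep_functional[OF tu, of 2])
      fix e assume e: "good e"
      show "(app (e ty2 2) (eval M e (tup t u)) = zero \<or> app (e ty2 2) (eval M e (tup t u)) = one) \<and>
        (app (e ty2 2) (eval M e (tup t u)) = zero \<longleftrightarrow> holds M e (Atom a))"
        using L[OF eval_in[OF good_valid[OF e] tup_typed[OF tu]]] app_tup[OF tu good_valid[OF e]] e LessA
        by (simp add: good_def)
    qed
  qed
next
  case Fls
  then show ?case by (simp add: rep_False)
next
  case (Imp \<phi> \<psi>)
  then show ?case by (simp add: rep_Imp)
next
  case (All \<tau> \<phi>)
  then have "rep (\<lambda>e. \<not> (\<exists>n\<in>D N. \<not> holds M (bind N n e) \<phi>))"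
    by (intro rep_Not rep_Ex[of "\<lambda>e. \<not> holds M e \<phi>"]) auto
  then show ?case using All.prems by simp
qed

section \<open>Comprehension, BOOT and dependent choice in a model\<close>

lemma comprehension:
  assumes \<phi>: "wf_form \<phi>" "number_quantified \<phi>" and e: "good e"
  shows "\<exists>X\<in>D ty1. \<forall>n\<in>D N. (app X n = zero \<or> app X n = one) \<and>
    (app X n = one \<longleftrightarrow> holds M (bind N n e) \<phi>)"
proof -
  \<comment> \<open>Membership is the value 1 but truth is the value 0, hence the term for the
    negated formula.\<close>
  obtain t where t: "t \<Colon> N" "\<And>e. good e \<Longrightarrow> (eval M e t = zero \<or> eval M e t = one) \<and>
     (eval M e t = zero \<longleftrightarrow> \<not> holds M e \<phi>)"
    using rep_Not[OF rep_holds[OF \<phi>]] by (auto simp: rep_def)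
  have "eval M e (lam N t) \<in> D ty1"
    using eval_in[OF good_valid[OF e] lam_typed[OF t(1)]] .
  moreover have "(app (eval M e (lam N t)) n = zero \<or> app (eval M e (lam N t)) n = one) \<and>
    (app (eval M e (lam N t)) n = one \<longleftrightarrow> holds M (bind N n e) \<phi>)" if n: "n \<in> D N" for n
    using t(2)[OF good_bind[OF e n]] one_neq_zero app_lam[OF t(1) good_valid[OF e] n] by auto
  ultimately show ?thesis by blast
qed

text \<open>The characteristic term of the matrix, abstracted over the function and then the number,
  is the functional to which \<open>BOOT_minus\<close> is applied.\<close>

lemma boot:
  assumes \<phi>: "wf_form \<phi>" "number_quantified \<phi>" and e: "good e"
    and unique: "\<And>n f g. n \<in> D N \<Longrightarrow> f \<in> D ty1 \<Longrightarrow> g \<in> D ty1 \<Longrightarrow>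
      holds M (bind ty1 f (bind N n e)) \<phi> \<Longrightarrow> holds M (bind ty1 g (bind N n e)) \<phi> \<Longrightarrow> f = g"
  shows "\<exists>X\<in>D ty1. \<forall>n\<in>D N. (app X n = zero \<or> app X n = one) \<and>
    (app X n = one \<longleftrightarrow> (\<exists>f\<in>D ty1. holds M (bind ty1 f (bind N n e)) \<phi>))"
proof -
  obtain t where t: "t \<Colon> N" "\<And>e. good e \<Longrightarrow> eval M e t = zero \<longleftrightarrow> holds M e \<phi>"
    using rep_holds[OF \<phi>] by (auto simp: rep_def)
  define Y where "Y = eval M e (lam ty1 (lam N t))"
  have Y_in: "Y \<in> D (ty1 \<leadsto> N \<leadsto> N)"
    unfolding Y_def using eval_in[OF good_valid[OF e] lam_typed[OF lam_typed[OF t(1)]]] .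
  have Y: "app (app Y f) n = zero \<longleftrightarrow> holds M (bind ty1 f (bind N n e)) \<phi>"
    if f: "f \<in> D ty1" and n: "n \<in> D N" for f n
  proof -
    have ef: "good (bind ty1 f e)" using good_bind[OF e f] by simp
    have enf: "good (bind N n (bind ty1 f e))" using good_bind[OF ef n] by simp
    \<comment> \<open>The functional takes f before n, whereas f is the inner variable of the
      formula; the two bindings commute because their types differ.\<close>
    show ?thesis
      using app_lam[OF lam_typed[OF t(1)] good_valid[OF e] f] app_lam[OF t(1) good_valid[OF ef] n]
        t(2)[OF enf] bind_commute[of N ty1 n f e] by (simp add: Y_def)
  qed
  have "BOOT_minus \<in> matrices" by (simp add: matrices_def)
  from ax[OF this good_valid[OF e]] have "holds M e BOOT_minus" .
  moreover have "holds M e BOOT_minus \<longleftrightarrow> (\<forall>Y\<in>D (ty1 \<leadsto> N \<leadsto> N). (\<forall>n\<in>D N. \<forall>f\<in>D ty1. \<forall>g\<in>D ty1.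
        app (app Y f) n = zero \<and> app (app Y g) n = zero \<longrightarrow> (\<forall>m\<in>D N. app f m = app g m)) \<longrightarrow>
     (\<exists>X\<in>D ty1. (\<forall>n\<in>D N. app X n = zero \<or> app X n = one) \<and>
        (\<forall>n\<in>D N. app X n = one \<longleftrightarrow> (\<exists>f\<in>D ty1. app (app Y f) n = zero))))"
    unfolding BOOT_minus_def Let_def IsSet_def holds_connectives holds.simps Eqt.simps
    by (simp only: holds_connectives holds.simps holds_atom.simps eval.simps eval_lift bind_simps
        ty.distinct ty.inject simp_thms One_nat_def not_False_eq_True)
  ultimately have "(\<forall>n\<in>D N. \<forall>f\<in>D ty1. \<forall>g\<in>D ty1.
        app (app Y f) n = zero \<and> app (app Y g) n = zero \<longrightarrow> (\<forall>m\<in>D N. app f m = app g m)) \<longrightarrow>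
     (\<exists>X\<in>D ty1. (\<forall>n\<in>D N. app X n = zero \<or> app X n = one) \<and>
        (\<forall>n\<in>D N. app X n = one \<longleftrightarrow> (\<exists>f\<in>D ty1. app (app Y f) n = zero)))"
    using Y_in by blast
  moreover have "\<forall>n\<in>D N. \<forall>f\<in>D ty1. \<forall>g\<in>D ty1. app (app Y f) n = zero \<and> app (app Y g) n = zero \<longrightarrow>
        (\<forall>m\<in>D N. app f m = app g m)"
  proof (intro ballI impI)
    fix n f g m
    assume n: "n \<in> D N" and f: "f \<in> D ty1" and g: "g \<in> D ty1"
      and "app (app Y f) n = zero \<and> app (app Y g) n = zero"
    then have "f = g" using unique[OF n f g] Y[OF f n] Y[OF g n] by simp
    then show "app f m = app g m" by simp
  qed
  ultimately obtain X where X: "X \<in> D ty1" "\<And>n. n \<in> D N \<Longrightarrow> app X n = zero \<or> app X n = one"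
    "\<And>n. n \<in> D N \<Longrightarrow> app X n = one \<longleftrightarrow> (\<exists>f\<in>D ty1. app (app Y f) n = zero)" by blast
  have "app X n = one \<longleftrightarrow> (\<exists>f\<in>D ty1. holds M (bind ty1 f (bind N n e)) \<phi>)" if n: "n \<in> D N" for n
    using X(3)[OF n] Y[OF _ n] by (simp cong: bex_cong)
  then show ?thesis using X(1,2) by blast
qed

text \<open>The characteristic term makes the matrix quantifier free. In it x is replaced by f(0),
  so that choice over functions f applies; the chosen Y at the constant function with value r is a
  successor of r, and the recursor iterates this step from a.\<close>

lemma dependent_choice:
  assumes \<phi>: "wf_form \<phi>" "number_quantified \<phi>" and e: "good e"
    and ex: "\<And>x. x \<in> D N \<Longrightarrow> \<exists>y\<in>D N. holds M (bind N y (bind N x e)) \<phi>"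
    and a: "a \<in> D N"
  shows "\<exists>f\<in>D ty1. app f zero = a \<and>
    (\<forall>n\<in>D N. holds M (bind N (app f (add n one)) (bind N (app f n) e)) \<phi>)"
proof -
  obtain t where t: "t \<Colon> N" "\<And>e. good e \<Longrightarrow> eval M e t = zero \<longleftrightarrow> holds M e \<phi>"
    using rep_holds[OF \<phi>] by (auto simp: rep_def)
  \<comment> \<open>The number variable 1, formerly x, is read as f(0). Its binder disappears, so
    higher number indices drop by one, while type 1 indices rise by one to make room for f.\<close>
  let ?\<sigma> = "\<lambda>\<rho> i. if \<rho> = N then (case i of 0 \<Rightarrow> Var N 0 | Suc j \<Rightarrow>
      (case j of 0 \<Rightarrow> Var ty1 0 \<cdot> Zero | Suc k \<Rightarrow> Var N (Suc k)))
    else if \<rho> = ty1 then Var ty1 (Suc i) else Var \<rho> i"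
  let ?A = "subst_tm ?\<sigma> t \<^bold>= Zero"
  have \<sigma>: "(\<lambda>\<rho> i. eval M (bind N n (bind ty1 f e)) (?\<sigma> \<rho> i)) = bind N n (bind N (app f zero) e)" for n f
    by (auto simp: fun_eq_iff bind_def split: nat.splits)
  have A: "holds M (bind N n (bind ty1 f e)) ?A \<longleftrightarrow> holds M (bind N n (bind N (app f zero) e)) \<phi>"
    if "n \<in> D N" "f \<in> D ty1" for n f
    using t(2)[OF good_bind[OF good_bind[OF e app_in[OF that(2) cst_in(1)]] that(1)]]
    by (simp add: eval_subst \<sigma>)
  have "\<exists>Y\<in>D ty2. \<forall>f\<in>D ty1. holds M (bind N (app Y f) (bind ty1 f e)) ?A"
  proof (rule choice)
    have "typed_subst ?\<sigma>" by (auto simp: typed_subst_def typed_iff split: nat.splits)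
    then show "wf_form ?A" using typed_subst_tm[OF t(1)] by (simp add: typed_iff)
    show "\<exists>n\<in>D N. holds M (bind N n (bind ty1 f e)) ?A" if f: "f \<in> D ty1" for f
      using ex[OF app_in[OF f cst_in(1)]] A f by blast
  qed (use good_valid[OF e] in auto)
  then obtain Y where Y: "Y \<in> D ty2" "\<And>f. f \<in> D ty1 \<Longrightarrow> holds M (bind N (app Y f) (bind ty1 f e)) ?A"
    by blast
  \<comment> \<open>Binding Y displaces the reserved functionals, but abstraction asks only for a
    valid assignment.\<close>
  let ?e = "bind ty2 Y e"
  let ?s = "Var ty2 0 \<cdot> (PiC N N \<cdot> Var N 0)"
  have s: "?s \<Colon> N" by (simp add: typed_iff)
  have e': "valid M ?e" using good_valid[OF e] Y(1) by blast
  define F where "F = eval M ?e (lam N (lam N ?s))"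
  have F_in: "F \<in> D (N \<leadsto> N \<leadsto> N)"
    unfolding F_def using eval_in[OF e' lam_typed[OF lam_typed[OF s]]] .
  have F: "app (app F n) r = app Y (app (cst M (PiC N N)) r)" if n: "n \<in> D N" and r: "r \<in> D N" for n r
    using app_lam[OF lam_typed[OF s] e' n] app_lam[OF s valid_bind[OF e' n] r] by (simp add: F_def)
  define f where "f = app (app (cst M Rec) F) a"
  have f: "f \<in> D ty1" unfolding f_def using app_in[OF app_in[OF cst_in(7) F_in] a] .
  have "holds M (bind N (app f (add n one)) (bind N (app f n) e)) \<phi>" if n: "n \<in> D N" for n
  proof -
    have fn: "app f n \<in> D N" using app_in[OF f n] .
    have k: "app (cst M (PiC N N)) (app f n) \<in> D ty1" using app_in[OF cst_in(5) fn] .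
    have "app f (add n one) = app Y (app (cst M (PiC N N)) (app f n))"
      using rec_eqs(2)[OF F_in a n] F[OF n fn] by (simp add: f_def)
    then show ?thesis
      using Y(2)[OF k] A[OF app_in[OF Y(1) k] k] K_eq[OF fn cst_in(1)] by simp
  qed
  moreover have "app f zero = a" using rec_eqs(1)[OF F_in a a] by (simp add: f_def)
  ultimately show ?thesis using f by blast
qed

end

subsection \<open>Structures for second-order arithmetic\<close>

abbreviation scons :: "'a \<Rightarrow> (nat \<Rightarrow> 'a) \<Rightarrow> nat \<Rightarrow> 'a"  (infixr \<open>##\<close> 65) where
  "x ## v \<equiv> case_nat x v"

text \<open>The numbers form a whole type, so number quantifiers unfold to plain HOL quantifiers;
  only the sets are restricted to a family.\<close>

locale so_struct =
  fixes zero one :: 'n and add mul :: "'n \<Rightarrow> 'n \<Rightarrow> 'n" and less :: "'n \<Rightarrow> 'n \<Rightarrow> bool"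
    and S :: "'n set set"
begin

primrec ev2 :: "(nat \<Rightarrow> 'n) \<Rightarrow> tm2 \<Rightarrow> 'n" where
  "ev2 v (NVar i) = v i"
| "ev2 v Zero2 = zero"
| "ev2 v One2 = one"
| "ev2 v (Plus2 t u) = add (ev2 v t) (ev2 v u)"
| "ev2 v (Times2 t u) = mul (ev2 v t) (ev2 v u)"

primrec holds_atom2 :: "(nat \<Rightarrow> 'n) \<Rightarrow> (nat \<Rightarrow> 'n set) \<Rightarrow> atom2 \<Rightarrow> bool" where
  "holds_atom2 v W (EqA2 t u) \<longleftrightarrow> ev2 v t = ev2 v u"
| "holds_atom2 v W (LessA2 t u) \<longleftrightarrow> less (ev2 v t) (ev2 v u)"
| "holds_atom2 v W (MemA t X) \<longleftrightarrow> ev2 v t \<in> W X"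

primrec holds2 :: "(nat \<Rightarrow> 'n) \<Rightarrow> (nat \<Rightarrow> 'n set) \<Rightarrow> form2 \<Rightarrow> bool" where
  "holds2 v W (Atom a) \<longleftrightarrow> holds_atom2 v W a"
| "holds2 v W Fls \<longleftrightarrow> False"
| "holds2 v W (\<phi> \<^bold>\<longrightarrow> \<psi>) \<longleftrightarrow> (holds2 v W \<phi> \<longrightarrow> holds2 v W \<psi>)"
| "holds2 v W (All s \<phi>) \<longleftrightarrow>
     (case s of NumS \<Rightarrow> \<forall>x. holds2 (x ## v) W \<phi> | SetS \<Rightarrow> \<forall>A\<in>S. holds2 v (A ## W) \<phi>)"

lemma holds2_connectives [simp]:
  "holds2 v W (\<^bold>\<not> \<phi>) \<longleftrightarrow> \<not> holds2 v W \<phi>"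
  "holds2 v W (\<phi> \<^bold>\<and> \<psi>) \<longleftrightarrow> holds2 v W \<phi> \<and> holds2 v W \<psi>"
  "holds2 v W (\<phi> \<^bold>\<or> \<psi>) \<longleftrightarrow> holds2 v W \<phi> \<or> holds2 v W \<psi>"
  "holds2 v W (\<phi> \<^bold>\<longleftrightarrow> \<psi>) \<longleftrightarrow> (holds2 v W \<phi> \<longleftrightarrow> holds2 v W \<psi>)"
  "holds2 v W (ExN \<phi>) \<longleftrightarrow> (\<exists>x. holds2 (x ## v) W \<phi>)"
  "holds2 v W (ExS \<phi>) \<longleftrightarrow> (\<exists>A\<in>S. holds2 v (A ## W) \<phi>)"
  by (auto simp: Neg_def And_def Or_def Iff_def Ex_def)

definition pr :: "'n \<Rightarrow> 'n \<Rightarrow> 'n" where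
  "pr i j = add (mul (add i j) (add i j)) i"

lemma ev2_pair [simp]: "ev2 v (pair s t) = pr (ev2 v s) (ev2 v t)"
  by (simp add: pair_def pr_def)

lemma ev2_cong: "(\<And>i. (NumS, i) \<in> tm2_vars t \<Longrightarrow> v i = v' i) \<Longrightarrow> ev2 v t = ev2 v' t"
  by (induction t) auto

lemma holds2_cong:
  "(\<And>i. (NumS, i) \<in> free_vars atom2_vars \<phi> \<Longrightarrow> v i = v' i) \<Longrightarrow>
   (\<And>i. (SetS, i) \<in> free_vars atom2_vars \<phi> \<Longrightarrow> W i = W' i) \<Longrightarrow>
   holds2 v W \<phi> \<longleftrightarrow> holds2 v' W' \<phi>"
proof (induction \<phi> arbitrary: v v' W W')
  case (Atom a)
  show ?case
  proof (cases a)
    case (EqA2 t u)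
    then show ?thesis using Atom ev2_cong[of t v v'] ev2_cong[of u v v'] by simp
  next
    case (LessA2 t u)
    then show ?thesis using Atom ev2_cong[of t v v'] ev2_cong[of u v v'] by simp
  next
    case (MemA t X)
    then show ?thesis using Atom ev2_cong[of t v v'] by simp
  qed
next
  case (Imp \<phi> \<psi>)
  have "holds2 v W \<phi> \<longleftrightarrow> holds2 v' W' \<phi>" by (rule Imp.IH(1)) (simp_all add: Imp.prems)
  moreover have "holds2 v W \<psi> \<longleftrightarrow> holds2 v' W' \<psi>" by (rule Imp.IH(2)) (simp_all add: Imp.prems)
  ultimately show ?case by simp
next
  case (All s \<phi>)
  show ?case
  proof (cases s)
    case NumS
    have "holds2 (x ## v) W \<phi> \<longleftrightarrow> holds2 (x ## v') W' \<phi>" for x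
    proof (rule All.IH)
      show "(x ## v) i = (x ## v') i" if "(NumS, i) \<in> free_vars atom2_vars \<phi>" for i
        using All.prems(1)[of "i - 1"] that NumS by (cases i) auto
    qed (use All.prems(2) NumS in auto)
    then show ?thesis using NumS by simp
  next
    case SetS
    have "holds2 v (x ## W) \<phi> \<longleftrightarrow> holds2 v' (x ## W') \<phi>" for x
    proof (rule All.IH)
      show "(x ## W) i = (x ## W') i" if "(SetS, i) \<in> free_vars atom2_vars \<phi>" for i
        using All.prems(2)[of "i - 1"] that SetS by (cases i) auto
    qed (use All.prems(1) SetS in auto)
    then show ?thesis using SetS by simp
  qed
qed simp

subsection \<open>Arithmetical definability\<close>

definition dtm :: "((nat \<Rightarrow> 'n) \<Rightarrow> 'n) \<Rightarrow> bool" where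
  "dtm f \<longleftrightarrow> (\<exists>t. \<forall>v. f v = ev2 v t)"

text \<open>
  The rules below for quantifiers peel off number variables from the front of v, so that predicates
  written with ordinary quantifiers match them by higher-order patterns; the set argument A is the
  only set variable, and W holds the set parameters.
\<close>

definition dfn :: "(nat \<Rightarrow> 'n set) \<Rightarrow> ((nat \<Rightarrow> 'n) \<Rightarrow> 'n set \<Rightarrow> bool) \<Rightarrow> bool" where
  "dfn W P \<longleftrightarrow> (\<exists>\<phi>. arithmetical \<phi> \<and> (\<forall>v A. P v A \<longleftrightarrow> holds2 v (A ## W) \<phi>))"

lemma arithmetical_connectives [simp]:
  "arithmetical (\<^bold>\<not> \<phi>) \<longleftrightarrow> arithmetical \<phi>"
  "arithmetical (\<phi> \<^bold>\<and> \<psi>) \<longleftrightarrow> arithmetical \<phi> \<and> arithmetical \<psi>"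
  by (auto simp: Neg_def And_def)

named_theorems dfn_intros

lemma dtm_var [dfn_intros]: "dtm (\<lambda>v. v i)"
  unfolding dtm_def by (rule exI[of _ "NVar i"]) simp

lemma dtm_zero [dfn_intros]: "dtm (\<lambda>v. zero)"
  unfolding dtm_def by (rule exI[of _ Zero2]) simp

lemma dtm_one [dfn_intros]: "dtm (\<lambda>v. one)"
  unfolding dtm_def by (rule exI[of _ One2]) simp

lemma dtm_add [dfn_intros]:
  assumes "dtm f" "dtm g" shows "dtm (\<lambda>v. add (f v) (g v))"
proof -
  obtain t u where "\<forall>v. f v = ev2 v t" "\<forall>v. g v = ev2 v u" using assms by (auto simp: dtm_def)
  then show ?thesis unfolding dtm_def by (intro exI[of _ "Plus2 t u"]) simp
qed

lemma dtm_mul [dfn_intros]: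
  assumes "dtm f" "dtm g" shows "dtm (\<lambda>v. mul (f v) (g v))"
proof -
  obtain t u where "\<forall>v. f v = ev2 v t" "\<forall>v. g v = ev2 v u" using assms by (auto simp: dtm_def)
  then show ?thesis unfolding dtm_def by (intro exI[of _ "Times2 t u"]) simp
qed

lemma dtm_pr [dfn_intros]: "dtm f \<Longrightarrow> dtm g \<Longrightarrow> dtm (\<lambda>v. pr (f v) (g v))"
  unfolding pr_def by (intro dfn_intros)

lemma dtm_subst:
  assumes "\<And>i. dtm (f i)"
  shows "dtm (\<lambda>v. ev2 (\<lambda>i. f i v) t)"
  by (induction t) (simp_all add: assms dfn_intros)

lemma dfn_eq [dfn_intros]:
  assumes "dtm f" "dtm g" shows "dfn W (\<lambda>v A. f v = g v)"
proof -
  obtain t u where "\<forall>v. f v = ev2 v t" "\<forall>v. g v = ev2 v u" using assms by (auto simp: dtm_def)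
  then show ?thesis unfolding dfn_def by (intro exI[of _ "t =\<^sub>2 u"]) simp
qed

lemma dfn_less [dfn_intros]:
  assumes "dtm f" "dtm g" shows "dfn W (\<lambda>v A. less (f v) (g v))"
proof -
  obtain t u where "\<forall>v. f v = ev2 v t" "\<forall>v. g v = ev2 v u" using assms by (auto simp: dtm_def)
  then show ?thesis unfolding dfn_def by (intro exI[of _ "t <\<^sub>2 u"]) simp
qed

lemma dfn_mem [dfn_intros]:
  assumes "dtm f" shows "dfn W (\<lambda>v A. f v \<in> A)"
proof -
  obtain t where "\<forall>v. f v = ev2 v t" using assms by (auto simp: dtm_def)
  then show ?thesis unfolding dfn_def by (intro exI[of _ "t \<in>\<^sub>2 0"]) simp
qed

lemma dfn_param:
  assumes "dtm f" shows "dfn W (\<lambda>v A. f v \<in> W i)"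
proof -
  obtain t where "\<forall>v. f v = ev2 v t" using assms by (auto simp: dtm_def)
  then show ?thesis unfolding dfn_def by (intro exI[of _ "t \<in>\<^sub>2 Suc i"]) simp
qed

lemma dfn_False [dfn_intros]: "dfn W (\<lambda>v A. False)"
  unfolding dfn_def by (intro exI[of _ Fls]) simp

lemma dfn_imp [dfn_intros]:
  assumes "dfn W P" "dfn W Q" shows "dfn W (\<lambda>v A. P v A \<longrightarrow> Q v A)"
proof -
  obtain \<phi> \<psi> where "arithmetical \<phi>" "\<forall>v A. P v A \<longleftrightarrow> holds2 v (A ## W) \<phi>"
    "arithmetical \<psi>" "\<forall>v A. Q v A \<longleftrightarrow> holds2 v (A ## W) \<psi>" using assms by (auto simp: dfn_def)
  then show ?thesis unfolding dfn_def by (intro exI[of _ "\<phi> \<^bold>\<longrightarrow> \<psi>"]) simp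
qed

lemma dfn_all [dfn_intros]:
  assumes "dfn W (\<lambda>v A. P (v 0) (\<lambda>k. v (Suc k)) A)" shows "dfn W (\<lambda>v A. \<forall>x. P x v A)"
proof -
  obtain \<phi> where "arithmetical \<phi>" "\<forall>v A. P (v 0) (\<lambda>k. v (Suc k)) A \<longleftrightarrow> holds2 v (A ## W) \<phi>"
    using assms by (auto simp: dfn_def)
  moreover from this(2) have "P x v A \<longleftrightarrow> holds2 (x ## v) (A ## W) \<phi>" for x v A
    by (metis (no_types, lifting) ext nat.case(1) nat.case(2))
  ultimately show ?thesis unfolding dfn_def by (intro exI[of _ "AllN \<phi>"]) simp
qed

lemma dfn_not [dfn_intros]: "dfn W P \<Longrightarrow> dfn W (\<lambda>v A. \<not> P v A)"
  using dfn_imp[OF _ dfn_False] by simp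

lemma dfn_or [dfn_intros]: "dfn W P \<Longrightarrow> dfn W Q \<Longrightarrow> dfn W (\<lambda>v A. P v A \<or> Q v A)"
  using dfn_imp[OF dfn_not, of W P Q] by (simp add: disj_imp)

lemma dfn_and [dfn_intros]: "dfn W P \<Longrightarrow> dfn W Q \<Longrightarrow> dfn W (\<lambda>v A. P v A \<and> Q v A)"
  using dfn_not[OF dfn_or[OF dfn_not dfn_not], of W P Q] by simp

lemma dfn_iff [dfn_intros]: "dfn W P \<Longrightarrow> dfn W Q \<Longrightarrow> dfn W (\<lambda>v A. P v A \<longleftrightarrow> Q v A)"
  unfolding iff_conv_conj_imp by (intro dfn_intros)

lemma dfn_ex [dfn_intros]:
  assumes "dfn W (\<lambda>v A. P (v 0) (\<lambda>k. v (Suc k)) A)" shows "dfn W (\<lambda>v A. \<exists>x. P x v A)"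
  using dfn_not[OF dfn_all[OF dfn_not[OF assms]]] by simp

text \<open>This takes the place of a syntactic substitution for second-order formulas. Under a
  number quantifier index 0 is the new variable and the old terms read the shifted
  assignment.\<close>

lemma dfn_num_subst:
  assumes "dfn W P" and f: "\<And>i. dtm (f i)"
  shows "dfn W (\<lambda>v A. P (\<lambda>i. f i v) A)"
proof -
  obtain \<phi> where \<phi>: "arithmetical \<phi>" "\<And>v A. P v A \<longleftrightarrow> holds2 v (A ## W) \<phi>"
    using assms by (auto simp: dfn_def)
  from \<phi>(1) f have "dfn W (\<lambda>v A. holds2 (\<lambda>i. f i v) (A ## W) \<phi>)"
  proof (induction \<phi> arbitrary: f)
    case (Atom a)
    note s = dtm_subst[of f, OF Atom.prems(2)]
    show ?case
    proof (cases a)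
      case (MemA t X)
      then show ?thesis
        using dfn_mem[OF s[of t]] dfn_param[OF s[of t]] by (cases X) simp_all
    qed (simp_all add: dfn_eq dfn_less s)
  next
    case (All s \<phi>)
    let ?f = "(\<lambda>v. v 0) ## (\<lambda>i v. f i (\<lambda>k. v (Suc k)))"
    have "dtm (?f i)" for i
    proof (cases i)
      case (Suc j)
      obtain t where "f j = (\<lambda>v. ev2 v t)" using All.prems(2)[of j] by (auto simp: dtm_def)
      then show ?thesis using dtm_subst[of "\<lambda>i v. v (Suc i)" t] dtm_var Suc by simp
    qed (simp add: dtm_var)
    then have "dfn W (\<lambda>v A. holds2 (\<lambda>i. ?f i v) (A ## W) \<phi>)"
      using All.prems(1) by (intro All.IH) simp_all
    moreover have "(\<lambda>i. ?f i v) = v 0 ## (\<lambda>i. f i (\<lambda>k. v (Suc k)))" for v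
      by (auto simp: fun_eq_iff split: nat.split)
    ultimately have "dfn W (\<lambda>v A. holds2 (v 0 ## (\<lambda>i. f i (\<lambda>k. v (Suc k)))) (A ## W) \<phi>)" by simp
    from dfn_all[OF this] show ?case using All.prems(1) by simp
  qed (simp_all add: dfn_False dfn_imp)
  then show ?thesis using \<phi>(2) by simp
qed

text \<open>Set variables may be replaced by definable classes that depend on number variables. Thus
  \<open>\<theta>(n, Y^j)\<close> is arithmetical in Y without a quantifier over the segment
  \<open>Y^j\<close>.\<close>

lemma dfn_set_subst:
  assumes "arithmetical \<theta>" and "\<And>i. dtm (f i)"
    and "\<And>i. dfn W (\<lambda>v A. Q i (v 0) (\<lambda>k. v (Suc k)) A)"
  shows "dfn W (\<lambda>v A. holds2 (\<lambda>i. f i v) (\<lambda>i. {p. Q i p v A}) \<theta>)"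
  using assms
proof (induction \<theta> arbitrary: f Q)
  case (Atom a)
  note s = dtm_subst[of f, OF Atom.prems(2)]
  show ?case
  proof (cases a)
    case (MemA t X)
    \<comment> \<open>The value of t enters at variable 0, the place of the element, and the
      parameters behind it move back to their own indices.\<close>
    let ?f = "(\<lambda>v. ev2 (\<lambda>i. f i v) t) ## (\<lambda>i v. v i)"
    have "dtm (?f i)" for i
      using s[of t] by (cases i) (simp_all add: dtm_var)
    from dfn_num_subst[of _ _ ?f, OF Atom.prems(3)[of X] this] show ?thesis using MemA by simp
  qed (simp_all add: dfn_eq dfn_less s)
next
  case (All s \<phi>)
  let ?f = "(\<lambda>v. v 0) ## (\<lambda>i v. f i (\<lambda>k. v (Suc k)))"
  let ?Q = "\<lambda>i p v A. Q i p (\<lambda>k. v (Suc k)) A"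
  have "dtm (?f i)" for i
  proof (cases i)
    case (Suc j)
    obtain t where "f j = (\<lambda>v. ev2 v t)" using All.prems(2)[of j] by (auto simp: dtm_def)
    then show ?thesis using dtm_subst[of "\<lambda>i v. v (Suc i)" t] dtm_var Suc by simp
  qed (simp add: dtm_var)
  moreover have "dfn W (\<lambda>v A. ?Q i (v 0) (\<lambda>k. v (Suc k)) A)" for i
  proof -
    \<comment> \<open>Keep the element at index 0 and skip index 1, the number just quantified, on
      which the class does not depend.\<close>
    let ?g = "(\<lambda>v. v 0) ## (\<lambda>i v. v (Suc (Suc i)))"
    have "dtm (?g i)" for i
      by (cases i) (simp_all add: dtm_var)
    from dfn_num_subst[of _ _ ?g, OF All.prems(3)[of i] this] show ?thesis by simp
  qed
  ultimately have "dfn W (\<lambda>v A. holds2 (\<lambda>i. ?f i v) (\<lambda>i. {p. ?Q i p v A}) \<phi>)"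
    using All.prems(1) by (intro All.IH) simp_all
  moreover have "(\<lambda>i. ?f i v) = v 0 ## (\<lambda>i. f i (\<lambda>k. v (Suc k)))" for v
    by (auto simp: fun_eq_iff split: nat.split)
  ultimately have "dfn W (\<lambda>v A. holds2 (v 0 ## (\<lambda>i. f i (\<lambda>k. v (Suc k))))
    (\<lambda>i. {p. Q i p (\<lambda>k. v (Suc k)) A}) \<phi>)" by simp
  from dfn_all[of W "\<lambda>x v A. holds2 (x ## (\<lambda>i. f i v)) (\<lambda>i. {p. Q i p v A}) \<phi>", OF this]
  show ?case using All.prems(1) by simp
qed (simp_all add: dfn_False dfn_imp)

end

subsection \<open>Arithmetic\<close>

text \<open>Of the higher types only closure properties of the family of sets remain. Induction is
  restricted to these sets since the numbers may be nonstandard. In dependent choice f is a HOL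
  function whose graph is a set of the structure.\<close>

locale so_model = so_struct +
  assumes succ_neq_zero: "add n one \<noteq> zero"
    and succ_inject: "add m one = add n one \<Longrightarrow> m = n"
    and add_zero: "add m zero = m"
    and add_succ: "add m (add n one) = add (add m n) one"
    and mul_zero: "mul m zero = zero"
    and mul_succ: "mul m (add n one) = add (mul m n) m"
    and not_less_zero: "\<not> less m zero"
    and less_succ: "less m (add n one) \<longleftrightarrow> less m n \<or> m = n"
    and nonempty: "S \<noteq> {}"
    and induction: "A \<in> S \<Longrightarrow> zero \<in> A \<Longrightarrow> (\<And>n. n \<in> A \<Longrightarrow> add n one \<in> A) \<Longrightarrow> n \<in> A"
    and comprehension: "arithmetical \<phi> \<Longrightarrow> (\<And>i. W i \<in> S) \<Longrightarrow> {x. holds2 (x ## v) W \<phi>} \<in> S"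
    and boot: "arithmetical \<phi> \<Longrightarrow> (\<And>i. W i \<in> S) \<Longrightarrow>
      (\<And>x A B. A \<in> S \<Longrightarrow> B \<in> S \<Longrightarrow> holds2 (x ## v) (A ## W) \<phi> \<Longrightarrow> holds2 (x ## v) (B ## W) \<phi> \<Longrightarrow> A = B) \<Longrightarrow>
      {x. \<exists>A\<in>S. holds2 (x ## v) (A ## W) \<phi>} \<in> S"
    and dependent_choice: "arithmetical \<phi> \<Longrightarrow> (\<And>i. W i \<in> S) \<Longrightarrow>
      (\<And>x. \<exists>y. holds2 (y ## x ## v) W \<phi>) \<Longrightarrow>
      \<exists>f. f zero = a \<and> (\<forall>n. holds2 (f (add n one) ## f n ## v) W \<phi>) \<and> {p. \<exists>n. p = pr n (f n)} \<in> S"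
begin

lemma scons_in: "A \<in> S \<Longrightarrow> (\<And>i. W i \<in> S) \<Longrightarrow> (A ## W) i \<in> S"
  by (cases i) simp_all

lemma dfn_comprehension:
  assumes "dfn W (\<lambda>v A. P (v 0) (\<lambda>k. v (Suc k)) A)" "\<And>i. W i \<in> S" "A \<in> S"
  shows "{x. P x v A} \<in> S"
proof -
  obtain \<phi> where "arithmetical \<phi>" "\<And>v A. P (v 0) (\<lambda>k. v (Suc k)) A \<longleftrightarrow> holds2 v (A ## W) \<phi>"
    using assms(1) by (auto simp: dfn_def)
  moreover from this(2)[of "_ ## v"] have "{x. P x v A} = {x. holds2 (x ## v) (A ## W) \<phi>}" by simp
  ultimately show ?thesis using comprehension scons_in assms(2,3) by simp
qed

lemma dfn_boot:
  assumes "dfn W (\<lambda>v A. P (v 0) (\<lambda>k. v (Suc k)) A)" "\<And>i. W i \<in> S"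
    and "\<And>x A B. A \<in> S \<Longrightarrow> B \<in> S \<Longrightarrow> P x v A \<Longrightarrow> P x v B \<Longrightarrow> A = B"
  shows "{x. \<exists>A\<in>S. P x v A} \<in> S"
proof -
  obtain \<phi> where \<phi>: "arithmetical \<phi>" "\<And>v A. P (v 0) (\<lambda>k. v (Suc k)) A \<longleftrightarrow> holds2 v (A ## W) \<phi>"
    using assms(1) by (auto simp: dfn_def)
  have "P x v A \<longleftrightarrow> holds2 (x ## v) (A ## W) \<phi>" for x A using \<phi>(2)[of "x ## v"] by simp
  then show ?thesis using boot[OF \<phi>(1) assms(2)] assms(3) by simp
qed

lemma dfn_dependent_choice:
  assumes "dfn W (\<lambda>v A. P (v 0) (v 1))" "\<And>i. W i \<in> S"
    and "\<And>x. \<exists>y. P y x"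
  shows "\<exists>f. f zero = a \<and> (\<forall>n. P (f (add n one)) (f n)) \<and> {p. \<exists>n. p = pr n (f n)} \<in> S"
proof -
  obtain \<phi> where \<phi>: "arithmetical \<phi>" "\<And>v A. P (v 0) (v 1) \<longleftrightarrow> holds2 v (A ## W) \<phi>"
    using assms(1) by (auto simp: dfn_def)
  obtain A where A: "A \<in> S" using nonempty by blast
  have "P y x \<longleftrightarrow> holds2 (y ## x ## v) (A ## W) \<phi>" for y x v using \<phi>(2)[of "y ## x ## v"] by simp
  then show ?thesis
    using dependent_choice[OF \<phi>(1), of "A ## W" "\<lambda>_. zero" a] scons_in[OF A] assms(2,3) by simp
qed

lemma dfn_induction:
  assumes "dfn W (\<lambda>v A. P (v 0) (\<lambda>k. v (Suc k)) A)" "\<And>i. W i \<in> S" "A \<in> S"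
    and "P zero v A" "\<And>n. P n v A \<Longrightarrow> P (add n one) v A"
  shows "P n v A"
  using induction[OF dfn_comprehension[of W P A v, OF assms(1-3)], of n] assms(4,5) by simp

lemma num_induction:
  assumes "\<And>W. dfn W (\<lambda>v A. P (v 0))" "P zero" "\<And>n. P n \<Longrightarrow> P (add n one)"
  shows "P n"
proof -
  \<comment> \<open>Any set of the structure can fill the parameter places, since P mentions no
    set.\<close>
  obtain A where "A \<in> S" using nonempty by blast
  then show ?thesis using dfn_induction[of "\<lambda>_. A" "\<lambda>x v A. P x" A] assms by simp
qed

section \<open>Semiring laws and injectivity of pairing\<close>

lemma zero_add: "add zero n = n"
  by (induction n rule: num_induction) (intro dfn_intros | simp add: add_zero add_succ)+

lemma succ_add: "add (add m one) n = add (add m n) one"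
proof -
  have "\<forall>m. add (add m one) n = add (add m n) one"
    by (induction n rule: num_induction) (intro dfn_intros | simp add: add_zero add_succ)+
  then show ?thesis by blast
qed

lemma add_comm: "add m n = add n m"
proof -
  have "\<forall>m. add m n = add n m"
    by (induction n rule: num_induction) (intro dfn_intros | simp add: add_zero zero_add add_succ succ_add)+
  then show ?thesis by blast
qed

lemma add_assoc: "add (add a b) c = add a (add b c)"
proof -
  have "\<forall>a b. add (add a b) c = add a (add b c)"
    by (induction c rule: num_induction) (intro dfn_intros | simp add: add_zero add_succ)+
  then show ?thesis by blast
qed

sublocale add: comm_monoid add zero
  by unfold_locales (rule add_assoc add_comm add_zero)+

lemma add_cancel: "add a c = add b c \<Longrightarrow> a = b"
proof -
  have "\<forall>a b. add a c = add b c \<longrightarrow> a = b"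
  proof (induction c rule: num_induction)
    case 1
    show ?case by (intro dfn_intros)
  next
    case (3 n)
    show ?case
    proof (intro allI impI)
      fix a b assume "add a (add n one) = add b (add n one)"
      then have "add a n = add b n" unfolding add_succ by (rule succ_inject)
      then show "a = b" using 3 by simp
    qed
  qed (simp add: add_zero)
  then show "add a c = add b c \<Longrightarrow> a = b" by simp
qed

lemma mul_distrib_left: "mul a (add b c) = add (mul a b) (mul a c)"
proof -
  have "\<forall>a b. mul a (add b c) = add (mul a b) (mul a c)"
    by (induction c rule: num_induction)
      (intro dfn_intros | simp add: add_zero mul_zero add_succ mul_succ add_assoc[symmetric])+
  then show ?thesis by blast
qed

lemma mul_distrib_right: "mul (add a b) c = add (mul a c) (mul b c)"
proof -
  have "\<forall>a b. mul (add a b) c = add (mul a c) (mul b c)"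
    by (induction c rule: num_induction)
      (intro dfn_intros | simp add: mul_zero add_zero mul_succ add.assoc add.commute add.left_commute)+
  then show ?thesis by blast
qed

lemma zero_or_succ: "n = zero \<or> (\<exists>m. n = add m one)"
  by (induction n rule: num_induction) (intro dfn_intros | blast)+

text \<open>Comparability expressed by differences; the pairing argument uses this instead of the
  order relation.\<close>

lemma add_total: "\<exists>d. add a d = b \<or> add b d = a"
proof -
  have "\<forall>b. \<exists>d. add a d = b \<or> add b d = a"
  proof (induction a rule: num_induction)
    case (2)
    show ?case using zero_add by blast
  next
    case (3 n)
    show ?case
    proof
      fix b
      from 3 obtain d where "add n d = b \<or> add b d = n" by blast
      then show "\<exists>d. add (add n one) d = b \<or> add b d = add n one"
      proof
        assume d: "add n d = b"
        from zero_or_succ[of d] show ?thesis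
        proof
          assume "d = zero"
          then have "add b one = add n one" using d add_zero by simp
          then show ?thesis by blast
        next
          assume "\<exists>m. d = add m one"
          then obtain m where "d = add m one" by blast
          then have "add (add n one) m = b" using d by (simp add: add_succ succ_add)
          then show ?thesis by blast
        qed
      next
        assume "add b d = n"
        then have "add b (add d one) = add n one" by (simp add: add_succ)
        then show ?thesis by blast
      qed
    qed
  qed (intro dfn_intros)
  then show ?thesis by blast
qed

text \<open>Since i is at most s, the number \<open>s^2 + i\<close> is below
  \<open>(s + 1)^2\<close>, so codes of pairs with different sums differ. The proof only cancels:
  removing \<open>s * s\<close> and then i from both sides leaves zero equal to a successor.\<close>

lemma pr_add_succ_neq:
  assumes "add i j = s" shows "add (mul s s) i \<noteq> add (mul (add s (add d one)) (add s (add d one))) k"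
proof
  define c where "c = add d one"
  assume "add (mul s s) i = add (mul (add s (add d one)) (add s (add d one))) k"
  then have "add (mul s s) i = add (mul (add s c) (add s c)) k" by (simp add: c_def)
  also have "\<dots> = add (mul s s) (add (mul s c) (add (mul c s) (add (mul c c) k)))"
    by (simp add: mul_distrib_left mul_distrib_right add.assoc add.commute add.left_commute)
  finally have "i = add (mul s c) (add (mul c s) (add (mul c c) k))"
    using add_cancel add.commute by metis
  \<comment> \<open>One summand of \<open>s * (d + 1)\<close> is s, which contains the i to be
    cancelled.\<close>
  also have "mul s c = add (mul s d) (add i j)" by (simp add: c_def mul_succ assms)
  \<comment> \<open>The square of \<open>d + 1\<close> supplies the final successor.\<close>
  also have "mul c c = add (add (mul c d) d) one" by (simp add: c_def mul_succ add_assoc)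
  finally have "add zero i = add (add (add (mul s d) (add j (add (mul c s) (add (add (mul c d) d) k)))) one) i"
    by (simp add: add.assoc add.commute add.left_commute)
  then have "zero = add (add (mul s d) (add j (add (mul c s) (add (add (mul c d) d) k)))) one"
    by (rule add_cancel)
  then show False using succ_neq_zero by metis
qed

text \<open>Different sums are excluded by \<open>pr_add_succ_neq\<close>; with equal sums the
  squares cancel.\<close>

lemma pr_inject: "pr i j = pr i' j' \<longleftrightarrow> i = i' \<and> j = j'"
proof
  assume eq: "pr i j = pr i' j'"
  have "add i j = add i' j'"
  proof (rule ccontr)
    assume ne: "add i j \<noteq> add i' j'"
    obtain d where d: "add (add i j) d = add i' j' \<or> add (add i' j') d = add i j"
      using add_total by blast
    then have "d \<noteq> zero" using ne add_zero by auto
    then obtain c where c: "d = add c one" using zero_or_succ by blast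
    from d eq show False
      using pr_add_succ_neq[of i j "add i j" c i'] pr_add_succ_neq[of i' j' "add i' j'" c i]
      unfolding c pr_def by metis
  qed
  moreover from this have "i = i'" using eq add_cancel add.commute unfolding pr_def by metis
  ultimately show "i = i' \<and> j = j'" using add_cancel add.commute by metis
qed simp

end

subsection \<open>Arithmetical transfinite recursion\<close>

locale so_recursion = so_model +
  fixes v :: "nat \<Rightarrow> 'a" and W :: "nat \<Rightarrow> 'a set" and X :: "'a set" and \<theta> :: form2
  assumes W_in: "W i \<in> S" and X_in: "X \<in> S"
    and WO: "holds2 v (X ## W) (WellOrder 0)"
    and \<theta>: "arithmetical \<theta>" "{(NumS, 1), (NumS, 2), (SetS, 1)} \<inter> free_vars atom2_vars \<theta> = {}"
begin

definition le :: "'a \<Rightarrow> 'a \<Rightarrow> bool" where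
  "le i j \<longleftrightarrow> pr i j \<in> X"

definition lss :: "'a \<Rightarrow> 'a \<Rightarrow> bool" where
  "lss i j \<longleftrightarrow> pr i j \<in> X \<and> pr j i \<notin> X"

definition seg :: "'a \<Rightarrow> 'a set \<Rightarrow> 'a set" where
  "seg i Y = {q. \<exists>m k. q = pr m k \<and> lss k i \<and> pr m k \<in> Y}"

lemmas order_simps = WellOrder_def WellFounded_def LinearOrder_def Reflexive_def FunctionToFld_def
  Let_def LeX_def LessX_def Fld_def numeral_2_eq_2 numeral_3_eq_3

lemma linear: "holds2 v (X ## W) (LinearOrder 0)"
  using WO by (simp only: WellOrder_def holds2_connectives)

text \<open>For an arbitrary index, because the order is set variable 0 in \<open>WellOrder\<close>
  but 1 in \<open>Hierarchy\<close>.\<close>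

lemma LinearOrder_iff:
  "holds2 u U (LinearOrder s) \<longleftrightarrow>
    (\<forall>i j. pr i j \<in> U s \<longrightarrow> pr i i \<in> U s \<and> pr j j \<in> U s) \<and>
    (\<forall>i j k. pr i j \<in> U s \<and> pr j k \<in> U s \<longrightarrow> pr i k \<in> U s) \<and>
    (\<forall>i j. pr i j \<in> U s \<and> pr j i \<in> U s \<longrightarrow> i = j) \<and>
    (\<forall>i j. pr i i \<in> U s \<and> pr j j \<in> U s \<longrightarrow> pr i j \<in> U s \<or> pr j i \<in> U s)"
  unfolding LinearOrder_def Reflexive_def Let_def LeX_def Fld_def
  by (simp add: numeral_2_eq_2)

lemmas linear' = linear[unfolded LinearOrder_iff nat.case, folded le_def]

lemma le_field: "le i j \<Longrightarrow> le i i \<and> le j j"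
  using linear' by blast

lemma le_trans: "le i j \<Longrightarrow> le j k \<Longrightarrow> le i k"
  using linear' by blast

lemma lss_le: "lss i j \<longleftrightarrow> le i j \<and> \<not> le j i"
  by (simp add: le_def lss_def)

lemma lss_trans: "lss i j \<Longrightarrow> lss j k \<Longrightarrow> lss i k"
  unfolding lss_le using le_trans by blast

lemma lss_field: "lss i j \<Longrightarrow> le i i" "lss i j \<Longrightarrow> le j j"
  unfolding lss_le using le_field by blast+

section \<open>Descending sequences and least elements\<close>

lemma no_descending_sequence:
  assumes F: "{p. \<exists>n. p = pr n (f n)} \<in> S" and field: "\<And>n. le (f n) (f n)"
    and desc: "\<And>n. lss (f (add n one)) (f n)"
  shows False
proof -
  let ?F = "{p. \<exists>n. p = pr n (f n)}"
  have F_mem: "pr n m \<in> ?F \<longleftrightarrow> m = f n" for n m by (auto simp: pr_inject)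
  have "holds2 v (?F ## X ## W) (FunctionToFld 0 1)"
    using field by (auto simp: order_simps F_mem le_def pr_inject)
  moreover have "holds2 v (?F ## X ## W)
     (AllN (AllN (AllN (let l = NVar 0; m = NVar 1; n = NVar 2 in
         (pair n m \<in>\<^sub>2 0) \<^bold>\<and> (pair (n +\<^sub>2 One2) l \<in>\<^sub>2 0) \<^bold>\<longrightarrow> LessX 1 l m))))"
    using desc by (auto simp: order_simps pr_inject lss_def)
  moreover have "\<not> holds2 v (X ## W) (ExS (let F = 0; X' = Suc 0 in
       FunctionToFld F X' \<^bold>\<and>
       AllN (AllN (AllN (let l = NVar 0; m = NVar 1; n = NVar 2 in
         (pair n m \<in>\<^sub>2 F) \<^bold>\<and> (pair (n +\<^sub>2 One2) l \<in>\<^sub>2 F) \<^bold>\<longrightarrow> LessX X' l m)))))"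
    using WO unfolding WellOrder_def WellFounded_def holds2_connectives by blast
  ultimately show False
    using F unfolding holds2_connectives Let_def One_nat_def by blast
qed

definition params :: "nat \<Rightarrow> 'a set" where
  "params = X ## W"

lemma params_in: "params i \<in> S"
  unfolding params_def by (rule scons_in[OF X_in W_in])

lemma dfn_X:
  assumes "U i = X" "dtm f" shows "dfn U (\<lambda>v A. f v \<in> X)"
  using dfn_param[OF assms(2), of U i] assms(1) by simp

lemma dfn_lss:
  assumes "U i = X" "dtm f" "dtm g"
  shows "dfn U (\<lambda>v A. lss (f v) (g v))"
  unfolding lss_def by (intro dfn_intros dfn_X[where U = U and i = i] assms)

text \<open>\<open>WellFounded\<close> only forbids descending sequences that are sets of the
  structure. Dependent choice makes one from a set without least element by always stepping to a
  smaller member.\<close>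

lemma minimal_element:
  assumes A: "A \<in> S" and field: "\<And>i. i \<in> A \<Longrightarrow> le i i" and a: "a \<in> A"
  shows "\<exists>j\<in>A. \<forall>i. lss i j \<longrightarrow> i \<notin> A"
proof (rule ccontr)
  assume none: "\<not> ?thesis"
  let ?U = "X ## (\<lambda>_. A)"
  have U: "?U i \<in> S" for i by (rule scons_in[OF X_in A])
  have dA: "dfn ?U (\<lambda>v B. f v \<in> A)" if "dtm f" for f
    using dfn_param[OF that, of ?U 1] by simp
  have "dfn ?U (\<lambda>v B. v 1 \<in> A \<longrightarrow> v 0 \<in> A \<and> lss (v 0) (v 1))"
    by (intro dfn_intros dA dfn_lss[of _ 0]) simp
  \<comment> \<open>The implication makes the relation total, as dependent choice demands; outside A
    any successor will do.\<close>
  moreover have "\<exists>y. x \<in> A \<longrightarrow> y \<in> A \<and> lss y x" for x using none by blast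
  ultimately obtain f where f: "f zero = a" "\<And>n. f n \<in> A \<Longrightarrow> f (add n one) \<in> A \<and> lss (f (add n one)) (f n)"
    "{p. \<exists>n. p = pr n (f n)} \<in> S"
    using dfn_dependent_choice[of ?U "\<lambda>y x. x \<in> A \<longrightarrow> y \<in> A \<and> lss y x" a] U by blast
  let ?F = "{p. \<exists>n. p = pr n (f n)}"
  \<comment> \<open>As a HOL function f is not definable, so the induction formula refers to its
    graph, the set argument B.\<close>
  have "dfn ?U (\<lambda>v B. \<exists>m. pr (v 0) m \<in> B \<and> m \<in> A)"
    by (intro dfn_intros dA)
  then have "\<exists>m. pr n m \<in> ?F \<and> m \<in> A" for n
    by (rule dfn_induction[where v = v and P = "\<lambda>n v B. \<exists>m. pr n m \<in> B \<and> m \<in> A"])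
      (use U f a in \<open>auto simp: pr_inject\<close>)
  then have "f n \<in> A" for n by (auto simp: pr_inject)
  then show False using no_descending_sequence[OF f(3)] f(2) field by blast
qed

text \<open>The places of j, k and Y, which do not occur in \<open>\<theta>\<close>, receive fixed
  values, so that one predicate describes \<open>\<theta>\<close> wherever it is evaluated.\<close>

definition TH :: "(nat \<Rightarrow> 'a) \<Rightarrow> 'a \<Rightarrow> 'a set \<Rightarrow> bool" where
  "TH u n Z \<longleftrightarrow> holds2 (n ## zero ## zero ## u) (Z ## {} ## params) \<theta>"

lemma holds2_\<theta>: "holds2 (n ## j ## k ## u) (Z ## Y ## params) \<theta> \<longleftrightarrow> TH u n Z"
  unfolding TH_def
proof (rule holds2_cong)
  fix i
  show "(NumS, i) \<in> free_vars atom2_vars \<theta> \<Longrightarrow> (n ## j ## k ## u) i = (n ## zero ## zero ## u) i"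
    using \<theta>(2) by (auto split: nat.splits simp: numeral_2_eq_2)
  show "(SetS, i) \<in> free_vars atom2_vars \<theta> \<Longrightarrow> (Z ## Y ## params) i = (Z ## {} ## params) i"
    using \<theta>(2) by (auto split: nat.splits)
qed

lemma dfn_TH [dfn_intros]:
  assumes g: "\<And>i. dtm (g i)" and n: "dtm n"
    and Q: "dfn params (\<lambda>v A. Q (v 0) (\<lambda>k. v (Suc k)) A)"
  shows "dfn params (\<lambda>v A. TH (\<lambda>i. g i v) (n v) {p. Q p v A})"
proof -
  let ?f = "n ## (\<lambda>v. zero) ## (\<lambda>v. zero) ## g"
  let ?Q = "Q ## (\<lambda>p v A. False) ## (\<lambda>i p v A. p \<in> params i)"
  have f: "dtm (?f i)" for i
    using g n by (auto simp: dtm_zero split: nat.splits)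
  have Q': "dfn params (\<lambda>v A. ?Q i (v 0) (\<lambda>k. v (Suc k)) A)" for i
    using Q by (auto intro: dfn_False dfn_param dtm_var split: nat.splits)
  have "(\<lambda>i. ?f i v) = n v ## zero ## zero ## (\<lambda>i. g i v)" for v
    by (auto simp: fun_eq_iff split: nat.splits)
  moreover have "(\<lambda>i. {p. ?Q i p v A}) = {p. Q p v A} ## {} ## params" for v A
    by (auto simp: fun_eq_iff split: nat.splits)
  ultimately show ?thesis
    using dfn_set_subst[where f = ?f and Q = ?Q, OF \<theta>(1) f Q'] by (simp add: TH_def)
qed

text \<open>An approximation: the hierarchy on the strict predecessors of j, as a fixed point. Row i
  is computed from the rows before i, which is why well-foundedness makes it unique.\<close>

definition HS :: "(nat \<Rightarrow> 'a) \<Rightarrow> 'a \<Rightarrow> 'a set \<Rightarrow> bool" where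
  "HS u j Y \<longleftrightarrow> (\<forall>p. p \<in> Y \<longleftrightarrow> (\<exists>n i. p = pr n i \<and> lss i j \<and> TH u n (seg i Y)))"

lemma dfn_HS [dfn_intros]:
  assumes g: "\<And>i. dtm (g i)" and "dtm j"
  shows "dfn params (\<lambda>v A. HS (\<lambda>i. g i v) (j v) A)"
proof -
  have "dfn params (\<lambda>v A. HS (\<lambda>i. v (Suc i)) (v 0) A)"
    unfolding HS_def seg_def by (intro dfn_intros dfn_lss[of _ 0]) (simp_all add: params_def)
  from dfn_num_subst[where f = "j ## g", OF this] show ?thesis
    using assms by (simp split: nat.split)
qed

text \<open>At the least row where two approximations differ, the segments before it coincide, and
  these segments determine the row. Allowing different lengths j and j' also serves the comparison
  of an approximation with its restrictions.\<close>

lemma HS_agree: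
  assumes HS: "HS v j Y" "HS v j' Y'" and Y: "Y \<in> S" "Y' \<in> S" and i: "lss i j" "lss i j'"
  shows "pr n i \<in> Y \<longleftrightarrow> pr n i \<in> Y'"
proof (rule ccontr)
  assume neq: "\<not> ?thesis"
  let ?A = "{i. lss i j \<and> lss i j' \<and> (\<exists>n. \<not> (pr n i \<in> Y \<longleftrightarrow> pr n i \<in> Y'))}"
  let ?U = "X ## (\<lambda>_. Y')"
  have U: "?U i \<in> S" for i by (rule scons_in[OF X_in Y(2)])
  have dY': "dfn ?U (\<lambda>v B. f v \<in> Y')" if "dtm f" for f
    using dfn_param[OF that, of ?U 1] by simp
  have "dfn ?U (\<lambda>v B. lss (v 0) (v 1) \<and> lss (v 0) (v 2) \<and>
      (\<exists>n. \<not> (pr n (v 0) \<in> B \<longleftrightarrow> pr n (v 0) \<in> Y')))"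
    by (intro dfn_intros dY' dfn_lss[of _ 0]) simp_all
  \<comment> \<open>Indices rewritten as successors, so that the variable being collected and the
    parameters behind it match \<open>dfn_comprehension\<close>.\<close>
  then have "dfn ?U (\<lambda>v B. lss (v 0) (v (Suc 0)) \<and> lss (v 0) (v (Suc 1)) \<and>
      (\<exists>n. \<not> (pr n (v 0) \<in> B \<longleftrightarrow> pr n (v 0) \<in> Y')))" by (simp add: numeral_2_eq_2)
  from dfn_comprehension[of ?U "\<lambda>x v B. lss x (v 0) \<and> lss x (v 1) \<and>
      (\<exists>n. \<not> (pr n x \<in> B \<longleftrightarrow> pr n x \<in> Y'))" Y "j ## j' ## v", OF this U Y(1)]
  have "?A \<in> S" by simp
  moreover have "i \<in> ?A" using neq i by blast
  ultimately obtain i where i: "i \<in> ?A" "\<forall>k. lss k i \<longrightarrow> k \<notin> ?A"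
    using minimal_element[of ?A i] lss_field by blast
  have "pr m k \<in> Y \<longleftrightarrow> pr m k \<in> Y'" if "lss k i" for m k
    using i that lss_trans by blast
  then have "seg i Y = seg i Y'" unfolding seg_def by blast
  moreover have "pr m i \<in> Y \<longleftrightarrow> TH v m (seg i Y)" "pr m i \<in> Y' \<longleftrightarrow> TH v m (seg i Y')" for m
    using HS i(1) by (auto simp: HS_def pr_inject)
  ultimately show False using i(1) by simp
qed

lemma HS_seg: "HS v j Y \<Longrightarrow> seg j Y = Y"
  unfolding seg_def HS_def by blast

lemma HS_unique:
  assumes "HS v j Y" "HS v j Y'" "Y \<in> S" "Y' \<in> S"
  shows "Y = Y'"
proof -
  have "seg j Y = seg j Y'"
    unfolding seg_def using HS_agree[OF assms] by blast
  then show ?thesis using HS_seg assms by simp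
qed

lemma HS_seg_eq:
  assumes "HS v j Y" "HS v i Y'" "Y \<in> S" "Y' \<in> S" "lss i j"
  shows "seg i Y = Y'"
proof -
  have "pr m k \<in> Y \<longleftrightarrow> pr m k \<in> Y'" if "lss k i" for m k
    using HS_agree[OF assms(1-4)] that lss_trans assms(5) by blast
  then have "seg i Y = seg i Y'" unfolding seg_def by blast
  then show ?thesis using HS_seg[OF assms(2)] by simp
qed

definition hier :: "'a set" where
  "hier = {p. \<exists>Y\<in>S. \<exists>n j. p = pr n j \<and> le j j \<and> HS v j Y \<and> TH v n Y}"

text \<open>The code p determines j by injectivity of pairing, and j determines its approximation,
  so the uniqueness premise of BOOT is met.\<close>

lemma hier_in: "hier \<in> S"
  unfolding hier_def
proof (rule dfn_boot[where v = v and W = params and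
      P = "\<lambda>p v Y. \<exists>n j. p = pr n j \<and> le j j \<and> HS v j Y \<and> TH v n Y"])
  \<comment> \<open>\<open>dfn_TH\<close> takes a class given by a predicate, so Y is first written
    in that form.\<close>
  have "dfn params (\<lambda>w Y. TH (\<lambda>k. w (Suc (Suc (Suc k)))) (w (Suc 0)) {p. p \<in> Y})"
    by (intro dfn_intros)
  then have T: "dfn params (\<lambda>w Y. TH (\<lambda>k. w (Suc (Suc (Suc k)))) (w (Suc 0)) Y)" by simp
  show "dfn params (\<lambda>w Y. \<exists>n j. w 0 = pr n j \<and> le j j \<and> HS (\<lambda>k. w (Suc k)) j Y \<and> TH (\<lambda>k. w (Suc k)) n Y)"
    unfolding le_def by (intro dfn_intros T dfn_X[of _ 0]) (simp add: params_def)
next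
  fix p A B
  assume "A \<in> S" "B \<in> S" "\<exists>n j. p = pr n j \<and> le j j \<and> HS v j A \<and> TH v n A"
    "\<exists>n j. p = pr n j \<and> le j j \<and> HS v j B \<and> TH v n B"
  then show "A = B" using HS_unique by (metis pr_inject)
qed (rule params_in)

lemma pr_hier: "pr n j \<in> hier \<longleftrightarrow> le j j \<and> (\<exists>Y\<in>S. HS v j Y \<and> TH v n Y)"
  by (auto simp: hier_def pr_inject)

lemma seg_in: "Y \<in> S \<Longrightarrow> seg j Y \<in> S"
proof -
  assume Y: "Y \<in> S"
  have "dfn params (\<lambda>w Y. \<exists>m k. w 0 = pr m k \<and> lss k (w 1) \<and> pr m k \<in> Y)"
    by (intro dfn_intros dfn_lss[of _ 0]) (simp add: params_def)
  then have "dfn params (\<lambda>w Y. \<exists>m k. w 0 = pr m k \<and> lss k (w (Suc 0)) \<and> pr m k \<in> Y)" by simp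
  from dfn_comprehension[of params "\<lambda>x w Y. \<exists>m k. x = pr m k \<and> lss k (w 0) \<and> pr m k \<in> Y" Y "j ## v",
      OF this params_in Y]
  show ?thesis by (simp add: seg_def)
qed

text \<open>For k before i before j, row k of \<open>hier\<close> evaluates \<open>\<theta>\<close>
  at the approximation below k, which is the segment at k of the one below i. Hence
  \<open>hier\<close> restricted to the predecessors of i is the approximation below i, and the rows
  before j satisfy the fixed point equation.\<close>

lemma HS_seg_hier:
  assumes below: "\<And>i. lss i j \<Longrightarrow> \<exists>Y\<in>S. HS v i Y"
  shows "HS v j (seg j hier)"
proof -
  have seg: "seg i (seg j hier) = Y" if i: "lss i j" and Y: "Y \<in> S" "HS v i Y" for i Y
  proof -
    have "pr m k \<in> hier \<longleftrightarrow> pr m k \<in> Y" if k: "lss k i" for m k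
    proof -
      obtain Z where Z: "Z \<in> S" "HS v k Z" using below lss_trans k i by blast
      have "pr m k \<in> hier \<longleftrightarrow> TH v m Z"
        using Z HS_unique lss_field[OF k] by (auto simp: pr_hier)
      also have "\<dots> \<longleftrightarrow> TH v m (seg k Y)" using HS_seg_eq[OF Y(2) Z(2) Y(1) Z(1) k] by simp
      also have "\<dots> \<longleftrightarrow> pr m k \<in> Y" using Y(2) k by (auto simp: HS_def pr_inject)
      finally show ?thesis .
    qed
    then have "seg i (seg j hier) = seg i Y"
      using lss_trans i by (auto simp: seg_def pr_inject)
    then show ?thesis using HS_seg Y by simp
  qed
  have "pr n i \<in> hier \<longleftrightarrow> TH v n (seg i (seg j hier))" if i: "lss i j" for n i
  proof -
    obtain Y where Y: "Y \<in> S" "HS v i Y" using below i by blast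
    then show ?thesis
      using seg[OF i Y] HS_unique lss_field[OF i] by (auto simp: pr_hier)
  qed
  note * = this
  show ?thesis
    unfolding HS_def
  proof
    fix p
    have "p \<in> seg j hier \<longleftrightarrow> (\<exists>n i. p = pr n i \<and> lss i j \<and> pr n i \<in> hier)" by (simp add: seg_def)
    also have "\<dots> \<longleftrightarrow> (\<exists>n i. p = pr n i \<and> lss i j \<and> TH v n (seg i (seg j hier)))" using * by blast
    finally show "p \<in> seg j hier \<longleftrightarrow>
      (\<exists>n i. p = pr n i \<and> lss i j \<and> TH v n (seg i (seg j hier)))" .
  qed
qed

text \<open>Having an approximation is expressed by an existential set quantifier, beyond
  arithmetical comprehension. A second use of BOOT provides the set of such j, so that a least
  failure exists, contradicting \<open>HS_seg_hier\<close>.\<close>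

lemma HS_exists: "le j j \<Longrightarrow> \<exists>Y\<in>S. HS v j Y"
proof (rule ccontr)
  assume j: "le j j" "\<not> (\<exists>Y\<in>S. HS v j Y)"
  let ?G = "{j. \<exists>Y\<in>S. HS v j Y}"
  have G: "?G \<in> S"
  proof (rule dfn_boot[where v = v and W = params and P = "\<lambda>j v Y. HS v j Y"])
    show "dfn params (\<lambda>w Y. HS (\<lambda>k. w (Suc k)) (w 0) Y)" by (intro dfn_intros)
  qed (use HS_unique params_in in auto)
  let ?A = "{j. le j j \<and> j \<notin> ?G}"
  have "dfn params (\<lambda>w G. pr (w 0) (w 0) \<in> X \<and> w 0 \<notin> G)"
    by (intro dfn_intros dfn_X[of _ 0]) (simp add: params_def)
  from dfn_comprehension[of params "\<lambda>x w G. pr x x \<in> X \<and> x \<notin> G", OF this params_in G]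
  have A: "?A \<in> S" by (simp add: le_def)
  have "j \<in> ?A" using j by simp
  from minimal_element[OF A _ this] obtain k where k: "k \<in> ?A" "\<forall>i. lss i k \<longrightarrow> i \<notin> ?A" by auto
  have "\<exists>Y\<in>S. HS v i Y" if "lss i k" for i
    using k(2)[rule_format, OF that] lss_field(1)[OF that] by simp
  then have "HS v k (seg k hier)" by (rule HS_seg_hier)
  then show False using k(1) seg_in[OF hier_in, of k] by auto
qed

lemma pr_hier_seg: "pr n j \<in> hier \<longleftrightarrow> le j j \<and> TH v n (seg j hier)"
proof -
  have "\<exists>Y\<in>S. HS v i Y" if "lss i j" for i using HS_exists[OF lss_field(1)[OF that]] .
  then have *: "HS v j (seg j hier)" by (rule HS_seg_hier)
  have "Y = seg j hier" if "HS v j Y" "Y \<in> S" for Y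
    using HS_unique[OF that(1) * that(2) seg_in[OF hier_in]] .
  then show ?thesis unfolding pr_hier using * seg_in[OF hier_in, of j] by blast
qed

lemma segment: "holds2 (n ## j ## w) (Z ## Y ## params) (IsSegment 0 2 1 1) \<longleftrightarrow> Z = seg j Y"
  by (auto simp: IsSegment_def order_simps params_def seg_def lss_def pr_inject)

theorem recursion: "holds2 v (X ## W) (ExS (Hierarchy \<theta>))"
proof -
  \<comment> \<open>\<open>Hierarchy\<close> quantifies j outside n; members are rewritten in that
    order.\<close>
  have "p \<in> hier \<longleftrightarrow> (\<exists>j n. p = pr n j \<and> pr n j \<in> hier)" for p
    unfolding hier_def by blast
  then have mem: "p \<in> hier \<longleftrightarrow> (\<exists>j n. p = pr n j \<and> le j j \<and> TH v n (seg j hier))" for p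
    unfolding pr_hier_seg .
  have segm: "holds2 (n ## j ## p ## v) (hier ## params) (ExS (IsSegment 0 2 1 1 \<^bold>\<and> \<theta>)) \<longleftrightarrow>
      TH v n (seg j hier)" for n j p
    unfolding holds2_connectives segment holds2_\<theta> using seg_in[OF hier_in, of j] by blast
  have field: "holds2 (n ## j ## p ## v) (hier ## params) (Fld (NVar 1) 1) \<longleftrightarrow> le j j" for n j p
    by (simp add: Fld_def le_def params_def)
  have linear: "holds2 v (hier ## params) (LinearOrder 1)"
    using linear unfolding LinearOrder_iff params_def nat.case One_nat_def .
  have "holds2 v (hier ## params) (Hierarchy \<theta>) \<longleftrightarrow>
      holds2 v (hier ## params) (LinearOrder 1) \<and>
      (\<forall>p. p \<in> hier \<longleftrightarrow> (\<exists>j n. p = pr n j \<and>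
        holds2 (n ## j ## p ## v) (hier ## params) (Fld (NVar 1) 1) \<and>
        holds2 (n ## j ## p ## v) (hier ## params) (ExS (IsSegment 0 2 1 1 \<^bold>\<and> \<theta>))))"
    unfolding Hierarchy_def Let_def by (simp add: numeral_2_eq_2 del: holds2_connectives(6))
  then have "holds2 v (hier ## params) (Hierarchy \<theta>)"
    unfolding segm field using linear mem by blast
  then show ?thesis using hier_in unfolding params_def holds2_connectives by blast
qed

end

section \<open>Truth of the axioms of ATR_0\<close>

context so_model
begin

lemma transfinite_recursion:
  assumes "\<phi> \<in> transfinite_recursion" "\<And>i. W i \<in> S"
  shows "holds2 v W \<phi>"
proof -
  obtain \<theta> where \<theta>: "\<phi> = AllS (WellOrder 0 \<^bold>\<longrightarrow> ExS (Hierarchy \<theta>))" "arithmetical \<theta>"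
    "{(NumS, 1), (NumS, 2), (SetS, 1)} \<inter> free_vars atom2_vars \<theta> = {}"
    using assms(1) by (auto simp: transfinite_recursion_def)
  have "holds2 v (X ## W) (ExS (Hierarchy \<theta>))"
    if "X \<in> S" "holds2 v (X ## W) (WellOrder 0)" for X
  proof -
    interpret so_recursion zero one add mul less S v W X \<theta>
      by unfold_locales (fact that assms(2) \<theta>(2,3))+
    show ?thesis by (rule recursion)
  qed
  then show ?thesis by (simp add: \<theta>(1))
qed

lemma ACA0_matrix:
  assumes "\<phi> \<in> arith_axioms2 \<union> {induction_axiom2} \<union> arithmetical_comprehension" "\<And>i. W i \<in> S"
  shows "holds2 v W \<phi>"
proof -
  consider "\<phi> \<in> arith_axioms2" | "\<phi> = induction_axiom2" | "\<phi> \<in> arithmetical_comprehension"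
    using assms(1) by blast
  then show ?thesis
  proof cases
    case 1
    have *: "add m one = add n one \<longleftrightarrow> m = n" for m n using succ_inject by blast
    show ?thesis
      using 1 unfolding arith_axioms2_def Let_def
      by (elim insertE emptyE) (simp_all only: holds2.simps holds2_connectives holds_atom2.simps ev2.simps
          succ_neq_zero add_zero add_succ mul_zero mul_succ not_less_zero less_succ *
          not_False_eq_True simp_thms)
  next
    case 2
    have "\<forall>n. n \<in> A" if "A \<in> S" "zero \<in> A" "\<forall>n. n \<in> A \<longrightarrow> add n one \<in> A" for A
      using induction[OF that(1,2)] that(3) by blast
    moreover have "holds2 v W induction_axiom2 \<longleftrightarrow>
        (\<forall>A\<in>S. zero \<in> A \<and> (\<forall>n. n \<in> A \<longrightarrow> add n one \<in> A) \<longrightarrow> (\<forall>n. n \<in> A))"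
      by (simp add: induction_axiom2_def)
    ultimately show ?thesis unfolding 2 by blast
  next
    case 3
    then obtain \<psi> where \<psi>: "\<phi> = ExS (AllN ((NVar 0 \<in>\<^sub>2 0) \<^bold>\<longleftrightarrow> \<psi>))" "arithmetical \<psi>"
      "(SetS, 0) \<notin> free_vars atom2_vars \<psi>" by (auto simp: arithmetical_comprehension_def)
    \<comment> \<open>A placeholder for set variable 0, which does not occur in
      \<open>\<psi>\<close>; it can be exchanged for the comprehended set afterwards.\<close>
    obtain B where B: "B \<in> S" using nonempty by blast
    define A where "A = {x. holds2 (x ## v) (B ## W) \<psi>}"
    have A: "A \<in> S" unfolding A_def by (rule comprehension[OF \<psi>(2)]) (rule scons_in[OF B assms(2)])
    have "holds2 (x ## v) (B ## W) \<psi> \<longleftrightarrow> holds2 (x ## v) (A ## W) \<psi>" for x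
    proof (rule holds2_cong)
      show "(B ## W) i = (A ## W) i" if "(SetS, i) \<in> free_vars atom2_vars \<psi>" for i
        using that \<psi>(3) by (cases i) auto
    qed simp
    then have "x \<in> A \<longleftrightarrow> holds2 (x ## v) (A ## W) \<psi>" for x unfolding A_def by blast
    then have "holds2 v (A ## W) (AllN ((NVar 0 \<in>\<^sub>2 0) \<^bold>\<longleftrightarrow> \<psi>))" by simp
    then show ?thesis unfolding \<psi>(1) holds2_connectives using A by (rule bexI)
  qed
qed

lemma generalization:
  assumes "\<phi> \<in> generalizations B" "\<And>\<psi> v W. \<psi> \<in> B \<Longrightarrow> (\<And>i. W i \<in> S) \<Longrightarrow> holds2 v W \<psi>"
    and "\<And>i. W i \<in> S"
  shows "holds2 v W \<phi>"
  using assms(1,3)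
proof (induction arbitrary: v W)
  case (gen \<phi> s)
  show ?case
  proof (cases s)
    case NumS
    then show ?thesis using gen.IH[OF gen.prems] by simp
  next
    case SetS
    have "holds2 v (A ## W) \<phi>" if "A \<in> S" for A
      by (rule gen.IH) (rule scons_in[OF that gen.prems])
    then show ?thesis using SetS by simp
  qed
qed (rule assms(2))

theorem ATR0_holds:
  assumes "\<phi> \<in> ATR0" "\<And>i. W i \<in> S"
  shows "holds2 v W \<phi>"
proof -
  consider "\<phi> \<in> generalizations (arith_axioms2 \<union> {induction_axiom2} \<union> arithmetical_comprehension)"
    | "\<phi> \<in> generalizations transfinite_recursion"
    using assms(1) unfolding ATR0_def ACA0_def universal_closures_def by blast
  then show ?thesis
  proof cases
    case 1
    then show ?thesis by (rule generalization) (fact ACA0_matrix assms(2))+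
  next
    case 2
    then show ?thesis by (rule generalization) (fact transfinite_recursion assms(2))+
  qed
qed

end

subsection \<open>The second-order part of a model\<close>

lemma wf_translate: "wf_form (translate \<phi>)"
proof -
  have t: "translate_tm t \<Colon> N" for t by (induction t) (simp_all add: typed_iff)
  have "wf_form (translate_atom a)" for a using t by (cases a) (simp_all add: typed_iff)
  then show ?thesis by (induction \<phi>) (simp_all add: IsSet_def typed_iff split: sort2.split)
qed

lemma number_quantified_translate: "arithmetical \<phi> \<Longrightarrow> number_quantified (translate \<phi>)"
proof (induction \<phi>)
  case (Atom a)
  then show ?case by (cases a) simp_all
qed simp_all

section \<open>Transport of numbers to nat and of characteristic functions to sets\<close>

context hoa_char
begin

text \<open>An arbitrary bijection, not the numeral map: the operations are carried along it to nat,
  where they need not be the standard ones.\<close>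

definition num :: "nat \<Rightarrow> tm" where
  "num = from_nat_into (D N)"

definition idx :: "tm \<Rightarrow> nat" where
  "idx = inv num"

lemma bij_num: "bij_betw num UNIV (D N)"
  unfolding num_def using infinite_numbers by (intro bij_betw_from_nat_into) auto

lemma num_in: "num x \<in> D N"
  using bij_num by (auto simp: bij_betw_def)

lemma bex_num: "(\<exists>a\<in>D N. P a) \<longleftrightarrow> (\<exists>x. P (num x))"
proof -
  have "D N = range num" using bij_num by (simp add: bij_betw_def)
  then show ?thesis by simp
qed

lemma idx_num [simp]: "idx (num x) = x"
  using bij_num by (simp add: bij_betw_def idx_def)

lemma num_idx: "a \<in> D N \<Longrightarrow> num (idx a) = a"
  unfolding idx_def by (rule f_inv_into_f) (use bij_num in \<open>simp add: bij_betw_def\<close>)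

lemma idx_eq: "a \<in> D N \<Longrightarrow> b \<in> D N \<Longrightarrow> idx a = idx b \<longleftrightarrow> a = b"
  by (metis num_idx)

lemma num_eq [simp]: "num x = num y \<longleftrightarrow> x = y"
  by (metis idx_num)

definition charfun :: "tm \<Rightarrow> bool" where
  "charfun f \<longleftrightarrow> f \<in> D ty1 \<and> (\<forall>n\<in>D N. app f n = zero \<or> app f n = one)"

definition ext1 :: "tm \<Rightarrow> nat set" where
  "ext1 f = {x. app f (num x) = one}"

definition sets :: "nat set set" where
  "sets = ext1 ` {f. charfun f}"

definition code :: "nat set \<Rightarrow> tm" where
  "code A = (SOME f. charfun f \<and> ext1 f = A)"

lemma code: assumes "A \<in> sets" shows "charfun (code A)" "ext1 (code A) = A"
proof -
  have "\<exists>f. charfun f \<and> ext1 f = A" using assms by (auto simp: sets_def)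
  then have "charfun (code A) \<and> ext1 (code A) = A" unfolding code_def by (rule someI_ex)
  then show "charfun (code A)" "ext1 (code A) = A" by simp_all
qed

text \<open>Two-valued functions with the same ones agree everywhere, so extensionality identifies
  them. This transfers uniqueness of sets to uniqueness of functions.\<close>

lemma ext1_inject: assumes "charfun f" "charfun g" "ext1 f = ext1 g" shows "f = g"
proof (rule app_ext)
  show "f \<in> D ty1" "g \<in> D ty1" using assms by (simp_all add: charfun_def)
  fix a assume a: "a \<in> D N"
  have "idx a \<in> ext1 f \<longleftrightarrow> idx a \<in> ext1 g" using assms(3) by simp
  then have "app f a = one \<longleftrightarrow> app g a = one" by (simp add: ext1_def num_idx[OF a])
  moreover have "app f a = zero \<or> app f a = one" "app g a = zero \<or> app g a = one"
    using assms(1,2) a unfolding charfun_def by blast+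
  ultimately show "app f a = app g a" by argo
qed

abbreviation "zero' \<equiv> idx zero"
abbreviation "one' \<equiv> idx one"
abbreviation "add' \<equiv> \<lambda>x y. idx (add (num x) (num y))"
abbreviation "mul' \<equiv> \<lambda>x y. idx (mul (num x) (num y))"
abbreviation "less' \<equiv> \<lambda>x y. lt M (num x) (num y)"

lemmas num_simps [simp] = num_idx idx_eq cst_in(1,2) add_in mul_in num_in

interpretation so: so_struct zero' one' add' mul' less' sets .

lemma eval_translate_tm:
  "(\<And>i. (NumS, i) \<in> tm2_vars t \<Longrightarrow> e N i = num (v i)) \<Longrightarrow> eval M e (translate_tm t) = num (so.ev2 v t)"
  by (induction t) simp_all

text \<open>Restricted to a set of variables, so that a closed formula imposes no condition on the
  assignment.\<close>

definition agrees :: "(sort2 \<times> nat) set \<Rightarrow> (ty \<Rightarrow> nat \<Rightarrow> tm) \<Rightarrow> (nat \<Rightarrow> nat) \<Rightarrow> (nat \<Rightarrow> nat set) \<Rightarrow> bool" where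
  "agrees V e v W \<longleftrightarrow> (\<forall>i. (NumS, i) \<in> V \<longrightarrow> e N i = num (v i)) \<and>
     (\<forall>i. (SetS, i) \<in> V \<longrightarrow> charfun (e ty1 i) \<and> ext1 (e ty1 i) = W i)"

lemma holds_translate:
  "agrees (free_vars atom2_vars \<phi>) e v W \<Longrightarrow> holds M e (translate \<phi>) \<longleftrightarrow> so.holds2 v W \<phi>"
proof (induction \<phi> arbitrary: e v W)
  case (Atom a)
  show ?case
  proof (cases a)
    case (EqA2 t u)
    then show ?thesis
      using Atom eval_translate_tm[of t e v] eval_translate_tm[of u e v] by (simp add: agrees_def)
  next
    case (LessA2 t u)
    then show ?thesis
      using Atom eval_translate_tm[of t e v] eval_translate_tm[of u e v] by (simp add: agrees_def)
  next
    case (MemA t X)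
    then have "ext1 (e ty1 X) = W X" and t: "eval M e (translate_tm t) = num (so.ev2 v t)"
      using Atom eval_translate_tm[of t e v] by (simp_all add: agrees_def)
    then have "app (e ty1 X) (num (so.ev2 v t)) = one \<longleftrightarrow> so.ev2 v t \<in> W X"
      unfolding ext1_def by blast
    then show ?thesis using MemA t by simp
  qed
next
  case (Imp \<phi> \<psi>)
  have "holds M e (translate \<phi>) \<longleftrightarrow> so.holds2 v W \<phi>"
    by (rule Imp.IH(1)) (use Imp.prems in \<open>simp add: agrees_def\<close>)
  moreover have "holds M e (translate \<psi>) \<longleftrightarrow> so.holds2 v W \<psi>"
    by (rule Imp.IH(2)) (use Imp.prems in \<open>simp add: agrees_def\<close>)
  ultimately show ?case by simp
next
  case (All s \<phi>)
  show ?case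
  proof (cases s)
    case NumS
    have "holds M (bind N (num x) e) (translate \<phi>) \<longleftrightarrow> so.holds2 (x ## v) W \<phi>" for x
    proof (rule All.IH)
      show "agrees (free_vars atom2_vars \<phi>) (bind N (num x) e) (x ## v) W"
        unfolding agrees_def
      proof (intro conjI allI impI)
        fix i assume i: "(NumS, i) \<in> free_vars atom2_vars \<phi>"
        show "bind N (num x) e N i = num ((x ## v) i)"
          using All.prems NumS i by (cases i) (simp_all add: agrees_def)
      qed (use All.prems NumS in \<open>auto simp: agrees_def\<close>)
    qed
    moreover have "holds M e (translate (All s \<phi>)) \<longleftrightarrow> (\<forall>x. holds M (bind N (num x) e) (translate \<phi>))"
    proof -
      have "D N = range num" using bij_num by (simp add: bij_betw_def)
      then show ?thesis using NumS by simp
    qed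
    ultimately show ?thesis using NumS by simp
  next
    case SetS
    have *: "holds M (bind ty1 f e) (translate \<phi>) \<longleftrightarrow> so.holds2 v (ext1 f ## W) \<phi>" if f: "charfun f" for f
    proof (rule All.IH)
      show "agrees (free_vars atom2_vars \<phi>) (bind ty1 f e) v (ext1 f ## W)"
        unfolding agrees_def
      proof (intro conjI allI impI)
        fix i assume i: "(SetS, i) \<in> free_vars atom2_vars \<phi>"
        show "charfun (bind ty1 f e ty1 i)" "ext1 (bind ty1 f e ty1 i) = (ext1 f ## W) i"
          using All.prems SetS i f by (cases i; simp add: agrees_def)+
      qed (use All.prems SetS in \<open>auto simp: agrees_def\<close>)
    qed
    have "holds M e (translate (All s \<phi>)) \<longleftrightarrow> (\<forall>f. charfun f \<longrightarrow> holds M (bind ty1 f e) (translate \<phi>))"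
      using SetS by (auto simp: IsSet_def charfun_def)
    also have "\<dots> \<longleftrightarrow> (\<forall>f. charfun f \<longrightarrow> so.holds2 v (ext1 f ## W) \<phi>)" using * by blast
    also have "\<dots> \<longleftrightarrow> (\<forall>A\<in>sets. so.holds2 v (A ## W) \<phi>)" by (simp add: sets_def)
    also have "\<dots> \<longleftrightarrow> so.holds2 v W (All s \<phi>)" using SetS by simp
    finally show ?thesis .
  qed
qed simp

lemma exists_env:
  fixes W :: "nat \<Rightarrow> nat set"
  assumes "\<And>i. W i \<in> sets"
  shows "\<exists>e. good e \<and> agrees UNIV e v W"
proof -
  obtain e0 where e0: "valid M e0" using ex_valid by blast
  define e where "e = (\<lambda>\<tau> i. if \<tau> = N then num (v i) else if \<tau> = ty1 then code (W i)
    else if \<tau> = ty2 then (if i = 0 then E else if i = 1 then Q else if i = 2 then L else I) else e0 \<tau> i)"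
  have "valid M e"
    unfolding valid_def e_def
    using num_in code(1)[OF assms] E_in Q_in L_in I_in e0[unfolded valid_def] by (simp add: charfun_def)
  then have "good e" by (simp add: good_def e_def)
  moreover have "agrees UNIV e v W" using code assms by (simp add: agrees_def e_def)
  ultimately show ?thesis by blast
qed

lemma agrees_UNIV: "agrees UNIV e v W \<Longrightarrow> agrees V e v W"
  by (simp add: agrees_def)

lemma agrees_bind_num: "agrees UNIV e v W \<Longrightarrow> agrees UNIV (bind N (num x) e) (x ## v) W"
  by (auto simp: agrees_def bind_def split: nat.split)

lemma agrees_bind_set: "agrees UNIV e v W \<Longrightarrow> charfun f \<Longrightarrow> agrees UNIV (bind ty1 f e) v (ext1 f ## W)"
  by (auto simp: agrees_def bind_def split: nat.split)

lemma charfun_comprehension: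
  assumes "wf_form \<phi>" "number_quantified \<phi>" "good e"
  shows "{x. holds M (bind N (num x) e) \<phi>} \<in> sets"
proof -
  obtain X where X: "X \<in> D ty1" "\<And>n. n \<in> D N \<Longrightarrow> (app X n = zero \<or> app X n = one) \<and>
    (app X n = one \<longleftrightarrow> holds M (bind N n e) \<phi>)"
    using comprehension[OF assms] by blast
  have "ext1 X = {x. holds M (bind N (num x) e) \<phi>}" using X(2) num_in by (simp add: ext1_def)
  moreover have "charfun X" unfolding charfun_def using X by blast
  ultimately show ?thesis unfolding sets_def by blast
qed

lemma so_model: "so_model zero' one' add' mul' less' sets"
proof
  fix m n
  note ar = arith_eqs[OF num_in[of m] num_in[of n]]
  show "add' n one' \<noteq> zero'" using ar(1) by simp
  show "add' m one' = add' n one' \<Longrightarrow> m = n" using ar(2) by simp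
  show "add' m zero' = m" using ar(3) by simp
  show "add' m (add' n one') = add' (add' m n) one'" using ar(4) by simp
  show "mul' m zero' = zero'" using ar(5) by simp
  show "mul' m (add' n one') = add' (mul' m n) m" using ar(6) by simp
  show "\<not> less' m zero'" using ar(7) by simp
  show "less' m (add' n one') \<longleftrightarrow> less' m n \<or> m = n" using ar(8) by simp
next
  obtain e0 where e0: "valid M e0" using ex_valid by blast
  define e where "e = (\<lambda>\<tau> i.
    if \<tau> = ty2 then (if i = 0 then E else if i = 1 then Q else if i = 2 then L else I) else e0 \<tau> i)"
  have "valid M e"
    unfolding valid_def e_def using E_in Q_in L_in I_in e0[unfolded valid_def] by simp
  then have "good e" by (simp add: good_def e_def)
  \<comment> \<open>Comprehension for falsity yields the empty set.\<close>
  from charfun_comprehension[of Fls, OF _ _ this] show "sets \<noteq> {}" by auto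
next
  fix A n
  assume A: "A \<in> sets" "zero' \<in> A" "\<And>n. n \<in> A \<Longrightarrow> add' n one' \<in> A"
  then obtain f where f: "charfun f" "A = ext1 f" by (auto simp: sets_def)
  have mem: "x \<in> A \<longleftrightarrow> app f (num x) = one" for x by (simp add: f(2) ext1_def)
  have "app f (num n) = one"
  proof (rule induction)
    show "f \<in> D ty1" using f(1) by (simp add: charfun_def)
    show "app f zero = one" using A(2) by (simp add: mem)
    show "app f (add a one) = one" if a: "a \<in> D N" "app f a = one" for a
      using A(3)[of "idx a"] a by (simp add: mem num_idx)
  qed (rule num_in)
  then show "n \<in> A" by (simp add: mem)
next
  fix \<phi> and W :: "nat \<Rightarrow> nat set" and v :: "nat \<Rightarrow> nat"
  assume \<phi>: "arithmetical \<phi>" and W: "\<And>i. W i \<in> sets"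
  obtain e where e: "good e" "agrees UNIV e v W" using exists_env[of W v, OF W] by blast
  have "holds M (bind N (num x) e) (translate \<phi>) \<longleftrightarrow> so.holds2 (x ## v) W \<phi>" for x
    by (rule holds_translate[OF agrees_UNIV[OF agrees_bind_num[OF e(2)]]])
  then show "{x. so.holds2 (x ## v) W \<phi>} \<in> sets"
    using charfun_comprehension[OF wf_translate number_quantified_translate[OF \<phi>] e(1)] by simp
next
  fix \<phi> and W :: "nat \<Rightarrow> nat set" and v :: "nat \<Rightarrow> nat"
  assume \<phi>: "arithmetical \<phi>" and W: "\<And>i. W i \<in> sets"
    and unique: "\<And>x A B. A \<in> sets \<Longrightarrow> B \<in> sets \<Longrightarrow> so.holds2 (x ## v) (A ## W) \<phi> \<Longrightarrow>
      so.holds2 (x ## v) (B ## W) \<phi> \<Longrightarrow> A = B"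
  obtain e where e: "good e" "agrees UNIV e v W" using exists_env[of W v, OF W] by blast
  \<comment> \<open>Functions that are not characteristic can share the extension of a set;
    relativizing to \<open>IsSet\<close> is what makes the witnessing function unique.\<close>
  let ?\<phi> = "IsSet 0 \<^bold>\<and> translate \<phi>"
  have h: "holds M (bind ty1 f (bind N (num x) e)) ?\<phi> \<longleftrightarrow>
      charfun f \<and> so.holds2 (x ## v) (ext1 f ## W) \<phi>" if "f \<in> D ty1" for f x
  proof -
    have "holds M (bind ty1 f (bind N (num x) e)) (IsSet 0) \<longleftrightarrow> charfun f"
      using that by (simp add: IsSet_def charfun_def)
    moreover have "holds M (bind ty1 f (bind N (num x) e)) (translate \<phi>) \<longleftrightarrow>
        so.holds2 (x ## v) (ext1 f ## W) \<phi>" if "charfun f"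
      by (rule holds_translate[OF agrees_UNIV[OF agrees_bind_set[OF agrees_bind_num[OF e(2)] that]]])
    ultimately show ?thesis by auto
  qed
  have "\<exists>X\<in>D ty1. \<forall>n\<in>D N. (app X n = zero \<or> app X n = one) \<and>
    (app X n = one \<longleftrightarrow> (\<exists>f\<in>D ty1. holds M (bind ty1 f (bind N n e)) ?\<phi>))"
  proof (rule boot)
    show "wf_form ?\<phi>" by (simp add: wf_translate IsSet_def typed_iff)
    show "number_quantified ?\<phi>" using number_quantified_translate[OF \<phi>] by (simp add: IsSet_def)
    show "good e" by fact
  next
    fix n f g
    assume n: "n \<in> D N" and f: "f \<in> D ty1" and g: "g \<in> D ty1"
      and "holds M (bind ty1 f (bind N n e)) ?\<phi>" "holds M (bind ty1 g (bind N n e)) ?\<phi>"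
    then have fg: "charfun f" "so.holds2 (idx n ## v) (ext1 f ## W) \<phi>"
      "charfun g" "so.holds2 (idx n ## v) (ext1 g ## W) \<phi>"
      using h[OF f, of "idx n"] h[OF g, of "idx n"] num_idx[OF n] by simp_all
    then have "ext1 f = ext1 g" using unique[of "ext1 f" "ext1 g" "idx n"] by (simp add: sets_def)
    then show "f = g" using fg ext1_inject by blast
  qed
  then obtain X where X: "X \<in> D ty1" "\<And>n. n \<in> D N \<Longrightarrow> (app X n = zero \<or> app X n = one) \<and>
    (app X n = one \<longleftrightarrow> (\<exists>f\<in>D ty1. holds M (bind ty1 f (bind N n e)) ?\<phi>))" by blast
  have "app X (num x) = one \<longleftrightarrow> (\<exists>A\<in>sets. so.holds2 (x ## v) (A ## W) \<phi>)" for x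
  proof -
    have "app X (num x) = one \<longleftrightarrow> (\<exists>f\<in>D ty1. holds M (bind ty1 f (bind N (num x) e)) ?\<phi>)"
      using X(2)[OF num_in] by blast
    also have "\<dots> \<longleftrightarrow> (\<exists>f\<in>D ty1. charfun f \<and> so.holds2 (x ## v) (ext1 f ## W) \<phi>)"
      using h by blast
    also have "\<dots> \<longleftrightarrow> (\<exists>A\<in>sets. so.holds2 (x ## v) (A ## W) \<phi>)"
      by (auto simp: sets_def charfun_def)
    finally show ?thesis .
  qed
  then have "ext1 X = {x. \<exists>A\<in>sets. so.holds2 (x ## v) (A ## W) \<phi>}" by (simp add: ext1_def)
  moreover have "charfun X" unfolding charfun_def using X by blast
  ultimately show "{x. \<exists>A\<in>sets. so.holds2 (x ## v) (A ## W) \<phi>} \<in> sets"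
    unfolding sets_def by blast
next
  fix \<phi> and W :: "nat \<Rightarrow> nat set" and v :: "nat \<Rightarrow> nat" and a
  assume \<phi>: "arithmetical \<phi>" and W: "\<And>i. W i \<in> sets"
    and ex: "\<And>x. \<exists>y. so.holds2 (y ## x ## v) W \<phi>"
  obtain e where e: "good e" "agrees UNIV e v W" using exists_env[of W v, OF W] by blast
  have h: "holds M (bind N (num y) (bind N (num x) e)) (translate \<phi>) \<longleftrightarrow> so.holds2 (y ## x ## v) W \<phi>" for x y
    by (rule holds_translate[OF agrees_UNIV[OF agrees_bind_num[OF agrees_bind_num[OF e(2)]]]])
  have "\<exists>f\<in>D ty1. app f zero = num a \<and>
    (\<forall>n\<in>D N. holds M (bind N (app f (add n one)) (bind N (app f n) e)) (translate \<phi>))"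
  proof (rule dependent_choice[OF wf_translate number_quantified_translate[OF \<phi>] e(1)])
    fix x assume x: "x \<in> D N"
    obtain y where "so.holds2 (y ## idx x ## v) W \<phi>" using ex by blast
    then have "holds M (bind N (num y) (bind N (num (idx x)) e)) (translate \<phi>)" using h by blast
    then show "\<exists>y\<in>D N. holds M (bind N y (bind N x e)) (translate \<phi>)"
      using num_in num_idx[OF x] by auto
  qed (rule num_in)
  then obtain f where f: "f \<in> D ty1" "app f zero = num a"
    "\<And>n. n \<in> D N \<Longrightarrow> holds M (bind N (app f (add n one)) (bind N (app f n) e)) (translate \<phi>)" by blast
  define f' where "f' x = idx (app f (num x))" for x
  have num_f': "num (f' x) = app f (num x)" for x
    unfolding f'_def by (rule num_idx[OF app_in[OF f(1) num_in]])
  have "so.holds2 (f' (add' n one') ## f' n ## v) W \<phi>" for n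
    using f(3)[OF num_in[of n]] h[of "f' (add' n one')" "f' n"] by (simp add: num_f')
  moreover have "f' zero' = a" by (simp add: f'_def f(2))
  moreover have "{p. \<exists>n. p = so.pr n (f' n)} \<in> sets"
  proof -
    \<comment> \<open>The graph is comprehended in the higher-order language, where f can serve as a
      parameter of type 1. In \<open>?\<psi>\<close> number variable 0 is the argument and 1 the
      code.\<close>
    let ?s = "Var N 0 \<^bold>+ Var ty1 0 \<cdot> Var N 0"
    let ?\<psi> = "Ex N (Var N 1 \<^bold>= (?s \<^bold>* ?s) \<^bold>+ Var N 0)"
    have "good (bind ty1 f e)" using good_bind[OF e(1) f(1)] by simp
    then have "{x. holds M (bind N (num x) (bind ty1 f e)) ?\<psi>} \<in> sets"
      by (intro charfun_comprehension) (simp_all add: typed_iff)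
    moreover have "holds M (bind N (num x) (bind ty1 f e)) ?\<psi> \<longleftrightarrow> (\<exists>n. x = so.pr n (f' n))" for x
    proof -
      have "holds M (bind N (num x) (bind ty1 f e)) ?\<psi> \<longleftrightarrow>
          (\<exists>n\<in>D N. num x = add (mul (add n (app f n)) (add n (app f n))) n)" by simp
      also have "\<dots> \<longleftrightarrow> (\<exists>n. num x = add (mul (add (num n) (app f (num n))) (add (num n) (app f (num n)))) (num n))"
        by (rule bex_num)
      also have "\<dots> \<longleftrightarrow> (\<exists>n. num x = num (so.pr n (f' n)))" by (simp add: so.pr_def num_f' app_in[OF f(1) num_in])
      finally show ?thesis by simp
    qed
    ultimately show ?thesis by simp
  qed
  ultimately show "\<exists>f. f zero' = a \<and> (\<forall>n. so.holds2 (f (add' n one') ## f n ## v) W \<phi>) \<and>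
      {p. \<exists>n. p = so.pr n (f n)} \<in> sets"
    by (intro exI[of _ f'] conjI allI)
qed

theorem holds_ATR0:
  assumes "\<phi> \<in> ATR0"
  shows "holds M e (translate \<phi>)"
proof -
  interpret so: so_model zero' one' add' mul' less' sets by (rule so_model)
  obtain A where A: "A \<in> sets" using so.nonempty by blast
  have "so.holds2 (\<lambda>_. 0) (\<lambda>_. A) \<phi>" by (rule so.ATR0_holds[OF assms A])
  moreover have "free_vars atom2_vars \<phi> = {}"
    using assms by (auto simp: ATR0_def ACA0_def universal_closures_def)
  ultimately show ?thesis using holds_translate[of \<phi> e "\<lambda>_. 0" "\<lambda>_. A"] by (simp add: agrees_def)
qed

end

subsection \<open>Universal closures\<close>

lemma free_vars_All_pow:
  "free_vars va ((All \<tau> ^^ n) \<phi>) = {(r, i). (r, if r = \<tau> then i + n else i) \<in> free_vars va \<phi>}"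
  by (induction n) (auto simp: fun_eq_iff)

lemma generalizations_pow: "\<phi> \<in> generalizations A \<Longrightarrow> (All \<tau> ^^ n) \<phi> \<in> generalizations A"
  by (induction n) (auto intro: generalizations.gen)

text \<open>Any valid assignment is the extension of its tail \<open>e'\<close> by its head, so a
  prefix true everywhere can be stripped.\<close>

lemma holds_All_pow:
  assumes "\<And>e. valid M e \<Longrightarrow> holds M e ((All \<tau> ^^ n) \<phi>)" "valid M e"
  shows "holds M e \<phi>"
  using assms
proof (induction n arbitrary: e)
  case (Suc n)
  show ?case
  proof (rule Suc.IH)
    fix e assume e: "valid M e"
    define e' where "e' = (\<lambda>\<rho> i. if \<rho> = \<tau> then e \<rho> (Suc i) else e \<rho> i)"
    have e': "valid M e'" using e by (simp add: valid_def e'_def)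
    have "bind \<tau> (e \<tau> 0) e' = e" by (auto simp: bind_def e'_def fun_eq_iff split: nat.split)
    moreover have "holds M (bind \<tau> (e \<tau> 0) e') ((All \<tau> ^^ n) \<phi>)"
      using Suc.prems(1)[OF e'] e by (simp add: valid_def)
    ultimately show "holds M e ((All \<tau> ^^ n) \<phi>)" by simp
  qed (rule Suc.prems(2))
qed simp

text \<open>Indices are counted separately for each type, so n quantifiers of one type bind all its
  indices below n. Doing this for each of the finitely many types gives a closure.\<close>

lemma closed_generalization:
  fixes M :: "'u hmodel"
  assumes "finite F" "free_vars va \<phi> \<subseteq> F \<times> {..<n}" "\<phi> \<in> generalizations A"
  shows "\<exists>\<psi>\<in>generalizations A. free_vars va \<psi> = {} \<and>
    ((\<forall>e. valid M e \<longrightarrow> holds M e \<psi>) \<longrightarrow> (\<forall>e. valid M e \<longrightarrow> holds M e \<phi>))"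
  using assms
proof (induction F arbitrary: \<phi> rule: finite_induct)
  case empty
  then show ?case by auto
next
  case (insert \<tau> F)
  let ?\<phi> = "(All \<tau> ^^ n) \<phi>"
  have "free_vars va ?\<phi> \<subseteq> F \<times> {..<n}"
    unfolding free_vars_All_pow using insert.prems(1) by (force split: if_splits)
  moreover have "?\<phi> \<in> generalizations A" by (rule generalizations_pow[OF insert.prems(2)])
  ultimately obtain \<psi> where \<psi>: "\<psi> \<in> generalizations A" "free_vars va \<psi> = {}"
    "\<And>e. (\<forall>e. valid M e \<longrightarrow> holds M e \<psi>) \<Longrightarrow> valid M e \<Longrightarrow> holds M e ?\<phi>"
    using insert.IH[of ?\<phi>] by blast
  have "holds M e \<phi>" if "\<forall>e. valid M e \<longrightarrow> holds M e \<psi>" "valid M e" for e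
    by (rule holds_All_pow[OF \<psi>(3)[OF that(1)] that(2)])
  then show ?case using \<psi>(1,2) by blast
qed

lemma universal_closures_matrix:
  assumes "\<phi> \<in> A" "\<And>e \<psi>. \<psi> \<in> universal_closures atom_vars A \<Longrightarrow> valid M e \<Longrightarrow> holds M e \<psi>"
    and "valid M e"
  shows "holds M e \<phi>"
proof -
  let ?V = "free_vars atom_vars \<phi>"
  have fin: "finite ?V" by (rule finite_free_vars[OF finite_atom_vars])
  then obtain n where n: "snd ` ?V \<subseteq> {..<n}" using finite_nat_iff_bounded by blast
  have "?V \<subseteq> fst ` ?V \<times> {..<n}" using n by (force simp: image_iff)
  from closed_generalization[OF _ this generalizations.base[OF assms(1)]] fin
  obtain \<psi> where "\<psi> \<in> generalizations A" "free_vars atom_vars \<psi> = {}"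
    "\<forall>e. valid M e \<longrightarrow> holds M e \<psi> \<Longrightarrow> holds M e \<phi>" using assms(3) by blast
  then show ?thesis using assms(2) by (auto simp: universal_closures_def)
qed

subsection \<open>Well-formedness of the axioms\<close>

lemma wf_generalizations:
  "\<phi> \<in> generalizations A \<Longrightarrow> (\<And>\<psi>. \<psi> \<in> A \<Longrightarrow> wf_form \<psi>) \<Longrightarrow> wf_form \<phi>"
  by (induction rule: generalizations.induct) simp_all

lemma wf_matrices: "\<phi> \<in> matrices \<Longrightarrow> wf_form \<phi>"
proof -
  have a: "wf_form \<phi>" if "\<phi> \<in> arith_axioms" for \<phi>
    using that by (auto simp: arith_axioms_def Let_def typed_iff)
  have c: "wf_form \<phi>" if "\<phi> \<in> combinator_axioms" for \<phi>
    using that by (auto simp: combinator_axioms_def Let_def typed_iff shift_def intro!: wf_Eqt)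
  have r: "wf_form \<phi>" if "\<phi> \<in> recursor_axioms" for \<phi>
    using that by (auto simp: recursor_axioms_def Let_def typed_iff)
  have x: "wf_form \<phi>" if "\<phi> \<in> extensionality_axioms" for \<phi>
    using that by (auto simp: extensionality_axioms_def Let_def typed_iff intro!: wf_Eqt)
  have i: "wf_form \<phi>" if \<phi>: "\<phi> \<in> qf_induction" for \<phi>
  proof -
    let ?\<sigma> = "\<lambda>\<rho> i. if \<rho> = N \<and> i = 0 then Var N 0 \<^bold>+ One else Var \<rho> i"
    obtain A where A: "wf_form A"
      "\<phi> = (inst N Zero A \<^bold>\<and> All N (A \<^bold>\<longrightarrow> subst_form ?\<sigma> A) \<^bold>\<longrightarrow> All N A)"
      using \<phi> by (auto simp: qf_induction_def)
    have "typed_subst ?\<sigma>" by (auto simp: typed_subst_def typed_iff)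
    then show ?thesis using A wf_subst wf_inst[OF A(1), of Zero N] by (simp add: typed_iff)
  qed
  have q: "wf_form \<phi>" if \<phi>: "\<phi> \<in> qf_choice" for \<phi>
  proof -
    let ?\<sigma> = "\<lambda>\<rho> i. if \<rho> = N then (case i of 0 \<Rightarrow> Var ty2 0 \<cdot> Var ty1 0 | Suc j \<Rightarrow> Var N j)
        else if \<rho> = ty2 then Var ty2 (Suc i) else Var \<rho> i"
    obtain A where A: "wf_form A"
      "\<phi> = (All ty1 (Ex N A) \<^bold>\<longrightarrow> Ex ty2 (All ty1 (subst_form ?\<sigma> A)))"
      using \<phi> unfolding qf_choice_def by blast
    have "typed_subst ?\<sigma>" by (auto simp: typed_subst_def typed_iff split: nat.split)
    then show ?thesis using A wf_subst by simp
  qed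
  have "wf_form Exists2" "wf_form BOOT_minus"
    by (simp_all add: Exists2_def BOOT_minus_def IsSet_def Let_def typed_iff shift_def)
  then show "\<phi> \<in> matrices \<Longrightarrow> wf_form \<phi>"
    using a c r x i q unfolding matrices_def by blast
qed

lemma free_vars_connectives [simp]:
  "free_vars va (\<^bold>\<not> \<phi>) = free_vars va \<phi>"
  "free_vars va (\<phi> \<^bold>\<and> \<psi>) = free_vars va \<phi> \<union> free_vars va \<psi>"
  "free_vars va (\<phi> \<^bold>\<or> \<psi>) = free_vars va \<phi> \<union> free_vars va \<psi>"
  "free_vars va (\<phi> \<^bold>\<longleftrightarrow> \<psi>) = free_vars va \<phi> \<union> free_vars va \<psi>"
  "free_vars va (Ex \<tau> \<phi>) = free_vars va (All \<tau> \<phi>)"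
  by (auto simp: Neg_def And_def Or_def Iff_def Ex_def)

lemma tm_vars_lift:
  "tm_vars (lift_tm \<tau> t) = (\<lambda>(r, j). (r, if r = \<tau> then Suc j else j)) ` tm_vars t"
  by (induction t) (auto simp: shift_def image_Un)

lemma free_vars_Eqt: "free_vars atom_vars (Eqt \<tau> t u) \<subseteq> tm_vars t \<union> tm_vars u"
proof (induction \<tau> arbitrary: t u)
  case (Fun \<rho> \<tau>)
  show ?case
  proof
    fix x assume "x \<in> free_vars atom_vars (Eqt (\<rho> \<leadsto> \<tau>) t u)"
    then obtain r i where x: "x = (r, i)" and "(r, if r = \<rho> then Suc i else i) \<in>
        free_vars atom_vars (Eqt \<tau> (lift_tm \<rho> t \<cdot> Var \<rho> 0) (lift_tm \<rho> u \<cdot> Var \<rho> 0))" by auto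
    with Fun.IH(2)[of "lift_tm \<rho> t \<cdot> Var \<rho> 0" "lift_tm \<rho> u \<cdot> Var \<rho> 0"]
    have "(r, if r = \<rho> then Suc i else i) \<in> tm_vars (lift_tm \<rho> t) \<or>
        (r, if r = \<rho> then Suc i else i) \<in> tm_vars (lift_tm \<rho> u)" by (auto split: if_splits)
    then show "x \<in> tm_vars t \<union> tm_vars u"
      unfolding x by (auto simp: tm_vars_lift split: if_splits)
  qed
qed simp

lemma extensionality_closed:
  assumes "\<phi> \<in> extensionality_axioms" shows "free_vars atom_vars \<phi> = {}"
proof -
  obtain \<rho> \<tau> where \<phi>: "\<phi> = All (\<rho> \<leadsto> \<tau>) (All \<rho> (All \<rho> (Eqt \<rho> (Var \<rho> 1) (Var \<rho> 0) \<^bold>\<longrightarrow>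
      Eqt \<tau> (Var (\<rho> \<leadsto> \<tau>) 0 \<cdot> Var \<rho> 1) (Var (\<rho> \<leadsto> \<tau>) 0 \<cdot> Var \<rho> 0))))"
    using assms by (auto simp: extensionality_axioms_def Let_def)
  let ?b = "Eqt \<rho> (Var \<rho> 1) (Var \<rho> 0) \<^bold>\<longrightarrow>
      Eqt \<tau> (Var (\<rho> \<leadsto> \<tau>) 0 \<cdot> Var \<rho> 1) (Var (\<rho> \<leadsto> \<tau>) 0 \<cdot> Var \<rho> 0)"
  have "free_vars atom_vars ?b \<subseteq> {(\<rho>, 0), (\<rho>, 1), (\<rho> \<leadsto> \<tau>, 0)}"
    using free_vars_Eqt[of \<rho> "Var \<rho> 1" "Var \<rho> 0"]
      free_vars_Eqt[of \<tau> "Var (\<rho> \<leadsto> \<tau>) 0 \<cdot> Var \<rho> 1" "Var (\<rho> \<leadsto> \<tau>) 0 \<cdot> Var \<rho> 0"] by auto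
  then show ?thesis unfolding \<phi> by (auto split: if_splits)
qed

theorem theorem4p3:
  shows "\<forall>\<phi> \<in> ATR0. ACA0\<omega> \<union> {BOOT_minus} \<turnstile> translate \<phi>"
proof
  fix \<phi> assume \<phi>: "\<phi> \<in> ATR0"
  let ?A = "arith_axioms \<union> combinator_axioms \<union> recursor_axioms \<union> extensionality_axioms \<union>
     qf_induction \<union> qf_choice"
  have T: "ACA0\<omega> \<union> {BOOT_minus} = universal_closures atom_vars ?A \<union> {Exists2, BOOT_minus}"
    by (auto simp: ACA0\<omega>_def RCA0\<omega>_def)
  have matrices: "matrices = ?A \<union> {Exists2, BOOT_minus}" by (simp add: matrices_def)
  show "ACA0\<omega> \<union> {BOOT_minus} \<turnstile> translate \<phi>"
    unfolding T
  proof (rule completeness)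
    fix \<psi> assume \<psi>: "\<psi> \<in> universal_closures atom_vars ?A \<union> {Exists2, BOOT_minus}"
    have "free_vars atom_vars Exists2 = {}"
      by (auto simp: Exists2_def Let_def)
    moreover have "free_vars atom_vars BOOT_minus = {}"
      by (auto simp: BOOT_minus_def IsSet_def Let_def shift_def)
    ultimately show "free_vars atom_vars \<psi> = {}"
      using \<psi> by (auto simp: universal_closures_def)
    show "wf_form \<psi>"
      using \<psi> wf_generalizations[of \<psi> ?A] wf_matrices unfolding universal_closures_def matrices by blast
  next
    have "extensionality_axioms \<subseteq> ?A" by blast
    then show "extensionality_axioms \<subseteq> universal_closures atom_vars ?A \<union> {Exists2, BOOT_minus}"
      using extensionality_closed generalizations.base unfolding universal_closures_def by blast
  next
    show "wf_form (translate \<phi>)" by (rule wf_translate)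
  next
    fix M :: "tm hmodel" and e
    assume M: "wf_hmodel M"
      and ax: "\<And>e \<psi>. \<psi> \<in> universal_closures atom_vars ?A \<union> {Exists2, BOOT_minus} \<Longrightarrow>
        valid M e \<Longrightarrow> holds M e \<psi>"
    \<comment> \<open>Closures are true in M by assumption, while the locale speaks of matrices
      under all valid assignments.\<close>
    interpret hoa M
    proof
      show "wf_hmodel M" by (rule M)
      fix \<psi> e assume \<psi>: "\<psi> \<in> matrices" and e: "valid M e"
      show "holds M e \<psi>"
      proof (cases "\<psi> \<in> ?A")
        case True
        from this ax[OF UnI1] e show ?thesis by (rule universal_closures_matrix)
      next
        case False
        then show ?thesis using \<psi> ax[OF UnI2] e unfolding matrices by blast
      qed
    qed
    obtain E Q L I where "hoa_char M E Q L I" using hoa_char_exists by blast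
    then interpret hoa_char M E Q L I .
    show "holds M e (translate \<phi>)" by (rule holds_ATR0[OF \<phi>])
  qed
qed

end
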